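(* Let $A$ be an Artin algebra and let $\ell\ell(A)$ be its Loewy length. Then $$\mathrm{IT.dist}(A)\le \max\{\ell\ell(A)-2,\,0\}.$$
   Context: Fix a commutative Artinian ring $k$. All algebras are Artin $k$-algebras with unit, and $A\text{-mod}$ denotes the category of finitely generated left $A$-modules. For $M\in A\text{-mod}$, $\Omega(M)$ is the kernel of a projective cover $P\to M$, $\Omega^0(M)=M$, and $\Omega^n(M)=\Omega(\Omega^{n-1}(M))$. For $U\in A\text{-mod}$, $\mathrm{add}(U)$ is the full subcategory of all direct summands of finite direct sums of copies of $U$. For nonnegative integers $m,n$, $A$ is an $(m,n)$-Igusa-Todorov algebra if there is $U\in A\text{-mod}$ such that for every $X\in A\text{-mod}$ there is an exact sequence $0\to U_m\to U_{m-1}\to\cdots\to U_1\to U_0\to\Omega^n(X)\to 0$ with $U_i\in\mathrm{add}(U)$ for $0\le i\le m$. The Igusa-Todorov distance of $A$ is $$\mathrm{IT.dist}(A):=\inf\{m\mid A\text{ is an }(m,n)\text{-Igusa-Todorov algebra for some } n\}.$$ *)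

theory Defs
  imports "HOL-Algebra.Module" "HOL-Algebra.Ideal_Product" "HOL-Library.Extended_Nat"
begin

section \<open>Left modules over a possibly noncommutative ring\<close>

text \<open>The locale \<^locale>\<open>module\<close> of the library requires a commutative ring of scalars, so left
  modules over an arbitrary ring are introduced here, on the same records. As for
  \<^locale>\<open>module\<close>, the fields \<open>mult\<close> and \<open>one\<close> of the record carry no meaning. The library
  locale \<^locale>\<open>submodule\<close> does not mention commutativity and is used as it is.\<close>

locale left_module = R?: ring R + M?: abelian_group M
  for R :: "('a, 'c) ring_scheme" (structure) and M :: "('a, 'm, 'd) module_scheme" (structure) +
  assumes smult_closed:
      "\<lbrakk>a \<in> carrier R; x \<in> carrier M\<rbrakk> \<Longrightarrow> a \<odot>\<^bsub>M\<^esub> x \<in> carrier M"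
    and smult_l_distr:
      "\<lbrakk>a \<in> carrier R; b \<in> carrier R; x \<in> carrier M\<rbrakk> \<Longrightarrow>
        (a \<oplus>\<^bsub>R\<^esub> b) \<odot>\<^bsub>M\<^esub> x = a \<odot>\<^bsub>M\<^esub> x \<oplus>\<^bsub>M\<^esub> b \<odot>\<^bsub>M\<^esub> x"
    and smult_r_distr:
      "\<lbrakk>a \<in> carrier R; x \<in> carrier M; y \<in> carrier M\<rbrakk> \<Longrightarrow>
        a \<odot>\<^bsub>M\<^esub> (x \<oplus>\<^bsub>M\<^esub> y) = a \<odot>\<^bsub>M\<^esub> x \<oplus>\<^bsub>M\<^esub> a \<odot>\<^bsub>M\<^esub> y"
    and smult_assoc:
      "\<lbrakk>a \<in> carrier R; b \<in> carrier R; x \<in> carrier M\<rbrakk> \<Longrightarrow>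
        (a \<otimes>\<^bsub>R\<^esub> b) \<odot>\<^bsub>M\<^esub> x = a \<odot>\<^bsub>M\<^esub> (b \<odot>\<^bsub>M\<^esub> x)"
    and smult_one:
      "x \<in> carrier M \<Longrightarrow> \<one>\<^bsub>R\<^esub> \<odot>\<^bsub>M\<^esub> x = x"

definition fin_gen :: "('a, 'c) ring_scheme \<Rightarrow> ('a, 'm, 'd) module_scheme \<Rightarrow> bool" where
  "fin_gen R M \<longleftrightarrow>
    (\<exists>(n::nat) g. g \<in> {..<n} \<rightarrow> carrier M \<and>
      (\<forall>x \<in> carrier M. \<exists>c \<in> {..<n} \<rightarrow> carrier R.
        x = (\<Oplus>\<^bsub>M\<^esub>i\<in>{..<n}. c i \<odot>\<^bsub>M\<^esub> g i)))"

definition fg_left_module :: "('a, 'c) ring_scheme \<Rightarrow> ('a, 'm, 'd) module_scheme \<Rightarrow> bool" where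
  "fg_left_module R M \<longleftrightarrow> left_module R M \<and> fin_gen R M"

definition module_hom ::
  "('a, 'c) ring_scheme \<Rightarrow> ('a, 'm, 'd) module_scheme \<Rightarrow> ('a, 'n, 'e) module_scheme \<Rightarrow> ('m \<Rightarrow> 'n) set"
  where
  "module_hom R M N = {f \<in> carrier M \<rightarrow> carrier N.
    (\<forall>x \<in> carrier M. \<forall>y \<in> carrier M. f (x \<oplus>\<^bsub>M\<^esub> y) = f x \<oplus>\<^bsub>N\<^esub> f y) \<and>
    (\<forall>a \<in> carrier R. \<forall>x \<in> carrier M. f (a \<odot>\<^bsub>M\<^esub> x) = a \<odot>\<^bsub>N\<^esub> f x)}"

definition module_iso ::
  "('a, 'c) ring_scheme \<Rightarrow> ('a, 'm, 'd) module_scheme \<Rightarrow> ('a, 'n, 'e) module_scheme \<Rightarrow> bool" where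
  "module_iso R M N \<longleftrightarrow> (\<exists>f \<in> module_hom R M N. bij_betw f (carrier M) (carrier N))"

text \<open>The direct sum of \<open>r\<close> copies of a module.\<close>

definition module_power :: "('a, 'm) module \<Rightarrow> nat \<Rightarrow> ('a, nat \<Rightarrow> 'm) module" where
  "module_power U r =
    \<lparr>carrier = {..<r} \<rightarrow>\<^sub>E carrier U,
     mult = (\<lambda>x y. \<lambda>i\<in>{..<r}. x i \<otimes>\<^bsub>U\<^esub> y i), one = (\<lambda>i\<in>{..<r}. \<one>\<^bsub>U\<^esub>),
     zero = (\<lambda>i\<in>{..<r}. \<zero>\<^bsub>U\<^esub>), add = (\<lambda>x y. \<lambda>i\<in>{..<r}. x i \<oplus>\<^bsub>U\<^esub> y i),
     smult = (\<lambda>a x. \<lambda>i\<in>{..<r}. a \<odot>\<^bsub>U\<^esub> x i)\<rparr>"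

definition direct_summand ::
  "('a, 'c) ring_scheme \<Rightarrow> 'm set \<Rightarrow> ('a, 'm) module \<Rightarrow> bool" where
  "direct_summand R N M \<longleftrightarrow> submodule N R M \<and>
    (\<exists>N'. submodule N' R M \<and> N <+>\<^bsub>M\<^esub> N' = carrier M \<and> N \<inter> N' = {\<zero>\<^bsub>M\<^esub>})"


section \<open>The category of finitely generated modules\<close>

text \<open>HOL cannot quantify over modules of all types. A module with \<open>n\<close> generators is a quotient
  of the free module of rank \<open>n\<close>, and the elements of such a quotient are sets of functions
  from \<^typ>\<open>nat\<close> to the ring. Hence every finitely generated module, whatever the type of its
  elements, is isomorphic to one of the following type (see \<open>fg_left_module_representative\<close>
  below), and it is enough to let quantifiers over the finitely generated modules range over
  this type.\<close>

type_synonym 'a fgmod = "('a, (nat \<Rightarrow> 'a) set) module"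

lemma fg_left_module_representative:
  fixes R :: "('a, 'c) ring_scheme" and M :: "('a, 'm, 'd) module_scheme"
  assumes "fg_left_module R M"
  shows "\<exists>N :: 'a fgmod. fg_left_module R N \<and> module_iso R M N"
proof -
  interpret left_module R M
    using assms by (simp add: fg_left_module_def)
  obtain n :: nat and g where g: "g \<in> {..<n} \<rightarrow> carrier M"
    and span: "\<And>x. x \<in> carrier M \<Longrightarrow>
      \<exists>c \<in> {..<n} \<rightarrow> carrier R. x = (\<Oplus>\<^bsub>M\<^esub>i\<in>{..<n}. c i \<odot>\<^bsub>M\<^esub> g i)"
    using assms unfolding fg_left_module_def fin_gen_def by blast
  define h where "h x = {c \<in> {..<n} \<rightarrow> carrier R. x = (\<Oplus>\<^bsub>M\<^esub>i\<in>{..<n}. c i \<odot>\<^bsub>M\<^esub> g i)}" for x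
  have inj: "inj_on h (carrier M)"
  proof (rule inj_onI)
    fix x y assume x: "x \<in> carrier M" and eq: "h x = h y"
    from span[OF x] obtain c where "c \<in> h x" by (auto simp: h_def)
    moreover from this eq have "c \<in> h y" by simp
    ultimately show "x = y" by (simp add: h_def)
  qed
  define u where "u = the_inv_into (carrier M) h"
  have uh [simp]: "u (h x) = x" if "x \<in> carrier M" for x
    using that inj by (simp add: u_def the_inv_into_f_f)
  define N :: "'a fgmod" where
    "N = \<lparr>carrier = h ` carrier M, mult = (\<lambda>x y. x), one = h \<zero>\<^bsub>M\<^esub>, zero = h \<zero>\<^bsub>M\<^esub>,
      add = (\<lambda>x y. h (u x \<oplus>\<^bsub>M\<^esub> u y)), smult = (\<lambda>a x. h (a \<odot>\<^bsub>M\<^esub> u x))\<rparr>"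
  have carN: "carrier N = h ` carrier M" by (simp add: N_def)
  have zeroN: "\<zero>\<^bsub>N\<^esub> = h \<zero>\<^bsub>M\<^esub>" by (simp add: N_def)
  have addN: "h x \<oplus>\<^bsub>N\<^esub> h y = h (x \<oplus>\<^bsub>M\<^esub> y)" if "x \<in> carrier M" "y \<in> carrier M" for x y
    using that by (simp add: N_def)
  have smultN: "a \<odot>\<^bsub>N\<^esub> h x = h (a \<odot>\<^bsub>M\<^esub> x)" if "x \<in> carrier M" for a x
    using that by (simp add: N_def)
  have "abelian_group N"
  proof (rule abelian_groupI)
    fix x assume "x \<in> carrier N"
    then obtain m where m: "m \<in> carrier M" "x = h m" by (auto simp: carN)
    then show "\<exists>y\<in>carrier N. y \<oplus>\<^bsub>N\<^esub> x = \<zero>\<^bsub>N\<^esub>"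
      by (intro bexI[of _ "h (\<ominus>\<^bsub>M\<^esub> m)"]) (auto simp: carN zeroN addN M.l_neg)
  qed (auto simp: carN zeroN addN M.a_ac)
  moreover have "left_module_axioms R N"
    by unfold_locales
      (auto simp: carN addN smultN smult_closed smult_l_distr smult_r_distr smult_assoc smult_one)
  ultimately have N: "left_module R N"
    using R.ring_axioms by (simp add: left_module_def)
  interpret N: abelian_group N by fact
  have sum: "h (\<Oplus>\<^bsub>M\<^esub>i\<in>I. f i) = (\<Oplus>\<^bsub>N\<^esub>i\<in>I. h (f i))"
    if "finite I" "f \<in> I \<rightarrow> carrier M" for I :: "nat set" and f
    using that
  proof (induction I rule: finite_induct)
    case (insert i I)
    then have f: "f i \<in> carrier M" "f \<in> I \<rightarrow> carrier M" by auto
    then have hf: "h (f i) \<in> carrier N" "(\<lambda>i. h (f i)) \<in> I \<rightarrow> carrier N" by (auto simp: carN)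
    show ?case
      using insert.hyps insert.IH f hf
      by (simp add: addN[symmetric])
  qed (simp add: zeroN)
  have "fin_gen R N"
    unfolding fin_gen_def
  proof (intro exI conjI ballI)
    show "(\<lambda>i. h (g i)) \<in> {..<n} \<rightarrow> carrier N" using g by (auto simp: carN)
    fix x assume "x \<in> carrier N"
    then obtain m where m: "m \<in> carrier M" "x = h m" by (auto simp: carN)
    obtain c where c: "c \<in> {..<n} \<rightarrow> carrier R" "m = (\<Oplus>\<^bsub>M\<^esub>i\<in>{..<n}. c i \<odot>\<^bsub>M\<^esub> g i)"
      using span[OF m(1)] by blast
    have cg: "(\<lambda>i. c i \<odot>\<^bsub>M\<^esub> g i) \<in> {..<n} \<rightarrow> carrier M"
      using c g by (auto intro!: smult_closed)
    have "x = (\<Oplus>\<^bsub>N\<^esub>i\<in>{..<n}. h (c i \<odot>\<^bsub>M\<^esub> g i))"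
      using sum[OF _ cg] m c by simp
    also have "\<dots> = (\<Oplus>\<^bsub>N\<^esub>i\<in>{..<n}. c i \<odot>\<^bsub>N\<^esub> h (g i))"
      using g cg by (intro N.finsum_cong') (auto simp: carN smultN Pi_iff)
    finally show "\<exists>c \<in> {..<n} \<rightarrow> carrier R. x = (\<Oplus>\<^bsub>N\<^esub>i\<in>{..<n}. c i \<odot>\<^bsub>N\<^esub> h (g i))"
      using c(1) by blast
  qed
  moreover have "h \<in> module_hom R M N"
    by (auto simp: module_hom_def carN addN smultN)
  moreover have "bij_betw h (carrier M) (carrier N)"
    using inj by (simp add: bij_betw_def carN)
  ultimately show ?thesis
    using N unfolding fg_left_module_def module_iso_def by blast
qed

definition projective_module :: "('a, 'c) ring_scheme \<Rightarrow> 'a fgmod \<Rightarrow> bool" where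
  "projective_module R P \<longleftrightarrow> fg_left_module R P \<and>
    (\<forall>(M :: 'a fgmod) (N :: 'a fgmod) f g.
      fg_left_module R M \<longrightarrow> fg_left_module R N \<longrightarrow>
      f \<in> module_hom R M N \<longrightarrow> f ` carrier M = carrier N \<longrightarrow> g \<in> module_hom R P N \<longrightarrow>
      (\<exists>h \<in> module_hom R P M. \<forall>x \<in> carrier P. f (h x) = g x))"

text \<open>A projective cover is an epimorphism from a projective module with superfluous kernel.\<close>

definition projective_cover ::
  "('a, 'c) ring_scheme \<Rightarrow> 'a fgmod \<Rightarrow> 'a fgmod \<Rightarrow> ((nat \<Rightarrow> 'a) set \<Rightarrow> (nat \<Rightarrow> 'a) set) \<Rightarrow> bool"
  where
  "projective_cover R P M p \<longleftrightarrow>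
    projective_module R P \<and> p \<in> module_hom R P M \<and> p ` carrier P = carrier M \<and>
    (\<forall>N. submodule N R P \<and> N <+>\<^bsub>P\<^esub> a_kernel P M p = carrier P \<longrightarrow> N = carrier P)"

text \<open>Projective covers, and with them syzygies, are unique only up to isomorphism. So
  \<open>nth_syzygy R n M K\<close> is a relation: \<open>K\<close> is a possible choice of \<open>\<Omega>\<^sup>n(M)\<close>.\<close>

definition syzygy :: "('a, 'c) ring_scheme \<Rightarrow> 'a fgmod \<Rightarrow> 'a fgmod \<Rightarrow> bool" where
  "syzygy R M K \<longleftrightarrow>
    (\<exists>P p. projective_cover R P M p \<and> K = P\<lparr>carrier := a_kernel P M p\<rparr>)"

primrec nth_syzygy :: "('a, 'c) ring_scheme \<Rightarrow> nat \<Rightarrow> 'a fgmod \<Rightarrow> 'a fgmod \<Rightarrow> bool" where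
  "nth_syzygy R 0 M K \<longleftrightarrow> K = M"
| "nth_syzygy R (Suc n) M K \<longleftrightarrow> (\<exists>L. nth_syzygy R n M L \<and> syzygy R L K)"

text \<open>Membership in \<open>add(U)\<close>, closed under isomorphism.\<close>

definition in_add :: "('a, 'c) ring_scheme \<Rightarrow> 'a fgmod \<Rightarrow> 'a fgmod \<Rightarrow> bool" where
  "in_add R U X \<longleftrightarrow> fg_left_module R X \<and>
    (\<exists>r N. direct_summand R N (module_power U r) \<and>
      module_iso R X ((module_power U r)\<lparr>carrier := N\<rparr>))"

text \<open>Exactness of \<open>0 \<rightarrow> V m \<rightarrow> \<dots> \<rightarrow> V 1 \<rightarrow> V 0 \<rightarrow> Y \<rightarrow> 0\<close>, where \<open>d 0\<close> is the map from
  \<open>V 0\<close> to \<open>Y\<close> and \<open>d (Suc i)\<close> the map from \<open>V (Suc i)\<close> to \<open>V i\<close>.\<close>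

definition exact_resolution ::
  "('a, 'c) ring_scheme \<Rightarrow> nat \<Rightarrow> (nat \<Rightarrow> 'a fgmod) \<Rightarrow>
    (nat \<Rightarrow> (nat \<Rightarrow> 'a) set \<Rightarrow> (nat \<Rightarrow> 'a) set) \<Rightarrow> 'a fgmod \<Rightarrow> bool" where
  "exact_resolution R m V d Y \<longleftrightarrow>
    d 0 \<in> module_hom R (V 0) Y \<and>
    (\<forall>i<m. d (Suc i) \<in> module_hom R (V (Suc i)) (V i)) \<and>
    d 0 ` carrier (V 0) = carrier Y \<and>
    (\<forall>i<m. d (Suc i) ` carrier (V (Suc i)) =
      a_kernel (V i) (case i of 0 \<Rightarrow> Y | Suc j \<Rightarrow> V j) (d i)) \<and>
    inj_on (d m) (carrier (V m))"


section \<open>Igusa-Todorov distance\<close>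

definition igusa_todorov_algebra :: "nat \<Rightarrow> nat \<Rightarrow> ('a, 'c) ring_scheme \<Rightarrow> bool" where
  "igusa_todorov_algebra m n A \<longleftrightarrow>
    (\<exists>U :: 'a fgmod. fg_left_module A U \<and>
      (\<forall>X :: 'a fgmod. fg_left_module A X \<longrightarrow>
        (\<exists>Y V d. nth_syzygy A n X Y \<and> (\<forall>i\<le>m. in_add A U (V i)) \<and>
          exact_resolution A m V d Y)))"

text \<open>The infimum is taken in \<^typ>\<open>enat\<close>, where the infimum of the empty set is \<open>\<infinity>\<close>.\<close>

definition IT_dist :: "('a, 'c) ring_scheme \<Rightarrow> enat" where
  "IT_dist A = Inf {enat m | m. \<exists>n. igusa_todorov_algebra m n A}"


section \<open>Loewy length and Artin algebras\<close>

definition regular_module :: "('a, 'c) ring_scheme \<Rightarrow> ('a, 'a) module" where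
  "regular_module R = \<lparr>carrier = carrier R, mult = mult R, one = one R, zero = zero R,
    add = add R, smult = mult R\<rparr>"

definition maximal_left_ideal :: "'a set \<Rightarrow> ('a, 'c) ring_scheme \<Rightarrow> bool" where
  "maximal_left_ideal I R \<longleftrightarrow> submodule I R (regular_module R) \<and> I \<noteq> carrier R \<and>
    (\<forall>J. submodule J R (regular_module R) \<and> I \<subseteq> J \<longrightarrow> J = I \<or> J = carrier R)"

definition jacobson_radical :: "('a, 'c) ring_scheme \<Rightarrow> 'a set" where
  "jacobson_radical R = carrier R \<inter> \<Inter>{I. maximal_left_ideal I R}"

primrec radical_power :: "('a, 'c) ring_scheme \<Rightarrow> nat \<Rightarrow> 'a set" where
  "radical_power R 0 = carrier R"
| "radical_power R (Suc n) = ideal_prod R (jacobson_radical R) (radical_power R n)"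

text \<open>Such an \<open>n\<close> exists for every Artin algebra, because its radical is nilpotent. The Loewy
  length of the zero ring is \<open>0\<close>.\<close>

definition loewy_length :: "('a, 'c) ring_scheme \<Rightarrow> nat" where
  "loewy_length R = (LEAST n. radical_power R n = {\<zero>\<^bsub>R\<^esub>})"

locale artinian_cring = cring R for R :: "('a, 'c) ring_scheme" (structure) +
  assumes descending_chain_condition:
    "\<lbrakk>\<And>i::nat. ideal (I i) R; \<And>i. I (Suc i) \<subseteq> I i\<rbrakk> \<Longrightarrow> \<exists>n. \<forall>i\<ge>n. I i = I n"

text \<open>The \<open>k\<close>-algebra structure is given by a ring homomorphism \<open>\<phi>\<close> into the centre of \<open>A\<close>.\<close>

locale artin_algebra = k?: artinian_cring k + A?: ring A
  for k :: "('k, 'e) ring_scheme" and A :: "('a, 'c) ring_scheme" and \<phi> :: "'k \<Rightarrow> 'a" +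
  assumes structure_hom: "\<phi> \<in> ring_hom k A"
    and central: "\<lbrakk>c \<in> carrier k; x \<in> carrier A\<rbrakk> \<Longrightarrow> \<phi> c \<otimes>\<^bsub>A\<^esub> x = x \<otimes>\<^bsub>A\<^esub> \<phi> c"
    and finite_over_base:
      "fin_gen k \<lparr>carrier = carrier A, mult = mult A, one = one A, zero = zero A,
        add = add A, smult = (\<lambda>c x. \<phi> c \<otimes>\<^bsub>A\<^esub> x)\<rparr>"

end

theory Submission
  imports Defs
begin

text \<open>Let \<open>J\<close> be the radical of \<open>A\<close> and \<open>l\<close> the Loewy length. The test module is
  \<open>U = A/J \<oplus> A/J\<^sup>2 \<oplus> \<dots> \<oplus> A/J\<^sup>m\<^sup>+\<^sup>1\<close> with \<open>m = max (l - 2) 0\<close>. Everything rests on one step. Let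
  \<open>Y\<close> be a finitely generated module with \<open>J\<^sup>t Y = 0\<close>, where \<open>t \<ge> 1\<close>, and let \<open>N \<rightarrow> Y\<close> be a
  projective cover. Then \<open>N / J\<^sup>t N\<close> still maps onto \<open>Y\<close>, it lies in \<open>add(A/J\<^sup>t)\<close>, and because
  the kernel of \<open>N \<rightarrow> Y\<close> is contained in \<open>J N\<close>, the kernel of \<open>N / J\<^sup>t N \<rightarrow> Y\<close> is killed by
  \<open>J\<^sup>t\<^sup>-\<^sup>1\<close>. Repeating the step until the kernel is killed by \<open>J\<^sup>0 = A\<close> yields a resolution of
  length \<open>t - 1\<close> by objects of \<open>add(U)\<close>, for all \<open>t \<le> m + 1\<close> (\<open>layer_resolution\<close>).

  If \<open>l \<ge> 2\<close>, a syzygy \<open>Y = \<Omega>(X)\<close> is the kernel of a projective cover and is therefore killed by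
  \<open>J\<^sup>l\<^sup>-\<^sup>1\<close>, so that the case \<open>t = l - 1\<close> gives length \<open>l - 2\<close>. If \<open>l \<le> 1\<close>, every module is
  killed by \<open>J\<close>, and the case \<open>t = 1\<close> applies to \<open>X = \<Omega>\<^sup>0(X)\<close> itself.

  Projective covers are constructed as direct summands \<open>N\<close> of free modules, minimal among the
  submodules that map onto \<open>Y\<close> (\<open>exists_minimal_cover\<close>); this needs only the descending chain
  condition. That the kernels are again finitely generated comes from the base ring: over a
  commutative Artinian ring, modules with the descending chain condition are Noetherian
  (\<open>artinian_imp_noetherian\<close>). The nilpotency of \<open>J\<close> (\<open>radical_nilpotent\<close>) ensures that the Loewy
  length is the least \<open>l\<close> with \<open>J\<^sup>l = 0\<close>, and not an arbitrary value.\<close>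


section \<open>Submodules of left modules\<close>

context left_module
begin

declare smult_closed [simp, intro] smult_one [simp]

lemma smult_zero_left [simp]:
  assumes "x \<in> carrier M"
  shows "\<zero>\<^bsub>R\<^esub> \<odot>\<^bsub>M\<^esub> x = \<zero>\<^bsub>M\<^esub>"
proof -
  have "\<zero>\<^bsub>R\<^esub> \<odot>\<^bsub>M\<^esub> x = \<zero>\<^bsub>R\<^esub> \<odot>\<^bsub>M\<^esub> x \<oplus>\<^bsub>M\<^esub> \<zero>\<^bsub>R\<^esub> \<odot>\<^bsub>M\<^esub> x"
    using smult_l_distr[of "\<zero>\<^bsub>R\<^esub>" "\<zero>\<^bsub>R\<^esub>" x] assms by simp
  then show ?thesis
    using assms by (metis M.add.r_cancel_one' R.zero_closed smult_closed)
qed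

lemma smult_zero_right [simp]:
  assumes "a \<in> carrier R"
  shows "a \<odot>\<^bsub>M\<^esub> \<zero>\<^bsub>M\<^esub> = \<zero>\<^bsub>M\<^esub>"
proof -
  have "a \<odot>\<^bsub>M\<^esub> \<zero>\<^bsub>M\<^esub> = a \<odot>\<^bsub>M\<^esub> \<zero>\<^bsub>M\<^esub> \<oplus>\<^bsub>M\<^esub> a \<odot>\<^bsub>M\<^esub> \<zero>\<^bsub>M\<^esub>"
    using smult_r_distr[of a "\<zero>\<^bsub>M\<^esub>" "\<zero>\<^bsub>M\<^esub>"] assms by simp
  then show ?thesis
    using assms by (metis M.add.r_cancel_one' M.zero_closed smult_closed)
qed

lemma smult_minus_left:
  assumes "a \<in> carrier R" "x \<in> carrier M"
  shows "(\<ominus>\<^bsub>R\<^esub> a) \<odot>\<^bsub>M\<^esub> x = \<ominus>\<^bsub>M\<^esub> (a \<odot>\<^bsub>M\<^esub> x)"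
proof -
  have "(\<ominus>\<^bsub>R\<^esub> a) \<odot>\<^bsub>M\<^esub> x \<oplus>\<^bsub>M\<^esub> a \<odot>\<^bsub>M\<^esub> x = \<zero>\<^bsub>M\<^esub>"
    using smult_l_distr[of "\<ominus>\<^bsub>R\<^esub> a" a x] assms by (simp add: R.l_neg)
  then show ?thesis
    using assms M.minus_equality by (metis R.a_inv_closed smult_closed)
qed

lemma smult_minus_one:
  assumes "x \<in> carrier M"
  shows "(\<ominus>\<^bsub>R\<^esub> \<one>\<^bsub>R\<^esub>) \<odot>\<^bsub>M\<^esub> x = \<ominus>\<^bsub>M\<^esub> x"
  using assms by (simp add: smult_minus_left)

lemma submodule_iff:
  "submodule S R M \<longleftrightarrow> S \<subseteq> carrier M \<and> \<zero>\<^bsub>M\<^esub> \<in> S \<and> (\<forall>x\<in>S. \<forall>y\<in>S. x \<oplus>\<^bsub>M\<^esub> y \<in> S) \<and>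
     (\<forall>a\<in>carrier R. \<forall>x\<in>S. a \<odot>\<^bsub>M\<^esub> x \<in> S)" (is "_ \<longleftrightarrow> ?P")
proof
  assume "submodule S R M"
  then interpret submodule S R M .
  show ?P
    using subset m_closed one_closed by auto
next
  assume P: ?P
  have "\<ominus>\<^bsub>M\<^esub> x \<in> S" if "x \<in> S" for x
    using P that smult_minus_one[of x] by (metis R.a_inv_closed R.one_closed subsetD)
  then show "submodule S R M"
    using P by (intro submodule.intro subgroup.intro submodule_axioms.intro)
      (auto simp: a_inv_def)
qed

lemma submoduleI:
  assumes "S \<subseteq> carrier M" "\<zero>\<^bsub>M\<^esub> \<in> S" "\<And>x y. x \<in> S \<Longrightarrow> y \<in> S \<Longrightarrow> x \<oplus>\<^bsub>M\<^esub> y \<in> S"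
    "\<And>a x. a \<in> carrier R \<Longrightarrow> x \<in> S \<Longrightarrow> a \<odot>\<^bsub>M\<^esub> x \<in> S"
  shows "submodule S R M"
  using assms by (simp add: submodule_iff)

lemma submoduleD:
  assumes "submodule S R M"
  shows "S \<subseteq> carrier M" "\<And>x. x \<in> S \<Longrightarrow> x \<in> carrier M" "\<zero>\<^bsub>M\<^esub> \<in> S"
    "\<And>x y. x \<in> S \<Longrightarrow> y \<in> S \<Longrightarrow> x \<oplus>\<^bsub>M\<^esub> y \<in> S"
    "\<And>a x. a \<in> carrier R \<Longrightarrow> x \<in> S \<Longrightarrow> a \<odot>\<^bsub>M\<^esub> x \<in> S"
    "\<And>x. x \<in> S \<Longrightarrow> \<ominus>\<^bsub>M\<^esub> x \<in> S"
    "\<And>x y. x \<in> S \<Longrightarrow> y \<in> S \<Longrightarrow> x \<ominus>\<^bsub>M\<^esub> y \<in> S"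
proof -
  show 1: "S \<subseteq> carrier M" "\<And>x. x \<in> S \<Longrightarrow> x \<in> carrier M" "\<zero>\<^bsub>M\<^esub> \<in> S"
    and 2: "\<And>x y. x \<in> S \<Longrightarrow> y \<in> S \<Longrightarrow> x \<oplus>\<^bsub>M\<^esub> y \<in> S"
    and 3: "\<And>a x. a \<in> carrier R \<Longrightarrow> x \<in> S \<Longrightarrow> a \<odot>\<^bsub>M\<^esub> x \<in> S"
    using assms by (auto simp: submodule_iff)
  show 4: "\<And>x. x \<in> S \<Longrightarrow> \<ominus>\<^bsub>M\<^esub> x \<in> S"
    using 1 3 by (metis R.a_inv_closed R.one_closed smult_minus_one)
  show "\<And>x y. x \<in> S \<Longrightarrow> y \<in> S \<Longrightarrow> x \<ominus>\<^bsub>M\<^esub> y \<in> S"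
    using 2 4 by (simp add: a_minus_def)
qed

lemma submodule_carrier: "submodule (carrier M) R M"
  by (rule submoduleI) auto

lemma submodule_zero: "submodule {\<zero>\<^bsub>M\<^esub>} R M"
  by (rule submoduleI) auto

lemma submodule_Int:
  assumes "submodule S R M" "submodule T R M"
  shows "submodule (S \<inter> T) R M"
  using assms by (auto simp: submodule_iff)

lemma set_addI:
  assumes "x \<in> S" "y \<in> T"
  shows "x \<oplus>\<^bsub>M\<^esub> y \<in> S <+>\<^bsub>M\<^esub> T"
  using assms by (auto simp: set_add_def')

lemma set_addE:
  assumes "z \<in> S <+>\<^bsub>M\<^esub> T"
  obtains x y where "x \<in> S" "y \<in> T" "z = x \<oplus>\<^bsub>M\<^esub> y"
  using assms by (auto simp: set_add_def')

lemma submodule_set_add: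
  assumes S: "submodule S R M" and T: "submodule T R M"
  shows "submodule (S <+>\<^bsub>M\<^esub> T) R M"
proof (rule submoduleI)
  note s = submoduleD[OF S] and t = submoduleD[OF T]
  show "S <+>\<^bsub>M\<^esub> T \<subseteq> carrier M"
    using s(2) t(2) by (auto elim!: set_addE)
  show "\<zero>\<^bsub>M\<^esub> \<in> S <+>\<^bsub>M\<^esub> T"
    using set_addI[OF s(3) t(3)] by simp
  show "x \<oplus>\<^bsub>M\<^esub> y \<in> S <+>\<^bsub>M\<^esub> T" if x: "x \<in> S <+>\<^bsub>M\<^esub> T" and y: "y \<in> S <+>\<^bsub>M\<^esub> T" for x y
  proof -
    obtain a b where a: "a \<in> S" "b \<in> T" "x = a \<oplus>\<^bsub>M\<^esub> b" using x by (rule set_addE)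
    obtain c d where c: "c \<in> S" "d \<in> T" "y = c \<oplus>\<^bsub>M\<^esub> d" using y by (rule set_addE)
    have "x \<oplus>\<^bsub>M\<^esub> y = (a \<oplus>\<^bsub>M\<^esub> c) \<oplus>\<^bsub>M\<^esub> (b \<oplus>\<^bsub>M\<^esub> d)"
      using a c s(2) t(2) by (simp add: M.a_ac)
    then show ?thesis using a c s(4) t(4) by (simp add: set_addI)
  qed
  show "r \<odot>\<^bsub>M\<^esub> x \<in> S <+>\<^bsub>M\<^esub> T" if r: "r \<in> carrier R" and x: "x \<in> S <+>\<^bsub>M\<^esub> T" for r x
  proof -
    obtain a b where a: "a \<in> S" "b \<in> T" "x = a \<oplus>\<^bsub>M\<^esub> b" using x by (rule set_addE)
    have "r \<odot>\<^bsub>M\<^esub> x = r \<odot>\<^bsub>M\<^esub> a \<oplus>\<^bsub>M\<^esub> r \<odot>\<^bsub>M\<^esub> b"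
      using a r s(2) t(2) by (simp add: smult_r_distr)
    then show ?thesis using a r s(5) t(5) by (simp add: set_addI)
  qed
qed

lemma set_add_upper1:
  assumes "submodule S R M" "submodule T R M"
  shows "S \<subseteq> S <+>\<^bsub>M\<^esub> T"
proof
  fix x assume "x \<in> S"
  then show "x \<in> S <+>\<^bsub>M\<^esub> T"
    using set_addI[of x S "\<zero>\<^bsub>M\<^esub>" T] submoduleD[OF assms(1)] submoduleD[OF assms(2)] by simp
qed

lemma set_add_upper2:
  assumes "submodule S R M" "submodule T R M"
  shows "T \<subseteq> S <+>\<^bsub>M\<^esub> T"
proof
  fix x assume "x \<in> T"
  then show "x \<in> S <+>\<^bsub>M\<^esub> T"
    using set_addI[of "\<zero>\<^bsub>M\<^esub>" S x T] submoduleD[OF assms(1)] submoduleD[OF assms(2)] by simp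
qed

lemma submodule_cyclic:
  assumes "x \<in> carrier M"
  shows "submodule {a \<odot>\<^bsub>M\<^esub> x | a. a \<in> carrier R} R M"
proof (rule submoduleI)
  show "\<zero>\<^bsub>M\<^esub> \<in> {a \<odot>\<^bsub>M\<^esub> x | a. a \<in> carrier R}"
    using assms by (auto intro!: exI[of _ "\<zero>\<^bsub>R\<^esub>"])
next
  fix y z assume "y \<in> {a \<odot>\<^bsub>M\<^esub> x | a. a \<in> carrier R}" "z \<in> {a \<odot>\<^bsub>M\<^esub> x | a. a \<in> carrier R}"
  then obtain a b where "a \<in> carrier R" "b \<in> carrier R" "y = a \<odot>\<^bsub>M\<^esub> x" "z = b \<odot>\<^bsub>M\<^esub> x" by blast
  then show "y \<oplus>\<^bsub>M\<^esub> z \<in> {a \<odot>\<^bsub>M\<^esub> x | a. a \<in> carrier R}"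
    using assms by (auto intro!: exI[of _ "a \<oplus>\<^bsub>R\<^esub> b"] simp: smult_l_distr)
next
  fix b y assume "b \<in> carrier R" "y \<in> {a \<odot>\<^bsub>M\<^esub> x | a. a \<in> carrier R}"
  moreover then obtain a where "a \<in> carrier R" "y = a \<odot>\<^bsub>M\<^esub> x" by blast
  ultimately show "b \<odot>\<^bsub>M\<^esub> y \<in> {a \<odot>\<^bsub>M\<^esub> x | a. a \<in> carrier R}"
    using assms by (auto intro!: exI[of _ "b \<otimes>\<^bsub>R\<^esub> a"] simp: smult_assoc)
qed (use assms in auto)

lemma cyclic_self:
  assumes "x \<in> carrier M"
  shows "x \<in> {a \<odot>\<^bsub>M\<^esub> x | a. a \<in> carrier R}"
  using assms by (auto intro!: exI[of _ "\<one>\<^bsub>R\<^esub>"])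

lemma submodule_left_module:
  assumes S: "submodule S R M"
  shows "left_module R (M\<lparr>carrier := S\<rparr>)"
proof -
  note s = submoduleD[OF S]
  have "abelian_group (M\<lparr>carrier := S\<rparr>)"
  proof (rule abelian_groupI)
    fix x assume "x \<in> carrier (M\<lparr>carrier := S\<rparr>)"
    then show "\<exists>y\<in>carrier (M\<lparr>carrier := S\<rparr>). y \<oplus>\<^bsub>M\<lparr>carrier := S\<rparr>\<^esub> x = \<zero>\<^bsub>M\<lparr>carrier := S\<rparr>\<^esub>"
      using s by (auto intro!: bexI[of _ "\<ominus>\<^bsub>M\<^esub> x"] simp: M.l_neg)
  qed (use s in \<open>auto simp: M.a_ac\<close>)
  moreover have "left_module_axioms R (M\<lparr>carrier := S\<rparr>)"
    using s by unfold_locales (auto simp: smult_l_distr smult_r_distr smult_assoc)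
  ultimately show ?thesis
    using R.ring_axioms by (simp add: left_module_def)
qed

lemma submodule_of_submodule_iff:
  assumes S: "submodule S R M"
  shows "submodule T R (M\<lparr>carrier := S\<rparr>) \<longleftrightarrow> submodule T R M \<and> T \<subseteq> S"
proof -
  interpret S: left_module R "M\<lparr>carrier := S\<rparr>" by (rule submodule_left_module[OF S])
  show ?thesis
    using submoduleD(1)[OF S] unfolding S.submodule_iff submodule_iff by auto
qed

text \<open>A submodule avoiding \<open>x\<close> lies in one that is maximal among those avoiding \<open>x\<close>.\<close>

lemma exists_maximal_avoiding:
  assumes T0: "submodule T0 R M" "x \<notin> T0"
  obtains T where "submodule T R M" "T0 \<subseteq> T" "x \<notin> T"
    "\<And>T'. submodule T' R M \<Longrightarrow> T \<subseteq> T' \<Longrightarrow> x \<notin> T' \<Longrightarrow> T' = T"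
proof -
  define F where "F = {T. submodule T R M \<and> T0 \<subseteq> T \<and> x \<notin> T}"
  have "\<exists>U\<in>F. \<forall>X\<in>C. X \<subseteq> U" if C: "C \<in> chains F" for C
  proof (cases "C = {}")
    case True
    then show ?thesis using T0 by (auto simp: F_def)
  next
    case False
    have sub: "\<And>X. X \<in> C \<Longrightarrow> submodule X R M \<and> T0 \<subseteq> X \<and> x \<notin> X"
      and lin: "\<And>X Y. X \<in> C \<Longrightarrow> Y \<in> C \<Longrightarrow> X \<subseteq> Y \<or> Y \<subseteq> X"
      using C by (auto simp: F_def chains_def chain_subset_def)
    have "submodule (\<Union>C) R M"
    proof (rule submoduleI)
      show "\<Union>C \<subseteq> carrier M" using sub submoduleD(1) by blast
      show "\<zero>\<^bsub>M\<^esub> \<in> \<Union>C" using sub submoduleD(3) False by blast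
      fix a y assume "a \<in> carrier R" "y \<in> \<Union>C"
      then show "a \<odot>\<^bsub>M\<^esub> y \<in> \<Union>C" using sub submoduleD(5) by blast
    next
      fix y z assume "y \<in> \<Union>C" "z \<in> \<Union>C"
      then obtain X Y where "X \<in> C" "Y \<in> C" "y \<in> X" "z \<in> Y" by blast
      then obtain Z where "Z \<in> C" "y \<in> Z" "z \<in> Z" using lin by blast
      then show "y \<oplus>\<^bsub>M\<^esub> z \<in> \<Union>C" using sub submoduleD(4) by blast
    qed
    moreover have "T0 \<subseteq> \<Union>C" "x \<notin> \<Union>C" using sub False by blast+
    ultimately have "\<Union>C \<in> F" by (simp add: F_def)
    then show ?thesis by blast
  qed
  then obtain T where "T \<in> F" "\<forall>X\<in>F. T \<subseteq> X \<longrightarrow> X = T"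
    using Zorn_Lemma2[of F] by blast
  then show thesis
    using that[of T] by (auto simp: F_def)
qed

end


section \<open>Finite generation\<close>

text \<open>\<open>S\<close> is finitely generated if some finite subset of it lies in no smaller submodule.\<close>

definition fg_submodule ::
  "('a, 'c) ring_scheme \<Rightarrow> ('a, 'm, 'd) module_scheme \<Rightarrow> 'm set \<Rightarrow> bool" where
  "fg_submodule R M S \<longleftrightarrow> submodule S R M \<and>
    (\<exists>G. finite G \<and> G \<subseteq> S \<and> (\<forall>T. submodule T R M \<longrightarrow> G \<subseteq> T \<longrightarrow> S \<subseteq> T))"

text \<open>The linear combination of \<open>g\<close> with coefficients \<open>c\<close>.\<close>

definition lincomb ::
  "('a, 'm, 'd) module_scheme \<Rightarrow> nat \<Rightarrow> (nat \<Rightarrow> 'm) \<Rightarrow> (nat \<Rightarrow> 'a) \<Rightarrow> 'm" where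
  "lincomb M n g c = (\<Oplus>\<^bsub>M\<^esub>i\<in>{..<n}. c i \<odot>\<^bsub>M\<^esub> g i)"

context left_module
begin

lemma lincomb_closed [simp, intro]:
  assumes "g \<in> {..<n} \<rightarrow> carrier M" "c \<in> {..<n} \<rightarrow> carrier R"
  shows "lincomb M n g c \<in> carrier M"
  using assms by (auto simp: lincomb_def intro!: M.finsum_closed)

lemma lincomb_in_submodule:
  assumes "submodule T R M" "g \<in> {..<n} \<rightarrow> T" "c \<in> {..<n} \<rightarrow> carrier R"
  shows "lincomb M n g c \<in> T"
proof -
  note t = submoduleD[OF assms(1)]
  have "(\<Oplus>\<^bsub>M\<^esub>i\<in>I. c i \<odot>\<^bsub>M\<^esub> g i) \<in> T" if "finite I" "I \<subseteq> {..<n}" for I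
    using that
  proof (induction I rule: finite_induct)
    case (insert i I)
    then have "c i \<odot>\<^bsub>M\<^esub> g i \<in> T" "(\<lambda>i. c i \<odot>\<^bsub>M\<^esub> g i) \<in> I \<rightarrow> T"
      using assms t(5) by (auto simp: Pi_iff)
    moreover from this have "(\<lambda>i. c i \<odot>\<^bsub>M\<^esub> g i) \<in> I \<rightarrow> carrier M" using t(2) by auto
    ultimately show ?case using insert t by simp
  qed (use t in simp)
  then show ?thesis by (simp add: lincomb_def)
qed

lemma lincomb_cong:
  assumes "\<And>i. i < n \<Longrightarrow> c i = d i" "g \<in> {..<n} \<rightarrow> carrier M" "d \<in> {..<n} \<rightarrow> carrier R"
  shows "lincomb M n g c = lincomb M n g d"
  unfolding lincomb_def using assms by (intro M.finsum_cong') auto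

lemma lincomb_add:
  assumes "g \<in> {..<n} \<rightarrow> carrier M" "c \<in> {..<n} \<rightarrow> carrier R" "d \<in> {..<n} \<rightarrow> carrier R"
  shows "lincomb M n g (\<lambda>i. c i \<oplus>\<^bsub>R\<^esub> d i) = lincomb M n g c \<oplus>\<^bsub>M\<^esub> lincomb M n g d"
proof -
  have "lincomb M n g (\<lambda>i. c i \<oplus>\<^bsub>R\<^esub> d i) =
      (\<Oplus>\<^bsub>M\<^esub>i\<in>{..<n}. c i \<odot>\<^bsub>M\<^esub> g i \<oplus>\<^bsub>M\<^esub> d i \<odot>\<^bsub>M\<^esub> g i)"
    unfolding lincomb_def using assms
    by (intro M.finsum_cong') (auto simp: smult_l_distr Pi_iff)
  also have "\<dots> = lincomb M n g c \<oplus>\<^bsub>M\<^esub> lincomb M n g d"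
    unfolding lincomb_def using assms by (intro M.finsum_addf) (auto simp: Pi_iff)
  finally show ?thesis .
qed

lemma finsum_smult:
  assumes "finite I" "f \<in> I \<rightarrow> carrier M" "a \<in> carrier R"
  shows "(\<Oplus>\<^bsub>M\<^esub>i\<in>I. a \<odot>\<^bsub>M\<^esub> f i) = a \<odot>\<^bsub>M\<^esub> (\<Oplus>\<^bsub>M\<^esub>i\<in>I. f i)"
  using assms(1,2)
proof (induction I rule: finite_induct)
  case (insert i I)
  then have "f i \<in> carrier M" "f \<in> I \<rightarrow> carrier M" "(\<lambda>i. a \<odot>\<^bsub>M\<^esub> f i) \<in> I \<rightarrow> carrier M"
    using assms(3) by (auto simp: Pi_iff)
  then show ?case
    using insert assms(3) by (simp add: smult_r_distr M.finsum_closed)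
qed (use assms in simp)

lemma lincomb_smult:
  assumes "g \<in> {..<n} \<rightarrow> carrier M" "c \<in> {..<n} \<rightarrow> carrier R" "a \<in> carrier R"
  shows "lincomb M n g (\<lambda>i. a \<otimes>\<^bsub>R\<^esub> c i) = a \<odot>\<^bsub>M\<^esub> lincomb M n g c"
proof -
  have "lincomb M n g (\<lambda>i. a \<otimes>\<^bsub>R\<^esub> c i) = (\<Oplus>\<^bsub>M\<^esub>i\<in>{..<n}. a \<odot>\<^bsub>M\<^esub> (c i \<odot>\<^bsub>M\<^esub> g i))"
    unfolding lincomb_def using assms by (intro M.finsum_cong') (auto simp: smult_assoc Pi_iff)
  also have "\<dots> = a \<odot>\<^bsub>M\<^esub> lincomb M n g c"
    unfolding lincomb_def using assms by (intro finsum_smult) (auto simp: Pi_iff)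
  finally show ?thesis .
qed

lemma lincomb_unit:
  assumes "g \<in> {..<n} \<rightarrow> carrier M" "j < n"
  shows "lincomb M n g (\<lambda>i. if i = j then \<one>\<^bsub>R\<^esub> else \<zero>\<^bsub>R\<^esub>) = g j"
proof -
  have "lincomb M n g (\<lambda>i. if i = j then \<one>\<^bsub>R\<^esub> else \<zero>\<^bsub>R\<^esub>) =
      (\<Oplus>\<^bsub>M\<^esub>i\<in>{..<n}. if j = i then g i else \<zero>\<^bsub>M\<^esub>)"
    unfolding lincomb_def using assms by (intro M.finsum_cong') (auto simp: Pi_iff)
  also have "\<dots> = g j"
    using assms by (intro M.finsum_singleton) auto
  finally show ?thesis .
qed

lemma submodule_lincombs:
  assumes "g \<in> {..<n} \<rightarrow> carrier M"
  shows "submodule (lincomb M n g ` ({..<n} \<rightarrow> carrier R)) R M"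
proof (rule submoduleI)
  have "lincomb M n g (\<lambda>i. \<zero>\<^bsub>R\<^esub> \<otimes>\<^bsub>R\<^esub> \<zero>\<^bsub>R\<^esub>) = \<zero>\<^bsub>R\<^esub> \<odot>\<^bsub>M\<^esub> lincomb M n g (\<lambda>i. \<zero>\<^bsub>R\<^esub>)"
    using assms by (intro lincomb_smult) auto
  also have "\<dots> = \<zero>\<^bsub>M\<^esub>" using assms by auto
  finally show "\<zero>\<^bsub>M\<^esub> \<in> lincomb M n g ` ({..<n} \<rightarrow> carrier R)"
    by (intro image_eqI[of _ _ "\<lambda>i. \<zero>\<^bsub>R\<^esub> \<otimes>\<^bsub>R\<^esub> \<zero>\<^bsub>R\<^esub>"]) auto
next
  fix x y assume "x \<in> lincomb M n g ` ({..<n} \<rightarrow> carrier R)"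
    "y \<in> lincomb M n g ` ({..<n} \<rightarrow> carrier R)"
  then obtain c d where "c \<in> {..<n} \<rightarrow> carrier R" "d \<in> {..<n} \<rightarrow> carrier R"
    "x = lincomb M n g c" "y = lincomb M n g d" by blast
  then show "x \<oplus>\<^bsub>M\<^esub> y \<in> lincomb M n g ` ({..<n} \<rightarrow> carrier R)"
    using assms by (intro image_eqI[of _ _ "\<lambda>i. c i \<oplus>\<^bsub>R\<^esub> d i"]) (auto simp: lincomb_add)
next
  fix a x assume "a \<in> carrier R" "x \<in> lincomb M n g ` ({..<n} \<rightarrow> carrier R)"
  moreover from this obtain c where "c \<in> {..<n} \<rightarrow> carrier R" "x = lincomb M n g c" by blast
  ultimately show "a \<odot>\<^bsub>M\<^esub> x \<in> lincomb M n g ` ({..<n} \<rightarrow> carrier R)"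
    using assms by (intro image_eqI[of _ _ "\<lambda>i. a \<otimes>\<^bsub>R\<^esub> c i"]) (auto simp: lincomb_smult)
qed (use assms in auto)

lemma fin_gen_iff: "fin_gen R M \<longleftrightarrow> fg_submodule R M (carrier M)"
proof
  assume "fin_gen R M"
  then obtain n :: nat and g where g: "g \<in> {..<n} \<rightarrow> carrier M"
    and span: "\<And>x. x \<in> carrier M \<Longrightarrow> \<exists>c\<in>{..<n} \<rightarrow> carrier R. x = lincomb M n g c"
    unfolding fin_gen_def lincomb_def by blast
  have "carrier M \<subseteq> T" if T: "submodule T R M" "g ` {..<n} \<subseteq> T" for T
  proof
    fix x assume "x \<in> carrier M"
    then obtain c where "c \<in> {..<n} \<rightarrow> carrier R" "x = lincomb M n g c" using span by blast
    then show "x \<in> T" using lincomb_in_submodule[OF T(1), of g n c] T(2) by auto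
  qed
  then show "fg_submodule R M (carrier M)"
    unfolding fg_submodule_def using g submodule_carrier
    by (intro conjI exI[of _ "g ` {..<n}"]) (simp_all add: image_subset_iff_funcset)
next
  assume "fg_submodule R M (carrier M)"
  then obtain G where G: "finite G" "G \<subseteq> carrier M"
    and gen: "\<And>T. submodule T R M \<Longrightarrow> G \<subseteq> T \<Longrightarrow> carrier M \<subseteq> T"
    unfolding fg_submodule_def by blast
  obtain n :: nat and g where g: "G = g ` {i. i < n}"
    using finite_imp_nat_seg_image_inj_on[OF G(1)] by blast
  then have gM: "g \<in> {..<n} \<rightarrow> carrier M" using G by auto
  have "G \<subseteq> lincomb M n g ` ({..<n} \<rightarrow> carrier R)"
  proof
    fix x assume "x \<in> G"
    then obtain j where "j < n" "x = g j" using g by auto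
    then show "x \<in> lincomb M n g ` ({..<n} \<rightarrow> carrier R)"
      using lincomb_unit[OF gM, of j]
      by (intro image_eqI[of _ _ "\<lambda>i. if i = j then \<one>\<^bsub>R\<^esub> else \<zero>\<^bsub>R\<^esub>"]) auto
  qed
  then have "carrier M \<subseteq> lincomb M n g ` ({..<n} \<rightarrow> carrier R)"
    using gen submodule_lincombs[OF gM] by blast
  then show "fin_gen R M"
    unfolding fin_gen_def lincomb_def using gM by blast
qed

lemma fg_submodule_restrict_iff:
  assumes S: "submodule S R M"
  shows "fin_gen R (M\<lparr>carrier := S\<rparr>) \<longleftrightarrow> fg_submodule R M S"
proof -
  interpret S: left_module R "M\<lparr>carrier := S\<rparr>" by (rule submodule_left_module[OF S])
  have *: "(\<forall>T. submodule T R (M\<lparr>carrier := S\<rparr>) \<longrightarrow> G \<subseteq> T \<longrightarrow> S \<subseteq> T) \<longleftrightarrow>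
      (\<forall>T. submodule T R M \<longrightarrow> G \<subseteq> T \<longrightarrow> S \<subseteq> T)" if "G \<subseteq> S" for G
  proof (intro iffI allI impI)
    fix T assume *: "\<forall>T. submodule T R (M\<lparr>carrier := S\<rparr>) \<longrightarrow> G \<subseteq> T \<longrightarrow> S \<subseteq> T"
      and T: "submodule T R M" "G \<subseteq> T"
    have "submodule (S \<inter> T) R (M\<lparr>carrier := S\<rparr>)"
      using S T by (simp add: submodule_of_submodule_iff submodule_Int)
    then show "S \<subseteq> T" using * that T by blast
  qed (use S submodule_of_submodule_iff in blast)
  have "submodule S R (M\<lparr>carrier := S\<rparr>)"
    using S by (simp add: submodule_of_submodule_iff)
  moreover have "(\<exists>G. finite G \<and> G \<subseteq> S \<and>
        (\<forall>T. submodule T R (M\<lparr>carrier := S\<rparr>) \<longrightarrow> G \<subseteq> T \<longrightarrow> S \<subseteq> T)) \<longleftrightarrow>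
      (\<exists>G. finite G \<and> G \<subseteq> S \<and> (\<forall>T. submodule T R M \<longrightarrow> G \<subseteq> T \<longrightarrow> S \<subseteq> T))"
    by (intro iff_exI conj_cong refl) (rule *)
  ultimately show ?thesis
    unfolding S.fin_gen_iff using S by (simp add: fg_submodule_def)
qed

end


section \<open>Chain conditions\<close>

text \<open>The descending chain condition on the submodules of \<open>M\<close> inside \<open>S\<close>.\<close>

definition dcc_on ::
  "('a, 'c) ring_scheme \<Rightarrow> ('a, 'm, 'd) module_scheme \<Rightarrow> 'm set \<Rightarrow> bool" where
  "dcc_on R M S \<longleftrightarrow> (\<forall>I :: nat \<Rightarrow> 'm set.
     (\<forall>i. submodule (I i) R M \<and> I i \<subseteq> S \<and> I (Suc i) \<subseteq> I i) \<longrightarrow> (\<exists>n. \<forall>i\<ge>n. I i = I n))"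

lemma dcc_on_mono:
  assumes "dcc_on R M T" "S \<subseteq> T"
  shows "dcc_on R M S"
  using assms unfolding dcc_on_def by (meson subset_trans)

lemma dcc_onD:
  assumes "dcc_on R M S" "\<And>i :: nat. submodule (I i) R M" "\<And>i. I i \<subseteq> S"
    "\<And>i. I (Suc i) \<subseteq> I i"
  shows "\<exists>n. \<forall>i\<ge>n. I i = I n"
  using assms by (auto simp: dcc_on_def)

lemma (in left_module) dcc_on_minimal:
  assumes dcc: "dcc_on R M (carrier M)" and F: "\<And>S. S \<in> F \<Longrightarrow> submodule S R M" and ne: "F \<noteq> {}"
  obtains S where "S \<in> F" "\<And>T. T \<in> F \<Longrightarrow> T \<subseteq> S \<Longrightarrow> T = S"
proof -
  have "wf {(T, S). T \<in> F \<and> S \<in> F \<and> T \<subset> S}" (is "wf ?r")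
    unfolding wf_iff_no_infinite_down_chain
  proof
    assume "\<exists>I. \<forall>i::nat. (I (Suc i), I i) \<in> ?r"
    then obtain I where "\<forall>i::nat. (I (Suc i), I i) \<in> ?r" ..
    then have I: "\<And>i. I i \<in> F" "\<And>i. I (Suc i) \<subset> I i" by simp_all
    have "\<exists>n. \<forall>i\<ge>n. I i = I n"
    proof (rule dcc_onD[OF dcc])
      fix i
      show "submodule (I i) R M" by (rule F[OF I(1)])
      then show "I i \<subseteq> carrier M" by (rule submoduleD(1))
      show "I (Suc i) \<subseteq> I i" using I(2)[of i] by (rule psubset_imp_subset)
    qed
    then obtain n where "\<forall>i\<ge>n. I i = I n" ..
    from this[rule_format, of "Suc n"] have "I (Suc n) = I n" by simp
    with I(2) show False by blast
  qed
  moreover obtain S0 where "S0 \<in> F" using ne by blast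
  ultimately show thesis
  proof (rule wfE_min)
    fix S assume S: "S \<in> F" and min: "\<And>T. (T, S) \<in> ?r \<Longrightarrow> T \<notin> F"
    show thesis
    proof (rule that[OF S])
      fix T assume T: "T \<in> F" "T \<subseteq> S"
      show "T = S"
      proof (rule ccontr)
        assume "T \<noteq> S"
        then have "(T, S) \<in> ?r" using S T by blast
        with min T(1) show False by blast
      qed
    qed
  qed
qed

lemma regular_module_simps [simp]:
  "carrier (regular_module R) = carrier R" "\<zero>\<^bsub>regular_module R\<^esub> = \<zero>\<^bsub>R\<^esub>"
  "x \<oplus>\<^bsub>regular_module R\<^esub> y = x \<oplus>\<^bsub>R\<^esub> y" "a \<odot>\<^bsub>regular_module R\<^esub> x = a \<otimes>\<^bsub>R\<^esub> x"
  by (simp_all add: regular_module_def)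

lemma (in ring) regular_left_module: "left_module R (regular_module R)"
proof -
  have "abelian_group (regular_module R)"
  proof (rule abelian_groupI)
    fix x assume "x \<in> carrier (regular_module R)"
    then show "\<exists>y\<in>carrier (regular_module R).
        y \<oplus>\<^bsub>regular_module R\<^esub> x = \<zero>\<^bsub>regular_module R\<^esub>"
      by (intro bexI[of _ "\<ominus> x"]) (auto simp: l_neg)
  qed (auto simp: a_ac)
  moreover have "left_module_axioms R (regular_module R)"
    by unfold_locales (auto simp: l_distr r_distr m_assoc)
  ultimately show ?thesis
    using ring_axioms by (simp add: left_module_def)
qed

text \<open>If the left ideals of \<open>R\<close> satisfy the descending chain condition, then the condition
  passes from \<open>T\<close> to \<open>T + R g\<close>: a submodule \<open>S\<close> of \<open>T + R g\<close> is determined, among those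
  comparable with it, by \<open>S \<inter> T\<close> and the left ideal of all \<open>c\<close> with \<open>c g + t \<in> S\<close> for some
  \<open>t \<in> T\<close>.\<close>

lemma (in left_module) dcc_on_add_cyclic:
  assumes dccR: "dcc_on R (regular_module R) (carrier R)"
    and T: "submodule T R M" and dccT: "dcc_on R M T" and g: "g \<in> carrier M"
  shows "dcc_on R M (T <+>\<^bsub>M\<^esub> {a \<odot>\<^bsub>M\<^esub> g | a. a \<in> carrier R})"
  unfolding dcc_on_def
proof (intro allI impI)
  fix I :: "nat \<Rightarrow> 'm set"
  assume "\<forall>i. submodule (I i) R M \<and> I i \<subseteq> T <+>\<^bsub>M\<^esub> {a \<odot>\<^bsub>M\<^esub> g | a. a \<in> carrier R} \<and> I (Suc i) \<subseteq> I i"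
  then have I: "\<And>i. submodule (I i) R M"
    "\<And>i x. x \<in> I i \<Longrightarrow> x \<in> T <+>\<^bsub>M\<^esub> {a \<odot>\<^bsub>M\<^esub> g | a. a \<in> carrier R}"
    and dec: "\<And>i. I (Suc i) \<subseteq> I i" by blast+
  interpret reg: left_module R "regular_module R" by (rule R.regular_left_module)
  note t = submoduleD[OF T]
  \<comment> \<open>the left ideal of leading coefficients of \<open>I i\<close>\<close>
  define L where "L i = {c \<in> carrier R. \<exists>x\<in>T. x \<oplus>\<^bsub>M\<^esub> c \<odot>\<^bsub>M\<^esub> g \<in> I i}" for i
  have L: "submodule (L i) R (regular_module R)" for i
  proof (rule reg.submoduleI)
    note s = submoduleD[OF I(1)[of i]]
    show "\<zero>\<^bsub>regular_module R\<^esub> \<in> L i"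
      using t(3) s(3) g by (auto simp: L_def intro!: bexI[of _ "\<zero>\<^bsub>M\<^esub>"])
    fix c d assume "c \<in> L i" "d \<in> L i"
    then obtain x y where *: "c \<in> carrier R" "d \<in> carrier R" "x \<in> T" "y \<in> T"
      "x \<oplus>\<^bsub>M\<^esub> c \<odot>\<^bsub>M\<^esub> g \<in> I i" "y \<oplus>\<^bsub>M\<^esub> d \<odot>\<^bsub>M\<^esub> g \<in> I i"
      by (auto simp: L_def)
    have "(x \<oplus>\<^bsub>M\<^esub> y) \<oplus>\<^bsub>M\<^esub> (c \<oplus>\<^bsub>R\<^esub> d) \<odot>\<^bsub>M\<^esub> g =
        (x \<oplus>\<^bsub>M\<^esub> c \<odot>\<^bsub>M\<^esub> g) \<oplus>\<^bsub>M\<^esub> (y \<oplus>\<^bsub>M\<^esub> d \<odot>\<^bsub>M\<^esub> g)"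
      using * g t(2) by (simp add: smult_l_distr M.a_ac)
    then have "(x \<oplus>\<^bsub>M\<^esub> y) \<oplus>\<^bsub>M\<^esub> (c \<oplus>\<^bsub>R\<^esub> d) \<odot>\<^bsub>M\<^esub> g \<in> I i" using * s(4) by simp
    then show "c \<oplus>\<^bsub>regular_module R\<^esub> d \<in> L i"
      using * t(4) by (auto simp: L_def)
  next
    note s = submoduleD[OF I(1)[of i]]
    fix a c assume a: "a \<in> carrier R" and "c \<in> L i"
    then obtain x where *: "c \<in> carrier R" "x \<in> T" "x \<oplus>\<^bsub>M\<^esub> c \<odot>\<^bsub>M\<^esub> g \<in> I i"
      by (auto simp: L_def)
    have "a \<odot>\<^bsub>M\<^esub> x \<oplus>\<^bsub>M\<^esub> (a \<otimes>\<^bsub>R\<^esub> c) \<odot>\<^bsub>M\<^esub> g = a \<odot>\<^bsub>M\<^esub> (x \<oplus>\<^bsub>M\<^esub> c \<odot>\<^bsub>M\<^esub> g)"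
      using * a g t(2) by (simp add: smult_r_distr smult_assoc)
    then have "a \<odot>\<^bsub>M\<^esub> x \<oplus>\<^bsub>M\<^esub> (a \<otimes>\<^bsub>R\<^esub> c) \<odot>\<^bsub>M\<^esub> g \<in> I i" using * a s(5) by simp
    then show "a \<odot>\<^bsub>regular_module R\<^esub> c \<in> L i"
      using * a t(5) by (auto simp: L_def)
  qed (auto simp: L_def)
  have "L (Suc i) \<subseteq> L i" for i
    using dec by (auto simp: L_def)
  then have "\<exists>m. \<forall>i\<ge>m. L i = L m"
    using L reg.submoduleD(1)[OF L] by (intro dcc_onD[OF dccR]) auto
  then obtain m where m: "\<forall>i\<ge>m. L i = L m" ..
  have "\<exists>n. \<forall>i\<ge>n. I i \<inter> T = I n \<inter> T"
  proof (rule dcc_onD[OF dccT])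
    fix i
    show "submodule (I i \<inter> T) R M" by (rule submodule_Int[OF I(1) T])
    show "I (Suc i) \<inter> T \<subseteq> I i \<inter> T" using dec[of i] by blast
  qed blast
  then obtain n where n: "\<forall>i\<ge>n. I i \<inter> T = I n \<inter> T" ..
  define N where "N = max m n"
  have mono: "I i \<subseteq> I N" if "i \<ge> N" for i
    using that by (induction i rule: dec_induct) (use dec in blast)+
  have "I N \<subseteq> I i" if i: "i \<ge> N" for i
  proof
    note s = submoduleD[OF I(1)]
    fix z assume z: "z \<in> I N"
    obtain x c where x: "x \<in> T" "c \<in> carrier R" "z = x \<oplus>\<^bsub>M\<^esub> c \<odot>\<^bsub>M\<^esub> g"
      using I(2)[OF z] by (auto elim!: set_addE)
    have "L N = L i" using m[rule_format, of N] m[rule_format, of i] i by (simp add: N_def)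
    moreover have "c \<in> L N" using x z by (auto simp: L_def)
    ultimately obtain y where y: "y \<in> T" "y \<oplus>\<^bsub>M\<^esub> c \<odot>\<^bsub>M\<^esub> g \<in> I i" by (auto simp: L_def)
    have "z \<ominus>\<^bsub>M\<^esub> (y \<oplus>\<^bsub>M\<^esub> c \<odot>\<^bsub>M\<^esub> g) = x \<ominus>\<^bsub>M\<^esub> y"
    proof -
      have c: "x \<in> carrier M" "y \<in> carrier M" "c \<odot>\<^bsub>M\<^esub> g \<in> carrier M" using x y t(2) g by auto
      then show ?thesis
        unfolding x(3) by (simp add: a_minus_def M.minus_add M.a_ac M.r_neg1 M.r_neg2 M.r_neg M.l_neg)
    qed
    moreover have "z \<ominus>\<^bsub>M\<^esub> (y \<oplus>\<^bsub>M\<^esub> c \<odot>\<^bsub>M\<^esub> g) \<in> I N" using z y mono[OF i] s(7) by blast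
    moreover have "x \<ominus>\<^bsub>M\<^esub> y \<in> T" using x y t(7) by blast
    moreover have "I N \<inter> T = I i \<inter> T" using n[rule_format, of N] n[rule_format, of i] i by (simp add: N_def)
    ultimately have "x \<ominus>\<^bsub>M\<^esub> y \<in> I i" by auto
    then have "(x \<ominus>\<^bsub>M\<^esub> y) \<oplus>\<^bsub>M\<^esub> (y \<oplus>\<^bsub>M\<^esub> c \<odot>\<^bsub>M\<^esub> g) \<in> I i" using y s(4) by blast
    moreover have "(x \<ominus>\<^bsub>M\<^esub> y) \<oplus>\<^bsub>M\<^esub> (y \<oplus>\<^bsub>M\<^esub> c \<odot>\<^bsub>M\<^esub> g) = z"
      using x y t(2) g by (simp add: a_minus_def M.a_assoc M.r_neg1 M.r_neg2)
    ultimately show "z \<in> I i" by simp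
  qed
  then show "\<exists>n. \<forall>i\<ge>n. I i = I n" using mono by blast
qed

lemma (in left_module) fin_gen_dcc:
  assumes dccR: "dcc_on R (regular_module R) (carrier R)" and fg: "fin_gen R M"
  shows "dcc_on R M (carrier M)"
proof -
  obtain G where G: "finite G" "G \<subseteq> carrier M"
    and gen: "\<And>T. submodule T R M \<Longrightarrow> G \<subseteq> T \<Longrightarrow> carrier M \<subseteq> T"
    using fg unfolding fin_gen_iff fg_submodule_def by blast
  have "\<exists>T. submodule T R M \<and> G \<subseteq> T \<and> dcc_on R M T"
    using G
  proof (induction G rule: finite_induct)
    case empty
    have "dcc_on R M {\<zero>\<^bsub>M\<^esub>}"
      unfolding dcc_on_def using submoduleD(3) by (metis subset_singletonD empty_iff)
    then show ?case using submodule_zero by blast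
  next
    case (insert g G)
    then obtain T where T: "submodule T R M" "G \<subseteq> T" "dcc_on R M T" by auto
    have g: "g \<in> carrier M" using insert by simp
    note c = submodule_cyclic[OF g]
    show ?case
      using submodule_set_add[OF T(1) c] set_add_upper1[OF T(1) c] set_add_upper2[OF T(1) c]
        cyclic_self[OF g] T(2) dcc_on_add_cyclic[OF dccR T(1,3) g] by blast
  qed
  then obtain T where T: "submodule T R M" "G \<subseteq> T" "dcc_on R M T" by blast
  show ?thesis using dcc_on_mono[OF T(3) gen[OF T(1,2)]] .
qed

lemma (in cring) submodule_regular_iff_ideal: "submodule I R (regular_module R) \<longleftrightarrow> ideal I R"
proof -
  interpret reg: left_module R "regular_module R" by (rule regular_left_module)
  show ?thesis
  proof
    assume I: "submodule I R (regular_module R)"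
    note s = reg.submoduleD[OF I, simplified]
    show "ideal I R"
    proof (rule idealI)
      show "subgroup I (add_monoid R)"
      proof (rule add.subgroupI)
        show "\<ominus> x \<in> I" if "x \<in> I" for x
          using s(5)[of "\<ominus> \<one>" x] s(2)[of x] that by (simp add: l_minus)
      qed (use s in auto)
      show "x \<otimes> a \<in> I" if "a \<in> I" "x \<in> carrier R" for a x
        using s that by simp
      show "a \<otimes> x \<in> I" if "a \<in> I" "x \<in> carrier R" for a x
        using s(5)[of x a] s(2) that by (simp add: m_comm)
    qed (rule ring_axioms)
  next
    assume "ideal I R"
    then interpret ideal I R .
    show "submodule I R (regular_module R)"
      by (rule reg.submoduleI) (auto simp: I_l_closed)
  qed
qed

lemma (in artinian_cring) dcc_regular: "dcc_on R (regular_module R) (carrier R)"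
  unfolding dcc_on_def submodule_regular_iff_ideal
  using descending_chain_condition by blast

text \<open>A module with the descending chain condition over a commutative Artinian ring is
  Noetherian. In a minimal counterexample \<open>W\<close> every scalar acts as zero or invertibly, so that
  \<open>W\<close> is in effect a vector space, and a maximal submodule avoiding a vector \<open>x\<close> is a
  complement of the line through \<open>x\<close>; but it is finitely generated by minimality.\<close>

lemma artinian_imp_noetherian:
  fixes k :: "('k, 'e) ring_scheme" and M :: "('k, 'm, 'd) module_scheme"
  assumes "artinian_cring k" "left_module k M" and dcc: "dcc_on k M (carrier M)"
    and S: "submodule S k M"
  shows "fg_submodule k M S"
proof (rule ccontr)
  interpret artinian_cring k by fact
  interpret left_module k M by fact
  assume "\<not> fg_submodule k M S"
  define F where "F = {T. submodule T k M \<and> \<not> fg_submodule k M T}"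
  have "S \<in> F" using S \<open>\<not> fg_submodule k M S\<close> by (simp add: F_def)
  then have "F \<noteq> {}" by blast
  obtain W where "W \<in> F" and minW: "\<And>T. T \<in> F \<Longrightarrow> T \<subseteq> W \<Longrightarrow> T = W"
    by (rule dcc_on_minimal[OF dcc _ \<open>F \<noteq> {}\<close>]) (auto simp: F_def)
  then have W: "submodule W k M" and nfg: "\<not> fg_submodule k M W"
    and min: "\<And>T. submodule T k M \<Longrightarrow> T \<subseteq> W \<Longrightarrow> T \<noteq> W \<Longrightarrow> fg_submodule k M T"
    by (auto simp: F_def)
  note w = submoduleD[OF W]
  \<comment> \<open>If \<open>c W \<noteq> W\<close>, then \<open>c W\<close> is finitely generated, and so is \<open>W\<close> unless \<open>ker c = W\<close>.
    If \<open>c W = W\<close>, then \<open>c\<^sup>n = d c\<^sup>n\<^sup>+\<^sup>1\<close> for some \<open>n\<close> and \<open>d\<close>, and \<open>d\<close> inverts \<open>c\<close> on \<open>c\<^sup>n W = W\<close>.\<close>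
  have scalar: "(\<forall>y\<in>W. c \<odot>\<^bsub>M\<^esub> y = \<zero>\<^bsub>M\<^esub>) \<or> (\<exists>d\<in>carrier k. \<forall>y\<in>W. d \<odot>\<^bsub>M\<^esub> (c \<odot>\<^bsub>M\<^esub> y) = y)"
    if c: "c \<in> carrier k" for c
  proof -
    define ker where "ker = {y \<in> W. c \<odot>\<^bsub>M\<^esub> y = \<zero>\<^bsub>M\<^esub>}"
    have cW: "submodule ((\<lambda>y. c \<odot>\<^bsub>M\<^esub> y) ` T) k M" if T: "submodule T k M" for T
    proof (rule submoduleI)
      note t = submoduleD[OF T]
      show "\<zero>\<^bsub>M\<^esub> \<in> (\<lambda>y. c \<odot>\<^bsub>M\<^esub> y) ` T"
        using c t(3) by (intro image_eqI[of _ _ "\<zero>\<^bsub>M\<^esub>"]) auto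
      show "(\<lambda>y. c \<odot>\<^bsub>M\<^esub> y) ` T \<subseteq> carrier M" using c t by auto
      fix x y assume "x \<in> (\<lambda>y. c \<odot>\<^bsub>M\<^esub> y) ` T" "y \<in> (\<lambda>y. c \<odot>\<^bsub>M\<^esub> y) ` T"
      then obtain u v where "u \<in> T" "v \<in> T" "x = c \<odot>\<^bsub>M\<^esub> u" "y = c \<odot>\<^bsub>M\<^esub> v" by blast
      then show "x \<oplus>\<^bsub>M\<^esub> y \<in> (\<lambda>y. c \<odot>\<^bsub>M\<^esub> y) ` T"
        using c t by (intro image_eqI[of _ _ "u \<oplus>\<^bsub>M\<^esub> v"]) (auto simp: smult_r_distr)
    next
      note t = submoduleD[OF T]
      fix a x assume a: "a \<in> carrier k" and "x \<in> (\<lambda>y. c \<odot>\<^bsub>M\<^esub> y) ` T"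
      then obtain u where u: "u \<in> T" "x = c \<odot>\<^bsub>M\<^esub> u" by blast
      have "a \<odot>\<^bsub>M\<^esub> x = c \<odot>\<^bsub>M\<^esub> (a \<odot>\<^bsub>M\<^esub> u)"
        using a c u t by (simp add: m_comm flip: smult_assoc)
      then show "a \<odot>\<^bsub>M\<^esub> x \<in> (\<lambda>y. c \<odot>\<^bsub>M\<^esub> y) ` T"
        using a u t by blast
    qed
    have ker: "submodule ker k M"
    proof (rule submoduleI)
      fix a x assume "a \<in> carrier k" "x \<in> ker"
      then have a: "a \<in> carrier k" "x \<in> W" "c \<odot>\<^bsub>M\<^esub> x = \<zero>\<^bsub>M\<^esub>" by (auto simp: ker_def)
      have "c \<odot>\<^bsub>M\<^esub> (a \<odot>\<^bsub>M\<^esub> x) = a \<odot>\<^bsub>M\<^esub> (c \<odot>\<^bsub>M\<^esub> x)"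
        using a(1,2) c w(2) by (simp add: m_comm flip: smult_assoc)
      then show "a \<odot>\<^bsub>M\<^esub> x \<in> ker" using a w(5) by (simp add: ker_def)
    qed (use c w in \<open>auto simp: ker_def smult_r_distr\<close>)
    show ?thesis
    proof (cases "(\<lambda>y. c \<odot>\<^bsub>M\<^esub> y) ` W = W")
      case False
      have "(\<lambda>y. c \<odot>\<^bsub>M\<^esub> y) ` W \<subseteq> W" using w(5) c by auto
      then have "fg_submodule k M ((\<lambda>y. c \<odot>\<^bsub>M\<^esub> y) ` W)"
        using min[OF cW[OF W]] False by blast
      then obtain G where G: "finite G" "G \<subseteq> (\<lambda>y. c \<odot>\<^bsub>M\<^esub> y) ` W"
        "\<And>T. submodule T k M \<Longrightarrow> G \<subseteq> T \<Longrightarrow> (\<lambda>y. c \<odot>\<^bsub>M\<^esub> y) ` W \<subseteq> T"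
        unfolding fg_submodule_def by blast
      obtain G' where G': "G' \<subseteq> W" "finite G'" "G = (\<lambda>y. c \<odot>\<^bsub>M\<^esub> y) ` G'"
        using finite_subset_image[OF G(1,2)] by blast
      have "ker = W"
      proof (rule ccontr)
        assume "ker \<noteq> W"
        then have "fg_submodule k M ker" using min[OF ker] by (auto simp: ker_def)
        then obtain H where H: "finite H" "H \<subseteq> ker"
          "\<And>T. submodule T k M \<Longrightarrow> H \<subseteq> T \<Longrightarrow> ker \<subseteq> T"
          unfolding fg_submodule_def by blast
        have "W \<subseteq> T" if T: "submodule T k M" "G' \<union> H \<subseteq> T" for T
        proof
          fix x assume x: "x \<in> W"
          have TW: "submodule (T \<inter> W) k M" by (rule submodule_Int[OF T(1) W])
          have "(\<lambda>y. c \<odot>\<^bsub>M\<^esub> y) ` W \<subseteq> (\<lambda>y. c \<odot>\<^bsub>M\<^esub> y) ` (T \<inter> W)"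
            using G(3)[OF cW[OF TW]] G' T(2) by blast
          then obtain y where y: "y \<in> T" "y \<in> W" "c \<odot>\<^bsub>M\<^esub> x = c \<odot>\<^bsub>M\<^esub> y" using x by blast
          have "c \<odot>\<^bsub>M\<^esub> (x \<ominus>\<^bsub>M\<^esub> y) = c \<odot>\<^bsub>M\<^esub> x \<oplus>\<^bsub>M\<^esub> c \<odot>\<^bsub>M\<^esub> ((\<ominus>\<^bsub>k\<^esub> \<one>\<^bsub>k\<^esub>) \<odot>\<^bsub>M\<^esub> y)"
            using x y c w(2) by (simp add: a_minus_def smult_minus_one smult_r_distr)
          also have "\<dots> = c \<odot>\<^bsub>M\<^esub> x \<oplus>\<^bsub>M\<^esub> (\<ominus>\<^bsub>k\<^esub> \<one>\<^bsub>k\<^esub>) \<odot>\<^bsub>M\<^esub> (c \<odot>\<^bsub>M\<^esub> y)"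
            using y c w(2) by (simp add: m_comm flip: smult_assoc)
          also have "\<dots> = \<zero>\<^bsub>M\<^esub>"
            using x y c w(2) by (simp add: smult_minus_one M.r_neg)
          finally have "x \<ominus>\<^bsub>M\<^esub> y \<in> ker" using x y w(7) by (simp add: ker_def)
          then have "x \<ominus>\<^bsub>M\<^esub> y \<in> T" using H(3)[OF T(1)] T(2) by blast
          then have "x \<ominus>\<^bsub>M\<^esub> y \<oplus>\<^bsub>M\<^esub> y \<in> T" using y submoduleD(4)[OF T(1)] by blast
          then show "x \<in> T" using x y w(2) by (simp add: a_minus_def M.a_assoc M.l_neg)
        qed
        moreover have "finite (G' \<union> H)" "G' \<union> H \<subseteq> W" using G' H by (auto simp: ker_def)
        ultimately have "fg_submodule k M W" using W unfolding fg_submodule_def by blast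
        with nfg show False ..
      qed
      then show ?thesis by (auto simp: ker_def)
    next
      case True
      have dec: "PIdl\<^bsub>k\<^esub> (c [^]\<^bsub>k\<^esub> Suc i) \<subseteq> PIdl\<^bsub>k\<^esub> (c [^]\<^bsub>k\<^esub> i)" for i
      proof
        fix z assume "z \<in> PIdl\<^bsub>k\<^esub> (c [^]\<^bsub>k\<^esub> Suc i)"
        then obtain a where "a \<in> carrier k" "z = a \<otimes>\<^bsub>k\<^esub> c [^]\<^bsub>k\<^esub> Suc i" by (auto simp: cgenideal_def)
        then show "z \<in> PIdl\<^bsub>k\<^esub> (c [^]\<^bsub>k\<^esub> i)"
          using c by (auto simp: cgenideal_def m_ac intro!: exI[of _ "a \<otimes>\<^bsub>k\<^esub> c"])
      qed
      have ideal: "ideal (PIdl\<^bsub>k\<^esub> (c [^]\<^bsub>k\<^esub> i)) k" for i :: nat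
        using c by (intro cgenideal_ideal) simp
      obtain n :: nat where n: "\<forall>i\<ge>n. PIdl\<^bsub>k\<^esub> (c [^]\<^bsub>k\<^esub> i) = PIdl\<^bsub>k\<^esub> (c [^]\<^bsub>k\<^esub> n)"
        using descending_chain_condition[of "\<lambda>i. PIdl\<^bsub>k\<^esub> (c [^]\<^bsub>k\<^esub> i)", OF ideal dec] ..
      have "c [^]\<^bsub>k\<^esub> n \<in> PIdl\<^bsub>k\<^esub> (c [^]\<^bsub>k\<^esub> Suc n)"
        using n[rule_format, of "Suc n"] cgenideal_self[of "c [^]\<^bsub>k\<^esub> n"] c by simp
      then obtain d where d: "d \<in> carrier k" "c [^]\<^bsub>k\<^esub> n = d \<otimes>\<^bsub>k\<^esub> c [^]\<^bsub>k\<^esub> Suc n"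
        by (auto simp: cgenideal_def)
      have pow: "\<exists>z\<in>W. y = c [^]\<^bsub>k\<^esub> i \<odot>\<^bsub>M\<^esub> z" if "y \<in> W" for y and i :: nat
        using that
      proof (induction i arbitrary: y)
        case 0
        then show ?case using w(2) by auto
      next
        case (Suc i)
        then obtain z where z: "z \<in> W" "y = c [^]\<^bsub>k\<^esub> i \<odot>\<^bsub>M\<^esub> z" by blast
        then obtain z' where "z' \<in> W" "z = c \<odot>\<^bsub>M\<^esub> z'" using True by blast
        then show ?case using z c w(2) by (auto simp: smult_assoc intro!: bexI[of _ z'])
      qed
      have "d \<odot>\<^bsub>M\<^esub> (c \<odot>\<^bsub>M\<^esub> y) = y" if y: "y \<in> W" for y
      proof -
        obtain z where z: "z \<in> W" "y = c [^]\<^bsub>k\<^esub> n \<odot>\<^bsub>M\<^esub> z" using pow[OF y] by blast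
        have "d \<odot>\<^bsub>M\<^esub> (c \<odot>\<^bsub>M\<^esub> y) = (d \<otimes>\<^bsub>k\<^esub> c [^]\<^bsub>k\<^esub> Suc n) \<odot>\<^bsub>M\<^esub> z"
          using z d(1) c w(2) by (simp add: m_ac flip: smult_assoc)
        also have "\<dots> = c [^]\<^bsub>k\<^esub> n \<odot>\<^bsub>M\<^esub> z" by (simp only: d(2)[symmetric])
        finally show ?thesis by (simp only: z(2)[symmetric])
      qed
      then show ?thesis using d(1) by blast
    qed
  qed
  have "W \<noteq> {\<zero>\<^bsub>M\<^esub>}"
  proof
    assume "W = {\<zero>\<^bsub>M\<^esub>}"
    then have "fg_submodule k M W"
      using W submoduleD(3) by (auto simp: fg_submodule_def intro!: exI[of _ "{}"])
    with nfg show False ..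
  qed
  then obtain x where x: "x \<in> W" "x \<noteq> \<zero>\<^bsub>M\<^esub>" using w(3) by blast
  obtain T where T: "submodule T k M" "x \<notin> T"
    and max: "\<And>T'. submodule T' k M \<Longrightarrow> T \<subseteq> T' \<Longrightarrow> x \<notin> T' \<Longrightarrow> T' = T"
    using exists_maximal_avoiding[OF submodule_zero] x by blast
  \<comment> \<open>\<open>T \<inter> W\<close> and the line through \<open>x\<close> span \<open>W\<close>: for \<open>y \<notin> T\<close> maximality gives
    \<open>x = u + a y\<close> with \<open>u \<in> T\<close>, and \<open>a\<close> is invertible on \<open>W\<close> because \<open>x \<notin> T\<close>.\<close>
  have compl: "\<exists>a\<in>carrier k. \<exists>u\<in>T \<inter> W. y = u \<oplus>\<^bsub>M\<^esub> a \<odot>\<^bsub>M\<^esub> x" if y: "y \<in> W" for y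
  proof (cases "y \<in> T")
    case True
    then show ?thesis
      using x y w(2) by (intro bexI[of _ "\<zero>\<^bsub>k\<^esub>"] bexI[of _ y]) auto
  next
    case False
    have yM: "y \<in> carrier M" using y w(2) by blast
    note cyc = submodule_cyclic[OF yM]
    have "x \<in> T <+>\<^bsub>M\<^esub> {a \<odot>\<^bsub>M\<^esub> y | a. a \<in> carrier k}"
      using max[OF submodule_set_add[OF T(1) cyc] set_add_upper1[OF T(1) cyc]]
        set_add_upper2[OF T(1) cyc] cyclic_self[OF yM] False by blast
    then obtain u a where u: "u \<in> T" "a \<in> carrier k" "x = u \<oplus>\<^bsub>M\<^esub> a \<odot>\<^bsub>M\<^esub> y"
      by (auto elim!: set_addE)
    have uM: "u \<in> carrier M" using u(1) submoduleD(2)[OF T(1)] by blast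
    have "u = x \<ominus>\<^bsub>M\<^esub> a \<odot>\<^bsub>M\<^esub> y"
      using u uM yM by (simp add: a_minus_def M.a_assoc M.r_neg)
    then have uW: "u \<in> W" using x y u(2) w(5,7) by blast
    have "\<not> (\<forall>y\<in>W. a \<odot>\<^bsub>M\<^esub> y = \<zero>\<^bsub>M\<^esub>)"
      using u T(2) uM y by (metis M.r_zero)
    then obtain d where d: "d \<in> carrier k" "\<And>y. y \<in> W \<Longrightarrow> d \<odot>\<^bsub>M\<^esub> (a \<odot>\<^bsub>M\<^esub> y) = y"
      using scalar[OF u(2)] by blast
    have "d \<odot>\<^bsub>M\<^esub> x = d \<odot>\<^bsub>M\<^esub> u \<oplus>\<^bsub>M\<^esub> y"
      using u d y uM yM by (simp add: smult_r_distr)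
    then have "y = (\<ominus>\<^bsub>M\<^esub> (d \<odot>\<^bsub>M\<^esub> u)) \<oplus>\<^bsub>M\<^esub> d \<odot>\<^bsub>M\<^esub> x"
      using d(1) uM yM by (simp add: M.r_neg1)
    moreover have "\<ominus>\<^bsub>M\<^esub> (d \<odot>\<^bsub>M\<^esub> u) \<in> T \<inter> W"
      using u(1) uW d(1) submoduleD(5,6)[OF T(1)] w(5,6) by blast
    ultimately show ?thesis using d(1) by blast
  qed
  have TW: "submodule (T \<inter> W) k M" by (rule submodule_Int[OF T(1) W])
  then have "fg_submodule k M (T \<inter> W)" using min x T(2) by blast
  then obtain G where G: "finite G" "G \<subseteq> T \<inter> W"
    "\<And>V. submodule V k M \<Longrightarrow> G \<subseteq> V \<Longrightarrow> T \<inter> W \<subseteq> V"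
    unfolding fg_submodule_def by blast
  have "W \<subseteq> V" if V: "submodule V k M" "insert x G \<subseteq> V" for V
  proof
    fix y assume "y \<in> W"
    then obtain a u where "a \<in> carrier k" "u \<in> T \<inter> W" "y = u \<oplus>\<^bsub>M\<^esub> a \<odot>\<^bsub>M\<^esub> x" using compl by blast
    then show "y \<in> V" using V G(3)[OF V(1)] submoduleD(4,5)[OF V(1)] by blast
  qed
  then have "fg_submodule k M W"
    unfolding fg_submodule_def using W G x by (intro conjI exI[of _ "insert x G"]) auto
  with nfg show False ..
qed


section \<open>Modules over an Artin algebra\<close>

text \<open>Restriction of scalars along \<open>\<phi>\<close>.\<close>

definition restrict_scalars ::
  "('k \<Rightarrow> 'a) \<Rightarrow> ('a, 'm, 'd) module_scheme \<Rightarrow> ('k, 'm) module" where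
  "restrict_scalars \<phi> M = \<lparr>carrier = carrier M, mult = mult M, one = one M, zero = zero M,
     add = add M, smult = (\<lambda>c x. \<phi> c \<odot>\<^bsub>M\<^esub> x)\<rparr>"

lemma restrict_scalars_simps [simp]:
  "carrier (restrict_scalars \<phi> M) = carrier M" "\<zero>\<^bsub>restrict_scalars \<phi> M\<^esub> = \<zero>\<^bsub>M\<^esub>"
  "x \<oplus>\<^bsub>restrict_scalars \<phi> M\<^esub> y = x \<oplus>\<^bsub>M\<^esub> y" "c \<odot>\<^bsub>restrict_scalars \<phi> M\<^esub> x = \<phi> c \<odot>\<^bsub>M\<^esub> x"
  by (simp_all add: restrict_scalars_def)

context artin_algebra
begin

lemma restrict_scalars_left_module:
  assumes "left_module A M"
  shows "left_module k (restrict_scalars \<phi> M)"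
proof -
  interpret M: left_module A M by fact
  have hom: "\<phi> c \<in> carrier A" if "c \<in> carrier k" for c
    using structure_hom that by (rule ring_hom_closed)
  have "abelian_group (restrict_scalars \<phi> M)"
  proof (rule abelian_groupI)
    fix x assume "x \<in> carrier (restrict_scalars \<phi> M)"
    then show "\<exists>y\<in>carrier (restrict_scalars \<phi> M).
        y \<oplus>\<^bsub>restrict_scalars \<phi> M\<^esub> x = \<zero>\<^bsub>restrict_scalars \<phi> M\<^esub>"
      by (intro bexI[of _ "\<ominus>\<^bsub>M\<^esub> x"]) (auto simp: M.M.l_neg)
  qed (auto simp: M.M.a_ac)
  moreover have "left_module_axioms k (restrict_scalars \<phi> M)"
    using structure_hom
    by unfold_locales (auto simp: hom M.smult_l_distr M.smult_r_distr M.smult_assoc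
        ring_hom_add ring_hom_mult ring_hom_one)
  ultimately show ?thesis
    using k.ring_axioms by (simp add: left_module_def)
qed

lemma restrict_scalars_submodule:
  assumes M: "left_module A M" and S: "submodule S A M"
  shows "submodule S k (restrict_scalars \<phi> M)"
proof -
  interpret M: left_module A M by fact
  interpret Mk: left_module k "restrict_scalars \<phi> M" by (rule restrict_scalars_left_module[OF M])
  show ?thesis
    using M.submoduleD[OF S] ring_hom_closed[OF structure_hom] by (intro Mk.submoduleI) auto
qed

lemma restrict_scalars_fin_gen:
  assumes M: "left_module A M" and fg: "fin_gen A M"
  shows "fin_gen k (restrict_scalars \<phi> M)"
proof -
  interpret M: left_module A M by fact
  interpret Mk: left_module k "restrict_scalars \<phi> M" by (rule restrict_scalars_left_module[OF M])
  interpret reg: left_module A "regular_module A" by (rule A.regular_left_module)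
  interpret regk: left_module k "restrict_scalars \<phi> (regular_module A)"
    by (rule restrict_scalars_left_module) unfold_locales
  note hom = ring_hom_closed[OF structure_hom]
  have "fin_gen k (restrict_scalars \<phi> (regular_module A))"
    using finite_over_base by (simp add: restrict_scalars_def regular_module_def)
  then obtain B where B: "finite B" "B \<subseteq> carrier A"
    "\<And>T. submodule T k (restrict_scalars \<phi> (regular_module A)) \<Longrightarrow> B \<subseteq> T \<Longrightarrow> carrier A \<subseteq> T"
    unfolding regk.fin_gen_iff fg_submodule_def by auto
  obtain G where G: "finite G" "G \<subseteq> carrier M"
    "\<And>T. submodule T A M \<Longrightarrow> G \<subseteq> T \<Longrightarrow> carrier M \<subseteq> T"
    using fg unfolding M.fin_gen_iff fg_submodule_def by auto
  define H where "H = (\<lambda>(b, g). b \<odot>\<^bsub>M\<^esub> g) ` (B \<times> G)"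
  have "carrier M \<subseteq> T" if T: "submodule T k (restrict_scalars \<phi> M)" "H \<subseteq> T" for T
  proof -
    note t = Mk.submoduleD[OF T(1), simplified]
    \<comment> \<open>the largest \<open>A\<close>-submodule inside the \<open>k\<close>-submodule \<open>T\<close>\<close>
    define T' where "T' = {x \<in> carrier M. \<forall>a\<in>carrier A. a \<odot>\<^bsub>M\<^esub> x \<in> T}"
    have "submodule T' A M"
      using t by (intro M.submoduleI) (auto simp: T'_def M.smult_r_distr simp flip: M.smult_assoc)
    moreover have "G \<subseteq> T'"
    proof
      fix g assume g: "g \<in> G"
      then have gM: "g \<in> carrier M" using G by auto
      have "submodule {a \<in> carrier A. a \<odot>\<^bsub>M\<^esub> g \<in> T} k (restrict_scalars \<phi> (regular_module A))"
        using gM t hom by (intro regk.submoduleI) (auto simp: M.smult_l_distr M.smult_assoc)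
      moreover have "B \<subseteq> {a \<in> carrier A. a \<odot>\<^bsub>M\<^esub> g \<in> T}" using B T(2) g by (auto simp: H_def)
      ultimately have "carrier A \<subseteq> {a \<in> carrier A. a \<odot>\<^bsub>M\<^esub> g \<in> T}" by (rule B(3))
      then show "g \<in> T'" using gM by (auto simp: T'_def)
    qed
    ultimately have "carrier M \<subseteq> T'" by (rule G(3))
    then have "\<one>\<^bsub>A\<^esub> \<odot>\<^bsub>M\<^esub> x \<in> T" if "x \<in> carrier M" for x
      using that unfolding T'_def by blast
    then show ?thesis by auto
  qed
  moreover have "finite H" "H \<subseteq> carrier M" using B G by (auto simp: H_def)
  ultimately have "fg_submodule k (restrict_scalars \<phi> M) (carrier (restrict_scalars \<phi> M))"
    unfolding fg_submodule_def using Mk.submodule_carrier by auto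
  then show ?thesis by (simp only: Mk.fin_gen_iff)
qed

lemma fg_left_module_dcc:
  assumes "fg_left_module A M"
  shows "dcc_on A M (carrier M)"
proof -
  have M: "left_module A M" "fin_gen A M" using assms by (auto simp: fg_left_module_def)
  interpret Mk: left_module k "restrict_scalars \<phi> M" by (rule restrict_scalars_left_module[OF M(1)])
  have "dcc_on k (restrict_scalars \<phi> M) (carrier M)"
    using Mk.fin_gen_dcc[OF k.dcc_regular restrict_scalars_fin_gen[OF M]] by simp
  then show ?thesis
    unfolding dcc_on_def using restrict_scalars_submodule[OF M(1)] by blast
qed

lemma fg_left_module_submodule:
  assumes "fg_left_module A M" and S: "submodule S A M"
  shows "fg_left_module A (M\<lparr>carrier := S\<rparr>)"
proof -
  have M: "left_module A M" "fin_gen A M" using assms by (auto simp: fg_left_module_def)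
  interpret M: left_module A M by fact
  interpret Mk: left_module k "restrict_scalars \<phi> M" by (rule restrict_scalars_left_module[OF M(1)])
  have "dcc_on k (restrict_scalars \<phi> M) (carrier (restrict_scalars \<phi> M))"
    using Mk.fin_gen_dcc[OF k.dcc_regular restrict_scalars_fin_gen[OF M]] .
  then have "fg_submodule k (restrict_scalars \<phi> M) S"
    by (rule artinian_imp_noetherian[OF k.artinian_cring_axioms Mk.left_module_axioms _
          restrict_scalars_submodule[OF M(1) S]])
  then obtain G where "finite G" "G \<subseteq> S"
    "\<And>T. submodule T k (restrict_scalars \<phi> M) \<Longrightarrow> G \<subseteq> T \<Longrightarrow> S \<subseteq> T"
    unfolding fg_submodule_def by blast
  then have "fg_submodule A M S"
    unfolding fg_submodule_def using S restrict_scalars_submodule[OF M(1)]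
    by (intro conjI exI[of _ G] allI impI) simp_all
  then show ?thesis
    using M.submodule_left_module[OF S] M.fg_submodule_restrict_iff[OF S]
    by (simp add: fg_left_module_def)
qed

lemma regular_fg: "fg_left_module A (regular_module A)"
proof -
  interpret reg: left_module A "regular_module A" by (rule A.regular_left_module)
  have "carrier A \<subseteq> T" if "submodule T A (regular_module A)" "\<one>\<^bsub>A\<^esub> \<in> T" for T
    using reg.submoduleD(5)[OF that(1) _ that(2)] by auto
  then have "fg_submodule A (regular_module A) (carrier (regular_module A))"
    unfolding fg_submodule_def using reg.submodule_carrier
    by (intro conjI exI[of _ "{\<one>\<^bsub>A\<^esub>}"]) auto
  then show ?thesis
    using reg.left_module_axioms by (simp add: fg_left_module_def reg.fin_gen_iff)
qed

end


section \<open>The Jacobson radical\<close>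

context ring
begin

lemma ideal_imp_submodule_regular:
  assumes "ideal I R"
  shows "submodule I R (regular_module R)"
proof -
  interpret reg: left_module R "regular_module R" by (rule regular_left_module)
  interpret ideal I R by fact
  show ?thesis by (rule reg.submoduleI) (auto simp: I_l_closed)
qed

lemma exists_maximal_left_ideal:
  assumes I: "submodule I R (regular_module R)" "\<one> \<notin> I"
  obtains M where "maximal_left_ideal M R" "I \<subseteq> M"
proof -
  interpret reg: left_module R "regular_module R" by (rule regular_left_module)
  have unit: "J = carrier R" if "submodule J R (regular_module R)" "\<one> \<in> J" for J
  proof -
    have "x \<in> J" if "x \<in> carrier R" for x
      using reg.submoduleD(5)[OF \<open>submodule J R _\<close> that \<open>\<one> \<in> J\<close>] that by simp
    then show ?thesis using reg.submoduleD(1)[OF \<open>submodule J R _\<close>] by auto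
  qed
  obtain M where M: "submodule M R (regular_module R)" "I \<subseteq> M" "\<one> \<notin> M"
    and max: "\<And>J. submodule J R (regular_module R) \<Longrightarrow> M \<subseteq> J \<Longrightarrow> \<one> \<notin> J \<Longrightarrow> J = M"
    using reg.exists_maximal_avoiding[OF I] by blast
  have "maximal_left_ideal M R"
    unfolding maximal_left_ideal_def using M max unit by auto
  then show thesis using that M(2) by blast
qed

lemma maximal_left_idealD:
  assumes "maximal_left_ideal M R"
  shows "submodule M R (regular_module R)" "M \<subseteq> carrier R" "\<one> \<notin> M"
    "\<And>J. submodule J R (regular_module R) \<Longrightarrow> M \<subseteq> J \<Longrightarrow> J = M \<or> J = carrier R"
proof -
  interpret reg: left_module R "regular_module R" by (rule regular_left_module)
  show M: "submodule M R (regular_module R)"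
    and "\<And>J. submodule J R (regular_module R) \<Longrightarrow> M \<subseteq> J \<Longrightarrow> J = M \<or> J = carrier R"
    using assms by (auto simp: maximal_left_ideal_def)
  note s = reg.submoduleD[OF M, simplified]
  show "M \<subseteq> carrier R" by (rule s(1))
  have "M \<noteq> carrier R" using assms by (auto simp: maximal_left_ideal_def)
  then show "\<one> \<notin> M" using s(1) s(5)[of _ \<one>] r_one by fastforce
qed

text \<open>For \<open>b \<notin> M\<close> the left ideal \<open>(M : b)\<close> is again maximal, because multiplication by \<open>b\<close> embeds
  \<open>R / (M : b)\<close> into the simple module \<open>R / M\<close>. This is what makes the intersection of all
  maximal left ideals a right ideal.\<close>

lemma maximal_left_ideal_colon:
  assumes M: "maximal_left_ideal M R" and b: "b \<in> carrier R" "b \<notin> M"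
  shows "maximal_left_ideal {x \<in> carrier R. x \<otimes> b \<in> M} R"
proof -
  interpret reg: left_module R "regular_module R" by (rule regular_left_module)
  note m = maximal_left_idealD[OF M]
  note s = reg.submoduleD[OF m(1), simplified]
  let ?Q = "{x \<in> carrier R. x \<otimes> b \<in> M}"
  have Q: "submodule ?Q R (regular_module R)"
    using b s by (intro reg.submoduleI) (auto simp: l_distr m_assoc)
  moreover have "\<one> \<notin> ?Q" using b by simp
  then have "?Q \<noteq> carrier R" using one_closed by blast
  moreover have "J = carrier R"
    if J: "submodule J R (regular_module R)" "?Q \<subseteq> J" "J \<noteq> ?Q" for J
  proof -
    note j = reg.submoduleD[OF J(1), simplified]
    obtain y where y: "y \<in> J" "y \<otimes> b \<notin> M" using J j by blast
    have yb: "y \<otimes> b \<in> carrier (regular_module R)" using y j b by simp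
    note cyc = reg.submodule_cyclic[OF yb]
    let ?W = "M <+>\<^bsub>regular_module R\<^esub> {a \<odot>\<^bsub>regular_module R\<^esub> (y \<otimes> b) | a. a \<in> carrier R}"
    have "?W = carrier R"
      using m(4)[OF reg.submodule_set_add[OF m(1) cyc] reg.set_add_upper1[OF m(1) cyc]]
        reg.set_add_upper2[OF m(1) cyc] reg.cyclic_self[OF yb] y(2) by blast
    have "z \<in> J" if z: "z \<in> carrier R" for z
    proof -
      have "z \<otimes> b \<in> ?W" using z b \<open>?W = carrier R\<close> by simp
      then obtain u a where u: "u \<in> M" "a \<in> carrier R" "z \<otimes> b = u \<oplus> a \<otimes> (y \<otimes> b)"
        by (auto elim!: reg.set_addE)
      have c: "y \<in> carrier R" "u \<in> carrier R" using y u j s by auto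
      have "(z \<ominus> a \<otimes> y) \<otimes> b = z \<otimes> b \<ominus> a \<otimes> (y \<otimes> b)"
        using z u c b by (simp add: a_minus_def l_distr l_minus m_assoc)
      also have "\<dots> = u"
        using u c b by (simp add: a_minus_def a_assoc r_neg)
      finally have "z \<ominus> a \<otimes> y \<in> ?Q" using u z c by simp
      then have "z \<ominus> a \<otimes> y \<in> J" using J(2) by blast
      then have "(z \<ominus> a \<otimes> y) \<oplus> a \<otimes> y \<in> J" using j u y by blast
      then show ?thesis using z u c by (simp add: a_minus_def a_assoc l_neg)
    qed
    then show ?thesis using j(1) by blast
  qed
  ultimately show ?thesis unfolding maximal_left_ideal_def by blast
qed

lemma jacobson_radical_ideal: "ideal (jacobson_radical R) R"
proof -
  interpret reg: left_module R "regular_module R" by (rule regular_left_module)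
  have iff: "x \<in> jacobson_radical R \<longleftrightarrow> x \<in> carrier R \<and> (\<forall>M. maximal_left_ideal M R \<longrightarrow> x \<in> M)" for x
    by (auto simp: jacobson_radical_def)
  note s = reg.submoduleD[OF maximal_left_idealD(1), simplified]
  have left: "submodule (jacobson_radical R) R (regular_module R)"
    using s(3,4,5) by (intro reg.submoduleI) (auto simp: iff)
  have right: "x \<otimes> b \<in> jacobson_radical R" if x: "x \<in> jacobson_radical R" and b: "b \<in> carrier R" for x b
    unfolding iff
  proof (intro conjI allI impI)
    show "x \<otimes> b \<in> carrier R" using x b by (simp add: iff)
    fix M assume M: "maximal_left_ideal M R"
    show "x \<otimes> b \<in> M"
    proof (cases "b \<in> M")
      case True
      then show ?thesis using s(5)[OF M, of x b] x by (simp add: iff)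
    next
      case False
      then show ?thesis using maximal_left_ideal_colon[OF M b False] x by (auto simp: iff)
    qed
  qed
  note l = reg.submoduleD[OF left, simplified]
  show ?thesis
  proof (rule idealI)
    show "subgroup (jacobson_radical R) (add_monoid R)"
    proof (rule add.subgroupI)
      show "\<ominus> x \<in> jacobson_radical R" if "x \<in> jacobson_radical R" for x
        using l(5)[of "\<ominus> \<one>" x] l(2)[of x] that by (simp add: l_minus)
    qed (use l in auto)
  qed (use l right ring_axioms in auto)
qed

lemma radical_power_ideal: "ideal (radical_power R n) R"
  by (induction n) (auto simp: oneideal jacobson_radical_ideal ideal_prod_is_ideal)

lemma radical_power_closed [simp]: "x \<in> radical_power R n \<Longrightarrow> x \<in> carrier R"
  using ideal.Icarr[OF radical_power_ideal] .

lemma radical_power_Suc_subset: "radical_power R (Suc n) \<subseteq> radical_power R n"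
  using ideal_prod_inter[OF jacobson_radical_ideal radical_power_ideal] by auto

lemma radical_power_antimono:
  assumes "m \<le> n"
  shows "radical_power R n \<subseteq> radical_power R m"
  using assms by (induction n rule: dec_induct) (use radical_power_Suc_subset in blast)+

lemma radical_power_Suc_right:
  "radical_power R (Suc n) = ideal_prod R (radical_power R n) (jacobson_radical R)"
proof (induction n)
  case 0
  note J = jacobson_radical_ideal
  have "jacobson_radical R \<subseteq> ideal_prod R (carrier R) (jacobson_radical R)"
  proof
    fix x assume x: "x \<in> jacobson_radical R"
    then show "x \<in> ideal_prod R (carrier R) (jacobson_radical R)"
      using ideal_prod.prod[of \<one> "carrier R" x "jacobson_radical R" R] ideal.Icarr[OF J] by simp
  qed
  then show ?case
    using ideal_prod_one[OF J] ideal_prod_inter[OF oneideal J] by auto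
next
  case (Suc n)
  have "radical_power R (Suc (Suc n)) =
      ideal_prod R (jacobson_radical R) (ideal_prod R (radical_power R n) (jacobson_radical R))"
    using Suc by simp
  also have "\<dots> = ideal_prod R (radical_power R (Suc n)) (jacobson_radical R)"
    by (simp add: ideal_prod_assoc jacobson_radical_ideal radical_power_ideal)
  finally show ?case .
qed

lemma radical_power_mult_radical:
  assumes "w \<in> radical_power R n" "x \<in> jacobson_radical R"
  shows "w \<otimes> x \<in> radical_power R (Suc n)"
  unfolding radical_power_Suc_right using assms by (rule ideal_prod.prod)

end

text \<open>If \<open>e\<close> lies in the radical and \<open>x \<noteq> 0\<close>, then the annihilator of \<open>x\<close> is contained in a maximal
  left ideal, which contains \<open>e\<close> and therefore cannot contain \<open>1 - e\<close>.\<close>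

lemma (in left_module) radical_fixed_imp_zero:
  assumes e: "e \<in> jacobson_radical R" and x: "x \<in> carrier M" and fixed: "e \<odot>\<^bsub>M\<^esub> x = x"
  shows "x = \<zero>\<^bsub>M\<^esub>"
proof (rule ccontr)
  assume "x \<noteq> \<zero>\<^bsub>M\<^esub>"
  interpret reg: left_module R "regular_module R" by (rule R.regular_left_module)
  have eR: "e \<in> carrier R" using e ideal.Icarr[OF R.jacobson_radical_ideal] by blast
  let ?I = "{a \<in> carrier R. a \<odot>\<^bsub>M\<^esub> x = \<zero>\<^bsub>M\<^esub>}"
  have "submodule ?I R (regular_module R)"
    using x by (intro reg.submoduleI) (auto simp: smult_l_distr smult_assoc)
  moreover have "\<one>\<^bsub>R\<^esub> \<notin> ?I" using x \<open>x \<noteq> \<zero>\<^bsub>M\<^esub>\<close> by simp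
  ultimately obtain N where N: "maximal_left_ideal N R" "?I \<subseteq> N"
    by (rule R.exists_maximal_left_ideal)
  note n = reg.submoduleD[OF R.maximal_left_idealD(1)[OF N(1)], simplified]
  have "(\<one>\<^bsub>R\<^esub> \<ominus>\<^bsub>R\<^esub> e) \<odot>\<^bsub>M\<^esub> x = \<zero>\<^bsub>M\<^esub>"
    using eR x fixed by (simp add: a_minus_def smult_l_distr smult_minus_left M.r_neg)
  then have "\<one>\<^bsub>R\<^esub> \<ominus>\<^bsub>R\<^esub> e \<in> N" using N(2) eR by auto
  moreover have "e \<in> N" using e N(1) by (auto simp: jacobson_radical_def)
  ultimately have "(\<one>\<^bsub>R\<^esub> \<ominus>\<^bsub>R\<^esub> e) \<oplus>\<^bsub>R\<^esub> e \<in> N" by (rule n(4))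
  then have "\<one>\<^bsub>R\<^esub> \<in> N" using eR by (simp add: a_minus_def R.a_assoc R.l_neg)
  then show False using R.maximal_left_idealD(3)[OF N(1)] by blast
qed

text \<open>If the powers of the radical stabilise at \<open>I \<noteq> 0\<close>, then \<open>I J = I\<close>. A left ideal \<open>L\<close> that
  is minimal with \<open>I L \<noteq> 0\<close> satisfies \<open>L = J x\<close> for some \<open>x \<in> L\<close> with \<open>I x \<noteq> 0\<close>, so that
  \<open>x \<in> J x\<close>, and hence \<open>x = 0\<close>.\<close>

lemma (in artin_algebra) radical_nilpotent: "\<exists>n. radical_power A n = {\<zero>\<^bsub>A\<^esub>}"
proof -
  interpret reg: left_module A "regular_module A" by (rule A.regular_left_module)
  have dcc: "dcc_on A (regular_module A) (carrier (regular_module A))"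
    by (rule fg_left_module_dcc[OF regular_fg])
  let ?J = "jacobson_radical A"
  note J = A.jacobson_radical_ideal
  have "\<exists>n. \<forall>i\<ge>n. radical_power A i = radical_power A n"
  proof (rule dcc_onD[OF dcc])
    fix i
    show "submodule (radical_power A i) A (regular_module A)"
      by (rule A.ideal_imp_submodule_regular[OF A.radical_power_ideal])
    show "radical_power A i \<subseteq> carrier (regular_module A)" by auto
  qed (rule A.radical_power_Suc_subset)
  then obtain n where n: "\<forall>i\<ge>n. radical_power A i = radical_power A n" ..
  define I where "I = radical_power A n"
  have IJ: "ideal_prod A I ?J = I"
    using n[rule_format, of "Suc n"] by (simp only: I_def flip: A.radical_power_Suc_right)
  have IA: "w \<in> carrier A" if "w \<in> I" for w using that by (simp add: I_def)
  have JA: "w \<in> carrier A" if "w \<in> ?J" for w using that ideal.Icarr[OF J] by blast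
  have "I = {\<zero>\<^bsub>A\<^esub>}"
  proof (rule ccontr)
    assume "I \<noteq> {\<zero>\<^bsub>A\<^esub>}"
    moreover have "\<zero>\<^bsub>A\<^esub> \<in> I"
      using reg.submoduleD(3)[OF A.ideal_imp_submodule_regular[OF A.radical_power_ideal]]
      by (simp add: I_def)
    ultimately obtain w0 where w0: "w0 \<in> I" "w0 \<noteq> \<zero>\<^bsub>A\<^esub>" by blast
    define F where "F = {L. submodule L A (regular_module A) \<and> (\<exists>x\<in>L. \<exists>w\<in>I. w \<otimes>\<^bsub>A\<^esub> x \<noteq> \<zero>\<^bsub>A\<^esub>)}"
    have "\<exists>x\<in>carrier A. \<exists>w\<in>I. w \<otimes>\<^bsub>A\<^esub> x \<noteq> \<zero>\<^bsub>A\<^esub>"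
      using w0 IA by (intro bexI[of _ "\<one>\<^bsub>A\<^esub>"] bexI[of _ w0]) auto
    then have "carrier (regular_module A) \<in> F"
      using reg.submodule_carrier by (simp add: F_def)
    then have "F \<noteq> {}" by blast
    obtain L where L: "L \<in> F" and min: "\<And>T. T \<in> F \<Longrightarrow> T \<subseteq> L \<Longrightarrow> T = L"
      by (rule reg.dcc_on_minimal[OF dcc _ \<open>F \<noteq> {}\<close>]) (auto simp: F_def)
    then obtain x w where x: "x \<in> L" "w \<in> I" "w \<otimes>\<^bsub>A\<^esub> x \<noteq> \<zero>\<^bsub>A\<^esub>"
      and Lsub: "submodule L A (regular_module A)" by (auto simp: F_def)
    note l = reg.submoduleD[OF Lsub, simplified]
    have xA: "x \<in> carrier A" using x l by blast
    have Jx: "submodule ((\<lambda>j. j \<otimes>\<^bsub>A\<^esub> x) ` ?J) A (regular_module A)"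
    proof (rule reg.submoduleI)
      note j = reg.submoduleD[OF A.ideal_imp_submodule_regular[OF J], simplified]
      show "(\<lambda>j. j \<otimes>\<^bsub>A\<^esub> x) ` ?J \<subseteq> carrier (regular_module A)" using JA xA by auto
      show "\<zero>\<^bsub>regular_module A\<^esub> \<in> (\<lambda>j. j \<otimes>\<^bsub>A\<^esub> x) ` ?J"
        using j(3) xA by (intro image_eqI[of _ _ "\<zero>\<^bsub>A\<^esub>"]) auto
      fix y z assume "y \<in> (\<lambda>j. j \<otimes>\<^bsub>A\<^esub> x) ` ?J" "z \<in> (\<lambda>j. j \<otimes>\<^bsub>A\<^esub> x) ` ?J"
      then obtain a b where "a \<in> ?J" "b \<in> ?J" "y = a \<otimes>\<^bsub>A\<^esub> x" "z = b \<otimes>\<^bsub>A\<^esub> x" by blast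
      then show "y \<oplus>\<^bsub>regular_module A\<^esub> z \<in> (\<lambda>j. j \<otimes>\<^bsub>A\<^esub> x) ` ?J"
        using j(4) JA xA by (intro image_eqI[of _ _ "a \<oplus>\<^bsub>A\<^esub> b"]) (auto simp: A.l_distr)
    next
      note j = reg.submoduleD[OF A.ideal_imp_submodule_regular[OF J], simplified]
      fix a y assume "a \<in> carrier A" "y \<in> (\<lambda>j. j \<otimes>\<^bsub>A\<^esub> x) ` ?J"
      moreover from this obtain b where "b \<in> ?J" "y = b \<otimes>\<^bsub>A\<^esub> x" by blast
      ultimately show "a \<odot>\<^bsub>regular_module A\<^esub> y \<in> (\<lambda>j. j \<otimes>\<^bsub>A\<^esub> x) ` ?J"
        using j(5) JA xA by (intro image_eqI[of _ _ "a \<otimes>\<^bsub>A\<^esub> b"]) (auto simp: A.m_assoc)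
    qed
    have "\<exists>y\<in>(\<lambda>j. j \<otimes>\<^bsub>A\<^esub> x) ` ?J. \<exists>v\<in>I. v \<otimes>\<^bsub>A\<^esub> y \<noteq> \<zero>\<^bsub>A\<^esub>"
    proof (rule ccontr)
      assume *: "\<not> ?thesis"
      have "v \<in> carrier A \<and> v \<otimes>\<^bsub>A\<^esub> x = \<zero>\<^bsub>A\<^esub>" if "v \<in> ideal_prod A I ?J" for v
        using that
      proof (induction v rule: ideal_prod.induct)
        case (prod i j)
        then show ?case using * IA JA xA by (auto simp: A.m_assoc)
      next
        case (sum s t)
        then show ?case using xA by (simp add: A.l_distr)
      qed
      then show False using x IJ by blast
    qed
    then have "(\<lambda>j. j \<otimes>\<^bsub>A\<^esub> x) ` ?J \<in> F" using Jx by (simp add: F_def)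
    moreover have "(\<lambda>j. j \<otimes>\<^bsub>A\<^esub> x) ` ?J \<subseteq> L" using l(5) JA x(1) by auto
    ultimately have "(\<lambda>j. j \<otimes>\<^bsub>A\<^esub> x) ` ?J = L" by (rule min)
    then obtain j where "j \<in> ?J" "j \<otimes>\<^bsub>A\<^esub> x = x" using x(1) by (metis imageE)
    then have "x = \<zero>\<^bsub>A\<^esub>" using reg.radical_fixed_imp_zero[of j x] xA by simp
    then show False using x IA by simp
  qed
  then show ?thesis by (auto simp: I_def)
qed

lemma (in artin_algebra) radical_power_loewy_length: "radical_power A (loewy_length A) = {\<zero>\<^bsub>A\<^esub>}"
  unfolding loewy_length_def using radical_nilpotent by (rule LeastI_ex)


section \<open>Homomorphisms, free modules and quotients\<close>

lemma (in abelian_group) diff_zero: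
  assumes "x \<in> carrier G"
  shows "x \<ominus> \<zero> = x"
  using assms r_neg[of \<zero>] by (simp add: a_minus_def)

lemma (in abelian_group) diff_eq_zero_iff:
  assumes "x \<in> carrier G" "y \<in> carrier G"
  shows "x \<ominus> y = \<zero> \<longleftrightarrow> x = y"
proof
  assume "x \<ominus> y = \<zero>"
  then have "(x \<ominus> y) \<oplus> y = y" using assms by simp
  then show "x = y" using assms by (simp add: a_minus_def a_assoc l_neg)
qed (use assms in \<open>simp add: a_minus_def r_neg\<close>)

lemma a_kernel_iff: "x \<in> a_kernel M N f \<longleftrightarrow> x \<in> carrier M \<and> f x = \<zero>\<^bsub>N\<^esub>"
  by (auto simp: a_kernel_def kernel_def)

lemma module_homI:
  assumes "\<And>x. x \<in> carrier M \<Longrightarrow> f x \<in> carrier N"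
    "\<And>x y. x \<in> carrier M \<Longrightarrow> y \<in> carrier M \<Longrightarrow> f (x \<oplus>\<^bsub>M\<^esub> y) = f x \<oplus>\<^bsub>N\<^esub> f y"
    "\<And>a x. a \<in> carrier R \<Longrightarrow> x \<in> carrier M \<Longrightarrow> f (a \<odot>\<^bsub>M\<^esub> x) = a \<odot>\<^bsub>N\<^esub> f x"
  shows "f \<in> module_hom R M N"
  using assms by (auto simp: module_hom_def)

lemma module_homD:
  assumes "f \<in> module_hom R M N"
  shows "\<And>x. x \<in> carrier M \<Longrightarrow> f x \<in> carrier N"
    "\<And>x y. x \<in> carrier M \<Longrightarrow> y \<in> carrier M \<Longrightarrow> f (x \<oplus>\<^bsub>M\<^esub> y) = f x \<oplus>\<^bsub>N\<^esub> f y"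
    "\<And>a x. a \<in> carrier R \<Longrightarrow> x \<in> carrier M \<Longrightarrow> f (a \<odot>\<^bsub>M\<^esub> x) = a \<odot>\<^bsub>N\<^esub> f x"
  using assms by (auto simp: module_hom_def)

lemma module_hom_compose:
  assumes "f \<in> module_hom R M N" "g \<in> module_hom R N P"
  shows "(\<lambda>x. g (f x)) \<in> module_hom R M P"
  using module_homD[OF assms(1)] module_homD[OF assms(2)] by (intro module_homI) auto

lemma module_hom_zero:
  assumes "left_module R M" "left_module R N" "f \<in> module_hom R M N"
  shows "f \<zero>\<^bsub>M\<^esub> = \<zero>\<^bsub>N\<^esub>"
proof -
  interpret M: left_module R M by fact
  interpret N: left_module R N by fact
  have "f (\<zero>\<^bsub>R\<^esub> \<odot>\<^bsub>M\<^esub> \<zero>\<^bsub>M\<^esub>) = \<zero>\<^bsub>R\<^esub> \<odot>\<^bsub>N\<^esub> f \<zero>\<^bsub>M\<^esub>"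
    by (rule module_homD(3)[OF assms(3)]) auto
  then show ?thesis
    using module_homD(1)[OF assms(3) M.M.zero_closed] by simp
qed

lemma module_hom_diff:
  assumes "left_module R M" "left_module R N" "f \<in> module_hom R M N"
    and x: "x \<in> carrier M" and y: "y \<in> carrier M"
  shows "f (x \<ominus>\<^bsub>M\<^esub> y) = f x \<ominus>\<^bsub>N\<^esub> f y"
proof -
  interpret M: left_module R M by fact
  interpret N: left_module R N by fact
  note h = module_homD[OF assms(3)]
  have "f (x \<oplus>\<^bsub>M\<^esub> (\<ominus>\<^bsub>R\<^esub> \<one>\<^bsub>R\<^esub>) \<odot>\<^bsub>M\<^esub> y) = f x \<oplus>\<^bsub>N\<^esub> (\<ominus>\<^bsub>R\<^esub> \<one>\<^bsub>R\<^esub>) \<odot>\<^bsub>N\<^esub> f y"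
    using x y by (subst h(2)) (auto simp: h(3))
  then show ?thesis
    using x y h(1) by (simp add: M.smult_minus_one N.smult_minus_one a_minus_def)
qed

lemma submodule_preimage:
  assumes "left_module R M" "left_module R N" "f \<in> module_hom R M N" "submodule T R N"
  shows "submodule {x \<in> carrier M. f x \<in> T} R M"
proof -
  interpret M: left_module R M by fact
  interpret N: left_module R N by fact
  show ?thesis
    using module_homD[OF assms(3)] N.submoduleD[OF assms(4)] module_hom_zero[OF assms(1,2,3)]
    by (intro M.submoduleI) auto
qed

lemma submodule_a_kernel:
  assumes "left_module R M" "left_module R N" "f \<in> module_hom R M N"
  shows "submodule (a_kernel M N f) R M"
proof -
  have "a_kernel M N f = {x \<in> carrier M. f x \<in> {\<zero>\<^bsub>N\<^esub>}}" by (auto simp: a_kernel_iff)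
  then show ?thesis
    using submodule_preimage[OF assms left_module.submodule_zero[OF assms(2)]] by simp
qed

lemma submodule_image:
  assumes "left_module R M" "left_module R N" "f \<in> module_hom R M N" "submodule T R M"
  shows "submodule (f ` T) R N"
proof -
  interpret M: left_module R M by fact
  interpret N: left_module R N by fact
  note h = module_homD[OF assms(3)] and t = M.submoduleD[OF assms(4)]
  show ?thesis
  proof (rule N.submoduleI)
    show "f ` T \<subseteq> carrier N" using h(1) t(2) by auto
    show "\<zero>\<^bsub>N\<^esub> \<in> f ` T" using t(3) module_hom_zero[OF assms(1,2,3)] by (metis imageI)
    fix x y assume "x \<in> f ` T" "y \<in> f ` T"
    then obtain u v where "u \<in> T" "v \<in> T" "x = f u" "y = f v" by blast
    then show "x \<oplus>\<^bsub>N\<^esub> y \<in> f ` T"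
      using h(2) t by (intro image_eqI[of _ _ "u \<oplus>\<^bsub>M\<^esub> v"]) auto
  next
    fix a x assume "a \<in> carrier R" "x \<in> f ` T"
    moreover from this obtain u where "u \<in> T" "x = f u" by blast
    ultimately show "a \<odot>\<^bsub>N\<^esub> x \<in> f ` T"
      using h(3) t by (intro image_eqI[of _ _ "a \<odot>\<^bsub>M\<^esub> u"]) auto
  qed
qed

lemma fg_left_module_image:
  assumes M: "fg_left_module R M" and N: "left_module R N" and f: "f \<in> module_hom R M N"
    and surj: "f ` carrier M = carrier N"
  shows "fg_left_module R N"
proof -
  have M': "left_module R M" "fin_gen R M" using M by (auto simp: fg_left_module_def)
  interpret M: left_module R M by fact
  interpret N: left_module R N by fact
  obtain G where G: "finite G" "G \<subseteq> carrier M"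
    "\<And>T. submodule T R M \<Longrightarrow> G \<subseteq> T \<Longrightarrow> carrier M \<subseteq> T"
    using M'(2) unfolding M.fin_gen_iff fg_submodule_def by blast
  have "carrier N \<subseteq> T" if T: "submodule T R N" "f ` G \<subseteq> T" for T
  proof -
    have "carrier M \<subseteq> {x \<in> carrier M. f x \<in> T}"
      using G(2) T(2) by (intro G(3) submodule_preimage[OF M'(1) N f T(1)]) auto
    then show ?thesis unfolding surj[symmetric] by blast
  qed
  moreover have "f ` G \<subseteq> carrier N" using G(2) surj by blast
  ultimately have "fg_submodule R N (carrier N)"
    unfolding fg_submodule_def using N.submodule_carrier G(1)
    by (intro conjI exI[of _ "f ` G"]) auto
  then show ?thesis using N by (simp add: fg_left_module_def N.fin_gen_iff)
qed

lemma module_power_simps [simp]: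
  "carrier (module_power U r) = {..<r} \<rightarrow>\<^sub>E carrier U"
  "\<zero>\<^bsub>module_power U r\<^esub> = (\<lambda>i\<in>{..<r}. \<zero>\<^bsub>U\<^esub>)"
  "x \<oplus>\<^bsub>module_power U r\<^esub> y = (\<lambda>i\<in>{..<r}. x i \<oplus>\<^bsub>U\<^esub> y i)"
  "a \<odot>\<^bsub>module_power U r\<^esub> x = (\<lambda>i\<in>{..<r}. a \<odot>\<^bsub>U\<^esub> x i)"
  by (simp_all add: module_power_def)

lemma module_power_left_module:
  fixes U :: "('a, 'm) module"
  assumes "left_module R U"
  shows "left_module R (module_power U r)"
proof -
  interpret U: left_module R U by fact
  have mem: "x i \<in> carrier U" if "x \<in> {..<r} \<rightarrow>\<^sub>E carrier U" "i < r" for x i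
    using that by auto
  have "abelian_group (module_power U r)"
  proof (rule abelian_groupI)
    fix x assume x: "x \<in> carrier (module_power U r)"
    show "\<exists>y\<in>carrier (module_power U r). y \<oplus>\<^bsub>module_power U r\<^esub> x = \<zero>\<^bsub>module_power U r\<^esub>"
    proof (rule bexI)
      show "(\<lambda>i\<in>{..<r}. \<ominus>\<^bsub>U\<^esub> x i) \<oplus>\<^bsub>module_power U r\<^esub> x = \<zero>\<^bsub>module_power U r\<^esub>"
        using x by (simp add: mem U.M.l_neg cong: restrict_cong)
      show "(\<lambda>i\<in>{..<r}. \<ominus>\<^bsub>U\<^esub> x i) \<in> carrier (module_power U r)" using x by (simp add: mem)
    qed
  qed (simp_all add: mem U.M.a_ac cong: restrict_cong)
  moreover have "left_module_axioms R (module_power U r)"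
    by unfold_locales (simp_all add: mem U.smult_l_distr U.smult_r_distr U.smult_assoc
        cong: restrict_cong)
  ultimately show ?thesis
    using U.R.ring_axioms by (simp add: left_module_def)
qed

text \<open>If \<open>X\<close> is a retract of a power of \<open>U\<close>, given by the components of the two maps, then \<open>X\<close>
  belongs to \<open>add(U)\<close>.\<close>

lemma in_addI:
  fixes X U :: "'a fgmod" and r :: nat
  assumes X: "fg_left_module R X" and U: "left_module R U"
    and \<alpha>: "\<And>j. j < r \<Longrightarrow> \<alpha> j \<in> module_hom R X U"
    and \<beta>: "\<And>j. j < r \<Longrightarrow> \<beta> j \<in> module_hom R U X"
    and sum: "\<And>x. x \<in> carrier X \<Longrightarrow> (\<Oplus>\<^bsub>X\<^esub>j\<in>{..<r}. \<beta> j (\<alpha> j x)) = x"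
  shows "in_add R U X"
proof -
  have lX: "left_module R X" using X by (simp add: fg_left_module_def)
  interpret X: left_module R X by fact
  interpret U: left_module R U by fact
  have lP: "left_module R (module_power U r)" by (rule module_power_left_module[OF U])
  interpret P: left_module R "module_power U r" by fact
  define a where "a x = (\<lambda>j\<in>{..<r}. \<alpha> j x)" for x
  define b where "b u = (\<Oplus>\<^bsub>X\<^esub>j\<in>{..<r}. \<beta> j (u j))" for u
  note ha = module_homD[OF \<alpha>] and hb = module_homD[OF \<beta>]
  have a: "a \<in> module_hom R X (module_power U r)"
    by (rule module_homI) (auto simp: a_def ha intro!: restrict_ext)
  have b: "b \<in> module_hom R (module_power U r) X"
  proof (rule module_homI)
    fix u assume u: "u \<in> carrier (module_power U r)"
    then have uj: "u j \<in> carrier U" if "j < r" for j using that by auto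
    then have \<beta>u: "(\<lambda>j. \<beta> j (u j)) \<in> {..<r} \<rightarrow> carrier X" by (auto intro!: hb)
    then show "b u \<in> carrier X" by (auto simp: b_def intro!: X.M.finsum_closed)
    fix v assume v: "v \<in> carrier (module_power U r)"
    then have vj: "v j \<in> carrier U" if "j < r" for j using that by auto
    then have \<beta>v: "(\<lambda>j. \<beta> j (v j)) \<in> {..<r} \<rightarrow> carrier X" by (auto intro!: hb)
    have "b (u \<oplus>\<^bsub>module_power U r\<^esub> v) = (\<Oplus>\<^bsub>X\<^esub>j\<in>{..<r}. \<beta> j (u j) \<oplus>\<^bsub>X\<^esub> \<beta> j (v j))"
      unfolding b_def using \<beta>u \<beta>v by (intro X.M.finsum_cong') (simp_all add: hb uj vj Pi_iff)
    also have "\<dots> = b u \<oplus>\<^bsub>X\<^esub> b v"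
      unfolding b_def using \<beta>u \<beta>v by (rule X.M.finsum_addf)
    finally show "b (u \<oplus>\<^bsub>module_power U r\<^esub> v) = b u \<oplus>\<^bsub>X\<^esub> b v" .
  next
    fix c u assume c: "c \<in> carrier R" and u: "u \<in> carrier (module_power U r)"
    then have uj: "u j \<in> carrier U" if "j < r" for j using that by auto
    then have \<beta>u: "(\<lambda>j. \<beta> j (u j)) \<in> {..<r} \<rightarrow> carrier X" by (auto intro!: hb)
    have "b (c \<odot>\<^bsub>module_power U r\<^esub> u) = (\<Oplus>\<^bsub>X\<^esub>j\<in>{..<r}. c \<odot>\<^bsub>X\<^esub> \<beta> j (u j))"
      unfolding b_def using c \<beta>u by (intro X.M.finsum_cong') (simp_all add: hb uj Pi_iff)
    also have "\<dots> = c \<odot>\<^bsub>X\<^esub> b u"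
      unfolding b_def using \<beta>u c by (intro X.finsum_smult) auto
    finally show "b (c \<odot>\<^bsub>module_power U r\<^esub> u) = c \<odot>\<^bsub>X\<^esub> b u" .
  qed
  have ba: "b (a x) = x" if "x \<in> carrier X" for x
  proof -
    have "b (a x) = (\<Oplus>\<^bsub>X\<^esub>j\<in>{..<r}. \<beta> j (\<alpha> j x))"
      unfolding b_def using that by (intro X.M.finsum_cong') (auto simp: a_def intro!: ha hb)
    then show ?thesis using sum[OF that] by simp
  qed
  define N where "N = a ` carrier X"
  define N' where "N' = a_kernel (module_power U r) X b"
  have N: "submodule N R (module_power U r)"
    unfolding N_def by (rule submodule_image[OF lX lP a X.submodule_carrier])
  have N': "submodule N' R (module_power U r)"
    unfolding N'_def by (rule submodule_a_kernel[OF lP lX b])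
  have "N <+>\<^bsub>module_power U r\<^esub> N' = carrier (module_power U r)"
  proof
    show "N <+>\<^bsub>module_power U r\<^esub> N' \<subseteq> carrier (module_power U r)"
      using P.submoduleD(1)[OF P.submodule_set_add[OF N N']] .
    show "carrier (module_power U r) \<subseteq> N <+>\<^bsub>module_power U r\<^esub> N'"
    proof
      fix u assume u: "u \<in> carrier (module_power U r)"
      note bu = module_homD(1)[OF b u] and abu = module_homD(1)[OF a module_homD(1)[OF b u]]
      have "b (u \<ominus>\<^bsub>module_power U r\<^esub> a (b u)) = b u \<ominus>\<^bsub>X\<^esub> b u"
        using module_hom_diff[OF lP lX b u abu] ba[OF bu] by simp
      then have "u \<ominus>\<^bsub>module_power U r\<^esub> a (b u) \<in> N'"
        using u abu bu by (simp only: N'_def a_kernel_iff) (auto simp: a_minus_def X.M.r_neg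
            simp del: module_power_simps)
      moreover have "a (b u) \<in> N" using bu by (simp add: N_def)
      moreover have "u = a (b u) \<oplus>\<^bsub>module_power U r\<^esub> (u \<ominus>\<^bsub>module_power U r\<^esub> a (b u))"
        using u abu unfolding a_minus_def
        by (metis P.M.a_comm P.M.a_inv_closed P.M.add.m_closed P.M.r_neg1 P.M.r_neg2 P.M.minus_minus)
      ultimately show "u \<in> N <+>\<^bsub>module_power U r\<^esub> N'" using P.set_addI by metis
    qed
  qed
  moreover have "N \<inter> N' = {\<zero>\<^bsub>module_power U r\<^esub>}"
  proof
    show "N \<inter> N' \<subseteq> {\<zero>\<^bsub>module_power U r\<^esub>}"
    proof
      fix u assume "u \<in> N \<inter> N'"
      then obtain x where x: "x \<in> carrier X" "u = a x" "b u = \<zero>\<^bsub>X\<^esub>"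
        by (auto simp: N_def N'_def a_kernel_iff simp del: module_power_simps)
      then have "u = a \<zero>\<^bsub>X\<^esub>" using ba[OF x(1)] by simp
      then show "u \<in> {\<zero>\<^bsub>module_power U r\<^esub>}" using module_hom_zero[OF lX lP a] by simp
    qed
    show "{\<zero>\<^bsub>module_power U r\<^esub>} \<subseteq> N \<inter> N'"
      using P.submoduleD(3)[OF N] P.submoduleD(3)[OF N'] by blast
  qed
  ultimately have "direct_summand R N (module_power U r)"
    using N N' by (auto simp: direct_summand_def simp del: module_power_simps)
  moreover have "module_iso R X ((module_power U r)\<lparr>carrier := N\<rparr>)"
    unfolding module_iso_def
  proof (rule bexI[of _ a])
    show "a \<in> module_hom R X ((module_power U r)\<lparr>carrier := N\<rparr>)"
      using module_homD[OF a] by (intro module_homI) (auto simp: N_def)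
    have "inj_on a (carrier X)" by (rule inj_on_inverseI[of _ b]) (rule ba)
    then show "bij_betw a (carrier X) (carrier ((module_power U r)\<lparr>carrier := N\<rparr>))"
      by (simp add: bij_betw_def N_def)
  qed
  ultimately show ?thesis using X by (auto simp: in_add_def)
qed

text \<open>The free module of rank \<open>n\<close>, as the \<open>n\<close>-th power of the regular module. Its elements are
  the functions on \<open>{..<n}\<close>, extended by \<open>undefined\<close>.\<close>

definition free_module :: "('a, 'c) ring_scheme \<Rightarrow> nat \<Rightarrow> ('a, nat \<Rightarrow> 'a) module" where
  "free_module R n = module_power (regular_module R) n"

text \<open>The standard basis of the free module of rank \<open>n\<close>, for \<open>j < n\<close>.\<close>

definition unit_vector :: "('a, 'c) ring_scheme \<Rightarrow> nat \<Rightarrow> nat \<Rightarrow> nat \<Rightarrow> 'a" where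
  "unit_vector R n j = (\<lambda>i\<in>{..<n}. if i = j then \<one>\<^bsub>R\<^esub> else \<zero>\<^bsub>R\<^esub>)"

lemma free_module_simps [simp]:
  "carrier (free_module R n) = {..<n} \<rightarrow>\<^sub>E carrier R"
  "\<zero>\<^bsub>free_module R n\<^esub> = (\<lambda>i\<in>{..<n}. \<zero>\<^bsub>R\<^esub>)"
  "x \<oplus>\<^bsub>free_module R n\<^esub> y = (\<lambda>i\<in>{..<n}. x i \<oplus>\<^bsub>R\<^esub> y i)"
  "a \<odot>\<^bsub>free_module R n\<^esub> x = (\<lambda>i\<in>{..<n}. a \<otimes>\<^bsub>R\<^esub> x i)"
  by (simp_all add: free_module_def)

context ring
begin

lemma free_left_module: "left_module R (free_module R n)"
  unfolding free_module_def by (rule module_power_left_module[OF regular_left_module])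

lemma unit_vector_closed: "unit_vector R n j \<in> carrier (free_module R n)"
  by (auto simp: unit_vector_def)

lemma unit_vectors_generate:
  assumes T: "submodule T R (free_module R n)" and e: "\<And>j. j < n \<Longrightarrow> unit_vector R n j \<in> T"
  shows "carrier (free_module R n) \<subseteq> T"
proof
  interpret F: left_module R "free_module R n" by (rule free_left_module)
  note t = F.submoduleD[OF T]
  fix x assume x: "x \<in> carrier (free_module R n)"
  have "(\<lambda>i\<in>{..<n}. if i < j then x i else \<zero>) \<in> T" if "j \<le> n" for j
    using that
  proof (induction j)
    case 0
    then show ?case using t(3) by (simp add: restrict_def)
  next
    case (Suc j)
    have xj: "x j \<in> carrier R" using Suc.prems by (intro PiE_mem[OF x[unfolded free_module_simps]]) simp
    have "(\<lambda>i\<in>{..<n}. if i < j then x i else \<zero>) \<oplus>\<^bsub>free_module R n\<^esub>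
        x j \<odot>\<^bsub>free_module R n\<^esub> unit_vector R n j \<in> T"
    proof (rule t(4))
      show "(\<lambda>i\<in>{..<n}. if i < j then x i else \<zero>) \<in> T"
        using Suc.IH[OF Suc_leD[OF Suc.prems]] .
      show "x j \<odot>\<^bsub>free_module R n\<^esub> unit_vector R n j \<in> T"
        using xj e Suc.prems by (intro t(5)) auto
    qed
    also have "(\<lambda>i\<in>{..<n}. if i < j then x i else \<zero>) \<oplus>\<^bsub>free_module R n\<^esub>
        x j \<odot>\<^bsub>free_module R n\<^esub> unit_vector R n j = (\<lambda>i\<in>{..<n}. if i < Suc j then x i else \<zero>)"
      unfolding unit_vector_def free_module_simps
    proof (rule restrict_ext)
      fix i assume i: "i \<in> {..<n}"
      have xi: "x i \<in> carrier R" by (rule PiE_mem[OF x[unfolded free_module_simps] i])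
      show "restrict (\<lambda>i. if i < j then x i else \<zero>) {..<n} i \<oplus>
          restrict (\<lambda>i. x j \<otimes> restrict (\<lambda>i. if i = j then \<one> else \<zero>) {..<n} i) {..<n} i =
          (if i < Suc j then x i else \<zero>)"
        using i xi xj by (simp add: less_Suc_eq)
    qed
    finally show ?case .
  qed
  from this[of n] have "(\<lambda>i\<in>{..<n}. if i < n then x i else \<zero>) \<in> T" by simp
  moreover have "(\<lambda>i\<in>{..<n}. if i < n then x i else \<zero>) = x"
    using x by (auto simp: PiE_def extensional_def restrict_def)
  ultimately show "x \<in> T" by simp
qed

lemma free_module_fg: "fg_left_module R (free_module R n)"
proof -
  interpret F: left_module R "free_module R n" by (rule free_left_module)
  have "fg_submodule R (free_module R n) (carrier (free_module R n))"
    unfolding fg_submodule_def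
  proof (intro conjI exI[of _ "unit_vector R n ` {..<n}"] allI impI)
    fix T assume "submodule T R (free_module R n)" "unit_vector R n ` {..<n} \<subseteq> T"
    then show "carrier (free_module R n) \<subseteq> T"
      by (intro unit_vectors_generate) auto
  qed (use unit_vector_closed F.submodule_carrier in blast)+
  then show ?thesis
    using F.left_module_axioms by (simp add: fg_left_module_def F.fin_gen_iff)
qed

lemma free_module_hom_eqI:
  assumes "left_module R M" "f \<in> module_hom R (free_module R n) M" "g \<in> module_hom R (free_module R n) M"
    and e: "\<And>j. j < n \<Longrightarrow> f (unit_vector R n j) = g (unit_vector R n j)"
    and x: "x \<in> carrier (free_module R n)"
  shows "f x = g x"
proof -
  interpret M: left_module R M by fact
  interpret F: left_module R "free_module R n" by (rule free_left_module)
  note f = module_homD[OF assms(2)] and g = module_homD[OF assms(3)]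
  have "submodule {x \<in> carrier (free_module R n). f x = g x} R (free_module R n)"
    using module_hom_zero[OF F.left_module_axioms assms(1,2)]
      module_hom_zero[OF F.left_module_axioms assms(1,3)]
    by (intro F.submoduleI)
      (auto simp: f(2,3) g(2,3) F.M.zero_closed F.M.add.m_closed F.smult_closed simp del: free_module_simps)
  then have "carrier (free_module R n) \<subseteq> {x \<in> carrier (free_module R n). f x = g x}"
    using e unit_vector_closed by (intro unit_vectors_generate) auto
  then show ?thesis using x by blast
qed

end

context left_module
begin

lemma lincomb_hom:
  assumes "g \<in> {..<n} \<rightarrow> carrier M"
  shows "lincomb M n g \<in> module_hom R (free_module R n) M"
proof (rule module_homI)
  fix x assume x: "x \<in> carrier (free_module R n)"
  then have x': "x \<in> {..<n} \<rightarrow> carrier R" by auto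
  then show "lincomb M n g x \<in> carrier M" using assms by auto
  show "lincomb M n g (a \<odot>\<^bsub>free_module R n\<^esub> x) = a \<odot>\<^bsub>M\<^esub> lincomb M n g x" if "a \<in> carrier R" for a
    using assms x' that by (subst lincomb_smult[symmetric]) (auto intro!: lincomb_cong)
  fix y assume y: "y \<in> carrier (free_module R n)"
  then have "y \<in> {..<n} \<rightarrow> carrier R" by auto
  then show "lincomb M n g (x \<oplus>\<^bsub>free_module R n\<^esub> y) = lincomb M n g x \<oplus>\<^bsub>M\<^esub> lincomb M n g y"
    using assms x' by (subst lincomb_add[symmetric]) (auto intro!: lincomb_cong)
qed

lemma lincomb_unit_vector:
  assumes "g \<in> {..<n} \<rightarrow> carrier M" "j < n"
  shows "lincomb M n g (unit_vector R n j) = g j"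
proof -
  have "lincomb M n g (unit_vector R n j) = lincomb M n g (\<lambda>i. if i = j then \<one>\<^bsub>R\<^esub> else \<zero>\<^bsub>R\<^esub>)"
    using assms by (intro lincomb_cong) (auto simp: unit_vector_def)
  then show ?thesis using lincomb_unit[OF assms] by simp
qed

lemma fin_gen_free_image:
  assumes "fin_gen R M"
  obtains n f where "f \<in> module_hom R (free_module R n) M" "f ` carrier (free_module R n) = carrier M"
proof -
  obtain n :: nat and g where g: "g \<in> {..<n} \<rightarrow> carrier M"
    and span: "\<And>x. x \<in> carrier M \<Longrightarrow> \<exists>c\<in>{..<n} \<rightarrow> carrier R. x = lincomb M n g c"
    using assms unfolding fin_gen_def lincomb_def by blast
  have "x \<in> lincomb M n g ` carrier (free_module R n)" if x: "x \<in> carrier M" for x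
  proof -
    obtain c where c: "c \<in> {..<n} \<rightarrow> carrier R" "x = lincomb M n g c" using span[OF x] by blast
    have "x = lincomb M n g (restrict c {..<n})"
      unfolding c(2) using c(1) g by (intro lincomb_cong) (auto simp: Pi_iff)
    moreover have "restrict c {..<n} \<in> carrier (free_module R n)" using c(1) by auto
    ultimately show ?thesis by blast
  qed
  moreover have "lincomb M n g x \<in> carrier M" if "x \<in> carrier (free_module R n)" for x
    using module_homD(1)[OF lincomb_hom[OF g] that] .
  ultimately have "lincomb M n g ` carrier (free_module R n) = carrier M" by blast
  then show thesis using that lincomb_hom[OF g] by blast
qed

end

text \<open>The quotient of \<open>M\<close> by a submodule \<open>S\<close>; its elements are the cosets of \<open>S\<close>.\<close>

definition quotient_module ::
  "('a, 'm, 'd) module_scheme \<Rightarrow> 'm set \<Rightarrow> ('a, 'm set) module" where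
  "quotient_module M S =
    \<lparr>carrier = a_rcosets\<^bsub>M\<^esub> S, mult = (\<lambda>X Y. X), one = S, zero = S, add = set_add M,
     smult = (\<lambda>a X. \<Union>x\<in>X. S +>\<^bsub>M\<^esub> (a \<odot>\<^bsub>M\<^esub> x))\<rparr>"

lemma quotient_module_carrier: "carrier (quotient_module M S) = (\<lambda>x. S +>\<^bsub>M\<^esub> x) ` carrier M"
  by (auto simp: quotient_module_def A_RCOSETS_def')

lemma quotient_module_zero: "\<zero>\<^bsub>quotient_module M S\<^esub> = S"
  by (simp add: quotient_module_def)

text \<open>A module with a fixed submodule, by which the quotient is taken.\<close>

locale module_quotient = left_module +
  fixes S
  assumes S: "submodule S R M"
begin

lemma coset_eq_iff:
  assumes "x \<in> carrier M" "y \<in> carrier M"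
  shows "S +>\<^bsub>M\<^esub> x = S +>\<^bsub>M\<^esub> y \<longleftrightarrow> x \<ominus>\<^bsub>M\<^esub> y \<in> S"
proof
  note s = submoduleD[OF S]
  assume "S +>\<^bsub>M\<^esub> x = S +>\<^bsub>M\<^esub> y"
  moreover have "\<zero>\<^bsub>M\<^esub> \<oplus>\<^bsub>M\<^esub> x \<in> S +>\<^bsub>M\<^esub> x" using s assms by (intro M.a_rcosI) auto
  ultimately have "x \<in> S +>\<^bsub>M\<^esub> y" using assms by simp
  then obtain u where "u \<in> S" "x = u \<oplus>\<^bsub>M\<^esub> y" by (auto simp: a_r_coset_def')
  then show "x \<ominus>\<^bsub>M\<^esub> y \<in> S" using assms s(2) by (simp add: a_minus_def M.a_assoc M.r_neg)
next
  note s = submoduleD[OF S]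
  have sub: "subgroup S (add_monoid M)" using S by (rule submodule.axioms(1))
  assume "x \<ominus>\<^bsub>M\<^esub> y \<in> S"
  then have "(x \<ominus>\<^bsub>M\<^esub> y) \<oplus>\<^bsub>M\<^esub> y \<in> S +>\<^bsub>M\<^esub> y" using assms s(1) by (intro M.a_rcosI)
  then have "x \<in> S +>\<^bsub>M\<^esub> y" using assms by (simp add: a_minus_def M.a_assoc M.l_neg)
  then show "S +>\<^bsub>M\<^esub> x = S +>\<^bsub>M\<^esub> y" using M.a_repr_independence[OF _ assms(2) sub] by blast
qed

lemma coset_eq_zero_iff:
  assumes "x \<in> carrier M"
  shows "S +>\<^bsub>M\<^esub> x = S \<longleftrightarrow> x \<in> S"
  using coset_eq_iff[OF assms M.zero_closed] assms submoduleD(1)[OF S] by (simp add: M.diff_zero)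

lemma coset_add:
  assumes "x \<in> carrier M" "y \<in> carrier M"
  shows "(S +>\<^bsub>M\<^esub> x) \<oplus>\<^bsub>quotient_module M S\<^esub> (S +>\<^bsub>M\<^esub> y) = S +>\<^bsub>M\<^esub> (x \<oplus>\<^bsub>M\<^esub> y)"
proof -
  have "abelian_subgroup S M"
    using S M.abelian_group_axioms
    by (intro abelian_subgroupI3 additive_subgroupI submodule.axioms(1))
  then show ?thesis
    using assms by (simp add: quotient_module_def abelian_subgroup.a_rcos_sum)
qed

lemma coset_smult:
  assumes "a \<in> carrier R" "x \<in> carrier M"
  shows "a \<odot>\<^bsub>quotient_module M S\<^esub> (S +>\<^bsub>M\<^esub> x) = S +>\<^bsub>M\<^esub> (a \<odot>\<^bsub>M\<^esub> x)"
proof -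
  note s = submoduleD[OF S]
  have "S +>\<^bsub>M\<^esub> (a \<odot>\<^bsub>M\<^esub> y) = S +>\<^bsub>M\<^esub> (a \<odot>\<^bsub>M\<^esub> x)" if y: "y \<in> S +>\<^bsub>M\<^esub> x" for y
  proof -
    obtain u where u: "u \<in> S" "y = u \<oplus>\<^bsub>M\<^esub> x" using y by (auto simp: a_r_coset_def')
    have "a \<odot>\<^bsub>M\<^esub> y \<ominus>\<^bsub>M\<^esub> a \<odot>\<^bsub>M\<^esub> x = a \<odot>\<^bsub>M\<^esub> u"
      using u assms s(2) by (simp add: smult_r_distr a_minus_def M.a_assoc M.r_neg)
    then show ?thesis using u assms s by (subst coset_eq_iff) auto
  qed
  moreover have "S +>\<^bsub>M\<^esub> x \<noteq> {}" using s(3) by (auto simp: a_r_coset_def')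
  ultimately show ?thesis by (auto simp: quotient_module_def)
qed

lemma quotient_left_module: "left_module R (quotient_module M S)"
proof -
  let ?Q = "quotient_module M S"
  have zero: "\<zero>\<^bsub>?Q\<^esub> = S +>\<^bsub>M\<^esub> \<zero>\<^bsub>M\<^esub>"
    using submoduleD(1)[OF S] by (simp add: quotient_module_zero)
  have "abelian_group ?Q"
  proof (rule abelian_groupI)
    fix X assume "X \<in> carrier ?Q"
    then obtain x where x: "x \<in> carrier M" "X = S +>\<^bsub>M\<^esub> x" by (auto simp: quotient_module_carrier)
    then show "\<exists>Y\<in>carrier ?Q. Y \<oplus>\<^bsub>?Q\<^esub> X = \<zero>\<^bsub>?Q\<^esub>"
      by (intro bexI[of _ "S +>\<^bsub>M\<^esub> (\<ominus>\<^bsub>M\<^esub> x)"])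
        (auto simp: quotient_module_carrier zero coset_add M.l_neg)
  qed (auto simp: quotient_module_carrier zero coset_add M.a_ac)
  moreover have "left_module_axioms R ?Q"
    by unfold_locales (auto simp: quotient_module_carrier coset_add coset_smult
        smult_l_distr smult_r_distr smult_assoc)
  ultimately show ?thesis
    using R.ring_axioms by (simp add: left_module_def)
qed

lemma coset_hom: "(\<lambda>x. S +>\<^bsub>M\<^esub> x) \<in> module_hom R M (quotient_module M S)"
  by (rule module_homI) (auto simp: quotient_module_carrier coset_add coset_smult)

lemma quotient_fg:
  assumes "fin_gen R M"
  shows "fg_left_module R (quotient_module M S)"
  using left_module_axioms assms
  by (intro fg_left_module_image[OF _ quotient_left_module coset_hom])
    (auto simp: fg_left_module_def quotient_module_carrier)

lemma quotient_lift:
  assumes N: "left_module R N" and f: "f \<in> module_hom R M N" and S0: "\<And>x. x \<in> S \<Longrightarrow> f x = \<zero>\<^bsub>N\<^esub>"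
  obtains g where "g \<in> module_hom R (quotient_module M S) N"
    "\<And>x. x \<in> carrier M \<Longrightarrow> g (S +>\<^bsub>M\<^esub> x) = f x"
proof -
  interpret N: left_module R N by fact
  note h = module_homD[OF f]
  define g where "g X = f (SOME x. x \<in> carrier M \<and> X = S +>\<^bsub>M\<^esub> x)" for X
  have g: "g (S +>\<^bsub>M\<^esub> x) = f x" if x: "x \<in> carrier M" for x
  proof -
    define y where "y = (SOME y. y \<in> carrier M \<and> S +>\<^bsub>M\<^esub> x = S +>\<^bsub>M\<^esub> y)"
    have y: "y \<in> carrier M" "S +>\<^bsub>M\<^esub> x = S +>\<^bsub>M\<^esub> y"
      using someI[of "\<lambda>y. y \<in> carrier M \<and> S +>\<^bsub>M\<^esub> x = S +>\<^bsub>M\<^esub> y" x] x by (auto simp: y_def)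
    then have "f (x \<ominus>\<^bsub>M\<^esub> y) = \<zero>\<^bsub>N\<^esub>" using x S0 by (simp add: coset_eq_iff)
    then have "f x \<ominus>\<^bsub>N\<^esub> f y = \<zero>\<^bsub>N\<^esub>"
      using module_hom_diff[OF left_module_axioms N f x y(1)] by simp
    then have "f x = f y" using h(1) x y by (simp add: N.M.diff_eq_zero_iff)
    then show ?thesis by (simp add: g_def y_def)
  qed
  have "g \<in> module_hom R (quotient_module M S) N"
    by (rule module_homI) (auto simp: quotient_module_carrier coset_add coset_smult g h)
  then show thesis using that g by blast
qed

end


section \<open>Minimal covers by summands of free modules\<close>

lemma module_hom_finsum:
  assumes M: "left_module R M" and N: "left_module R N" and f: "f \<in> module_hom R M N"
    and I: "finite I" "u \<in> I \<rightarrow> carrier M"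
  shows "f (\<Oplus>\<^bsub>M\<^esub>i\<in>I. u i) = (\<Oplus>\<^bsub>N\<^esub>i\<in>I. f (u i))"
proof -
  interpret M: left_module R M by fact
  interpret N: left_module R N by fact
  note h = module_homD[OF f]
  show ?thesis
    using I
  proof (induction I rule: finite_induct)
    case empty
    then show ?case using module_hom_zero[OF M N f] by simp
  next
    case (insert i I)
    then have "u i \<in> carrier M" "u \<in> I \<rightarrow> carrier M" "(\<lambda>i. f (u i)) \<in> I \<rightarrow> carrier N"
      using h(1) by (auto simp: Pi_iff)
    then show ?case using insert h by (simp add: M.M.finsum_closed)
  qed
qed

text \<open>An epimorphism \<open>p\<close> from a direct summand \<open>N\<close> of a free module onto \<open>X\<close>, where \<open>h\<close> is a
  projection onto \<open>N\<close>, such that no smaller submodule maps onto \<open>X\<close>. This is a projective cover,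
  but realised inside a free module rather than in the type of the chosen representatives.\<close>

locale minimal_cover = artin_algebra k A \<phi>
  for k :: "('k, 'e) ring_scheme" and A :: "('a, 'c) ring_scheme" and \<phi> :: "'k \<Rightarrow> 'a" +
  fixes X :: "'a fgmod" and n :: nat and p :: "(nat \<Rightarrow> 'a) \<Rightarrow> (nat \<Rightarrow> 'a) set"
    and N :: "(nat \<Rightarrow> 'a) set" and h :: "(nat \<Rightarrow> 'a) \<Rightarrow> (nat \<Rightarrow> 'a)"
  assumes X: "fg_left_module A X"
    and p: "p \<in> module_hom A (free_module A n) X"
    and N: "submodule N A (free_module A n)"
    and surj: "p ` N = carrier X"
    and minimal: "\<And>T. submodule T A (free_module A n) \<Longrightarrow> T \<subseteq> N \<Longrightarrow> p ` T = carrier X \<Longrightarrow> T = N"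
    and h: "h \<in> module_hom A (free_module A n) ((free_module A n)\<lparr>carrier := N\<rparr>)"
    and h_id: "\<And>x. x \<in> N \<Longrightarrow> h x = x"

text \<open>Take \<open>N\<close> minimal with \<open>p N = X\<close>, and \<open>L\<close> minimal in the kernel \<open>K\<close> of \<open>p\<close> with
  \<open>N + L = F\<close>. Write the basis vectors as \<open>n\<^sub>i + l\<^sub>i\<close> and let \<open>h\<close> send the \<open>i\<close>-th one to \<open>n\<^sub>i\<close>.
  Then \<open>h\<close> is the identity modulo \<open>L\<close>, so that \<open>h N = N\<close> by minimality of \<open>N\<close>, and
  \<open>F = N + ker h\<close> with \<open>ker h \<subseteq> L\<close>, so that \<open>ker h = L\<close> by minimality of \<open>L\<close>. An element of
  \<open>N \<inter> L\<close> has the form \<open>h y\<close> with \<open>y \<in> L\<close>, and so it is zero.\<close>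

lemma (in artin_algebra) exists_minimal_cover:
  fixes X :: "'a fgmod"
  assumes X: "fg_left_module A X"
  obtains n p N h where "minimal_cover k A \<phi> X n p N h"
proof -
  have lX: "left_module A X" and fX: "fin_gen A X" using X by (auto simp: fg_left_module_def)
  interpret X: left_module A X by fact
  obtain n p where p: "p \<in> module_hom A (free_module A n) X" "p ` carrier (free_module A n) = carrier X"
    by (rule X.fin_gen_free_image[OF fX])
  define F where "F = free_module A n"
  have lF: "left_module A F" unfolding F_def by (rule A.free_left_module)
  interpret F: left_module A F by fact
  have pF: "p \<in> module_hom A F X" using p by (simp add: F_def)
  note hp = module_homD[OF pF]
  have dcc: "dcc_on A F (carrier F)"
    unfolding F_def by (rule fg_left_module_dcc[OF A.free_module_fg])
  define \<N> where "\<N> = {N. submodule N A F \<and> p ` N = carrier X}"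
  have "carrier F \<in> \<N>" using p F.submodule_carrier by (auto simp: \<N>_def F_def)
  then have "\<N> \<noteq> {}" by blast
  obtain N where "N \<in> \<N>" and "\<And>T. T \<in> \<N> \<Longrightarrow> T \<subseteq> N \<Longrightarrow> T = N"
    by (rule F.dcc_on_minimal[OF dcc _ \<open>\<N> \<noteq> {}\<close>]) (auto simp: \<N>_def)
  then have N: "submodule N A F" and surj: "p ` N = carrier X"
    and minN: "\<And>T. submodule T A F \<Longrightarrow> T \<subseteq> N \<Longrightarrow> p ` T = carrier X \<Longrightarrow> T = N"
    by (auto simp: \<N>_def)
  note sN = F.submoduleD[OF N]
  define K where "K = a_kernel F X p"
  have K: "submodule K A F" unfolding K_def by (rule submodule_a_kernel[OF lF lX pF])
  \<comment> \<open>the last condition expresses that \<open>N + L = F\<close>\<close>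
  define \<L> where "\<L> = {L. submodule L A F \<and> L \<subseteq> K \<and> (\<forall>x\<in>carrier F. \<exists>y\<in>N. x \<ominus>\<^bsub>F\<^esub> y \<in> L)}"
  have "\<exists>y\<in>N. x \<ominus>\<^bsub>F\<^esub> y \<in> K" if x: "x \<in> carrier F" for x
  proof -
    obtain y where y: "y \<in> N" "p x = p y" using surj hp(1)[OF x] by (metis imageE)
    have "p (x \<ominus>\<^bsub>F\<^esub> y) = p x \<ominus>\<^bsub>X\<^esub> p y"
      using x y sN(2) by (intro module_hom_diff[OF lF lX pF]) auto
    also have "\<dots> = \<zero>\<^bsub>X\<^esub>" using hp(1)[OF x] y(2) by (simp add: X.M.diff_eq_zero_iff)
    finally have "x \<ominus>\<^bsub>F\<^esub> y \<in> K" using x y sN(2) by (simp add: K_def a_kernel_iff)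
    then show ?thesis using y by blast
  qed
  then have "K \<in> \<L>" using K by (simp add: \<L>_def)
  then have "\<L> \<noteq> {}" by blast
  obtain L where "L \<in> \<L>" and min\<L>: "\<And>T. T \<in> \<L> \<Longrightarrow> T \<subseteq> L \<Longrightarrow> T = L"
    by (rule F.dcc_on_minimal[OF dcc _ \<open>\<L> \<noteq> {}\<close>]) (auto simp: \<L>_def)
  then have L: "submodule L A F" "L \<subseteq> K" and sum: "\<And>x. x \<in> carrier F \<Longrightarrow> \<exists>y\<in>N. x \<ominus>\<^bsub>F\<^esub> y \<in> L"
    by (auto simp: \<L>_def)
  have minL: "T = L" if "submodule T A F" "T \<subseteq> L" "\<forall>x\<in>carrier F. \<exists>y\<in>N. x \<ominus>\<^bsub>F\<^esub> y \<in> T" for T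
    using that L(2) by (intro min\<L>) (auto simp only: \<L>_def mem_Collect_eq)
  note sL = F.submoduleD[OF L(1)]
  have e: "unit_vector A n j \<in> carrier F" for j unfolding F_def by (rule A.unit_vector_closed)
  define g where "g j = (SOME y. y \<in> N \<and> unit_vector A n j \<ominus>\<^bsub>F\<^esub> y \<in> L)" for j
  have g: "g j \<in> N" "unit_vector A n j \<ominus>\<^bsub>F\<^esub> g j \<in> L" for j
    using someI_ex[of "\<lambda>y. y \<in> N \<and> unit_vector A n j \<ominus>\<^bsub>F\<^esub> y \<in> L"] sum[OF e[of j]]
    by (auto simp: g_def)
  define FN where "FN = F\<lparr>carrier := N\<rparr>"
  have FN [simp]: "carrier FN = N" "\<zero>\<^bsub>FN\<^esub> = \<zero>\<^bsub>F\<^esub>" "x \<oplus>\<^bsub>FN\<^esub> y = x \<oplus>\<^bsub>F\<^esub> y" "a \<odot>\<^bsub>FN\<^esub> x = a \<odot>\<^bsub>F\<^esub> x"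
    for a x y by (simp_all add: FN_def)
  interpret FN: left_module A FN unfolding FN_def by (rule F.submodule_left_module[OF N])
  have gFN: "g \<in> {..<n} \<rightarrow> carrier FN" using g by auto
  define h where "h = lincomb FN n g"
  have h: "h \<in> module_hom A F FN" unfolding h_def F_def by (rule FN.lincomb_hom[OF gFN])
  note hh = module_homD[OF h, simplified]
  have h': "h \<in> module_hom A F F" using hh sN(2) by (intro module_homI) auto
  have hL: "x \<ominus>\<^bsub>F\<^esub> h x \<in> L" if x: "x \<in> carrier F" for x
  proof -
    have "submodule {x \<in> carrier F. x \<ominus>\<^bsub>F\<^esub> h x \<in> L} A F"
    proof (rule F.submoduleI)
      show "\<zero>\<^bsub>F\<^esub> \<in> {x \<in> carrier F. x \<ominus>\<^bsub>F\<^esub> h x \<in> L}"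
        using module_hom_zero[OF lF lF h'] sL(3) by (simp add: F.M.diff_zero)
      fix x y assume "x \<in> {x \<in> carrier F. x \<ominus>\<^bsub>F\<^esub> h x \<in> L}" "y \<in> {x \<in> carrier F. x \<ominus>\<^bsub>F\<^esub> h x \<in> L}"
      then have x: "x \<in> carrier F" "x \<ominus>\<^bsub>F\<^esub> h x \<in> L" and y: "y \<in> carrier F" "y \<ominus>\<^bsub>F\<^esub> h y \<in> L" by auto
      note c = x(1) y(1) sN(2)[OF hh(1)[OF x(1)]] sN(2)[OF hh(1)[OF y(1)]]
      have "(x \<oplus>\<^bsub>F\<^esub> y) \<ominus>\<^bsub>F\<^esub> h (x \<oplus>\<^bsub>F\<^esub> y) = (x \<ominus>\<^bsub>F\<^esub> h x) \<oplus>\<^bsub>F\<^esub> (y \<ominus>\<^bsub>F\<^esub> h y)"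
        using c by (simp add: hh(2) a_minus_def F.M.minus_add F.M.a_ac)
      then show "x \<oplus>\<^bsub>F\<^esub> y \<in> {x \<in> carrier F. x \<ominus>\<^bsub>F\<^esub> h x \<in> L}"
        using c x y sL(4) by simp
    next
      fix a x assume a: "a \<in> carrier A" and "x \<in> {x \<in> carrier F. x \<ominus>\<^bsub>F\<^esub> h x \<in> L}"
      then have x: "x \<in> carrier F" "x \<ominus>\<^bsub>F\<^esub> h x \<in> L" by auto
      have hx: "h x \<in> carrier F" using sN(2)[OF hh(1)[OF x(1)]] .
      have mult: "(\<lambda>x. x \<ominus>\<^bsub>F\<^esub> h x) (a \<odot>\<^bsub>F\<^esub> x) = a \<odot>\<^bsub>F\<^esub> (x \<ominus>\<^bsub>F\<^esub> h x)"
      proof -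
        have "a \<odot>\<^bsub>F\<^esub> (\<ominus>\<^bsub>F\<^esub> h x) = \<ominus>\<^bsub>F\<^esub> (a \<odot>\<^bsub>F\<^esub> h x)"
        proof -
          have "a \<odot>\<^bsub>F\<^esub> (\<ominus>\<^bsub>F\<^esub> h x) \<oplus>\<^bsub>F\<^esub> a \<odot>\<^bsub>F\<^esub> h x = \<zero>\<^bsub>F\<^esub>"
            using a hx by (simp add: F.M.l_neg flip: F.smult_r_distr)
          then show ?thesis using a hx by (intro F.M.minus_equality[symmetric]) auto
        qed
        then show ?thesis using a x hx by (simp add: hh(3) a_minus_def F.smult_r_distr)
      qed
      then show "a \<odot>\<^bsub>F\<^esub> x \<in> {x \<in> carrier F. x \<ominus>\<^bsub>F\<^esub> h x \<in> L}"
        using a x sL(5) by simp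
    qed auto
    moreover have "unit_vector A n j \<in> {x \<in> carrier F. x \<ominus>\<^bsub>F\<^esub> h x \<in> L}" if "j < n" for j
      using e g(2)[of j] FN.lincomb_unit_vector[OF gFN that] by (simp add: h_def)
    ultimately have "carrier F \<subseteq> {x \<in> carrier F. x \<ominus>\<^bsub>F\<^esub> h x \<in> L}"
      unfolding F_def by (rule A.unit_vectors_generate)
    then show ?thesis using x by blast
  qed
  have ph: "p (h x) = p x" if x: "x \<in> carrier F" for x
  proof -
    have hx: "h x \<in> carrier F" using sN(2)[OF hh(1)[OF x]] .
    have "x \<ominus>\<^bsub>F\<^esub> h x \<in> K" using hL[OF x] L(2) by blast
    then have "p x \<ominus>\<^bsub>X\<^esub> p (h x) = \<zero>\<^bsub>X\<^esub>"
      using module_hom_diff[OF lF lX pF x hx] by (simp add: K_def a_kernel_iff)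
    then show ?thesis using hp(1) x hx by (simp add: X.M.diff_eq_zero_iff)
  qed
  have hN: "h ` N = N"
  proof (rule minN)
    show "submodule (h ` N) A F" by (rule submodule_image[OF lF lF h' N])
    show "h ` N \<subseteq> N" using hh(1) sN(2) by auto
    have "p ` h ` N = p ` N" using ph sN(2) by (simp add: image_image cong: image_cong)
    then show "p ` h ` N = carrier X" using surj by simp
  qed
  define H where "H = a_kernel F F h"
  have "H = L"
  proof (rule minL)
    show "submodule H A F" unfolding H_def by (rule submodule_a_kernel[OF lF lF h'])
    show "H \<subseteq> L"
    proof
      fix x assume "x \<in> H"
      then have "x \<in> carrier F" "h x = \<zero>\<^bsub>F\<^esub>" by (auto simp: H_def a_kernel_iff)
      then show "x \<in> L" using hL[of x] by (simp add: F.M.diff_zero)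
    qed
    show "\<forall>x\<in>carrier F. \<exists>y\<in>N. x \<ominus>\<^bsub>F\<^esub> y \<in> H"
    proof
      fix x assume x: "x \<in> carrier F"
      obtain y where y: "y \<in> N" "h x = h y" using hh(1)[OF x] hN by (metis imageE)
      have "h (x \<ominus>\<^bsub>F\<^esub> y) = h x \<ominus>\<^bsub>F\<^esub> h y"
        using x y sN(2) by (intro module_hom_diff[OF lF lF h']) auto
      also have "\<dots> = \<zero>\<^bsub>F\<^esub>" using sN(2)[OF hh(1)[OF x]] y(2) by (simp add: F.M.diff_eq_zero_iff)
      finally show "\<exists>y\<in>N. x \<ominus>\<^bsub>F\<^esub> y \<in> H" using x y sN(2) by (auto simp: H_def a_kernel_iff)
    qed
  qed
  have NL: "z = \<zero>\<^bsub>F\<^esub>" if z: "z \<in> N" "z \<in> L" for z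
  proof -
    obtain y where y: "y \<in> N" "z = h y" using z(1) hN by blast
    have yF: "y \<in> carrier F" using y sN(2) by blast
    have "(y \<ominus>\<^bsub>F\<^esub> h y) \<oplus>\<^bsub>F\<^esub> z \<in> L" using hL[OF yF] z(2) by (rule sL(4))
    then have "y \<in> L"
      using yF y(2) sN(2)[OF z(1)] by (simp add: a_minus_def F.M.a_assoc F.M.l_neg)
    then show ?thesis using y(2) \<open>H = L\<close> by (auto simp: H_def a_kernel_iff)
  qed
  have h_id: "h x = x" if x: "x \<in> N" for x
  proof -
    have xF: "x \<in> carrier F" "h x \<in> N" using x sN(2) hh(1) by auto
    have "x \<ominus>\<^bsub>F\<^esub> h x = \<zero>\<^bsub>F\<^esub>" using NL[OF sN(7)[OF x xF(2)] hL[OF xF(1)]] .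
    then show ?thesis using xF sN(2) by (simp add: F.M.diff_eq_zero_iff)
  qed
  have "minimal_cover k A \<phi> X n p N h"
    by (intro minimal_cover.intro minimal_cover_axioms.intro artin_algebra_axioms X surj h_id
        pF[unfolded F_def] N[unfolded F_def] minN[unfolded F_def] h[unfolded FN_def F_def])
  then show thesis by (rule that)
qed

context minimal_cover
begin

abbreviation F :: "('a, nat \<Rightarrow> 'a) module" where "F \<equiv> free_module A n"

text \<open>The submodule \<open>N\<close> of the free module as a module of its own.\<close>

definition FN :: "('a, nat \<Rightarrow> 'a) module" where "FN = F\<lparr>carrier := N\<rparr>"

sublocale F: left_module A F by (rule A.free_left_module)

sublocale FN: left_module A FN
  unfolding FN_def by (rule F.submodule_left_module[OF N])

sublocale X: left_module A X
  using X by (simp add: fg_left_module_def)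

lemma FN_simps [simp]:
  "carrier FN = N" "\<zero>\<^bsub>FN\<^esub> = \<zero>\<^bsub>F\<^esub>" "x \<oplus>\<^bsub>FN\<^esub> y = x \<oplus>\<^bsub>F\<^esub> y" "a \<odot>\<^bsub>FN\<^esub> x = a \<odot>\<^bsub>F\<^esub> x"
  by (simp_all add: FN_def)

lemma N_closed: "x \<in> N \<Longrightarrow> x \<in> carrier F"
  using F.submoduleD(2)[OF N] .

lemma N_coord: "x \<in> N \<Longrightarrow> j < n \<Longrightarrow> x j \<in> carrier A"
  using N_closed[of x] by auto

lemma submodule_FN_iff: "submodule T A FN \<longleftrightarrow> submodule T A F \<and> T \<subseteq> N"
  unfolding FN_def by (rule F.submodule_of_submodule_iff[OF N])

lemma FN_fg: "fg_left_module A FN"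
  unfolding FN_def by (rule fg_left_module_submodule[OF A.free_module_fg N])

lemma h_FN: "h \<in> module_hom A F FN"
  using h by (simp add: FN_def)

lemma p_FN: "p \<in> module_hom A FN X"
  using module_homD[OF p] N_closed by (intro module_homI) auto

text \<open>If a coordinate \<open>s j\<close> of an element \<open>s\<close> of the kernel avoided a maximal left ideal \<open>M\<close>, then
  every element of \<open>N\<close> could be moved by a multiple of \<open>s\<close> into the smaller submodule of those
  with \<open>j\<close>-th coordinate in \<open>M\<close>.\<close>

lemma kernel_coord_radical:
  assumes s: "s \<in> N" "p s = \<zero>\<^bsub>X\<^esub>" and j: "j < n"
  shows "s j \<in> jacobson_radical A"
proof -
  interpret reg: left_module A "regular_module A" by (rule A.regular_left_module)
  note sN = F.submoduleD[OF N] and hp = module_homD[OF p_FN, simplified]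
  have sj: "s j \<in> carrier A" using N_coord[OF s(1) j] .
  have "s j \<in> M" if M: "maximal_left_ideal M A" for M
  proof (rule ccontr)
    assume nM: "s j \<notin> M"
    note mM = A.maximal_left_idealD[OF M]
    note sM = reg.submoduleD[OF mM(1), simplified]
    \<comment> \<open>\<open>T\<close> is a proper submodule of \<open>N\<close>, as \<open>s \<notin> T\<close>, but it still maps onto \<open>X\<close>\<close>
    define T where "T = {x \<in> N. x j \<in> M}"
    have T: "submodule T A F"
      unfolding T_def using sN sM j by (intro F.submoduleI) auto
    have sj': "s j \<in> carrier (regular_module A)" using sj by simp
    note cyc = reg.submodule_cyclic[OF sj']
    have W: "M <+>\<^bsub>regular_module A\<^esub> {a \<odot>\<^bsub>regular_module A\<^esub> s j | a. a \<in> carrier A} = carrier A"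
      using mM(4)[OF reg.submodule_set_add[OF mM(1) cyc] reg.set_add_upper1[OF mM(1) cyc]]
        reg.set_add_upper2[OF mM(1) cyc] reg.cyclic_self[OF sj'] nM by blast
    have "carrier X \<subseteq> p ` T"
    proof
      fix y assume "y \<in> carrier X"
      then obtain x where x: "x \<in> N" "y = p x" using surj by blast
      have xj: "x j \<in> carrier A" using N_coord[OF x(1) j] .
      then have "x j \<in> M <+>\<^bsub>regular_module A\<^esub> {a \<odot>\<^bsub>regular_module A\<^esub> s j | a. a \<in> carrier A}"
        by (simp only: W)
      then obtain m a where m: "m \<in> M" "a \<in> carrier A" "x j = m \<oplus>\<^bsub>A\<^esub> a \<otimes>\<^bsub>A\<^esub> s j"
        by (auto elim!: reg.set_addE)
      define z where "z = x \<oplus>\<^bsub>F\<^esub> (\<ominus>\<^bsub>A\<^esub> a) \<odot>\<^bsub>F\<^esub> s"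
      have as: "(\<ominus>\<^bsub>A\<^esub> a) \<odot>\<^bsub>F\<^esub> s \<in> N" using m s by (intro sN(5)) auto
      have "z \<in> N" unfolding z_def by (rule sN(4)[OF x(1) as])
      have "z j = x j \<oplus>\<^bsub>A\<^esub> (\<ominus>\<^bsub>A\<^esub> a) \<otimes>\<^bsub>A\<^esub> s j" using j by (simp add: z_def)
      also have "\<dots> = m"
        using m sM(2)[OF m(1)] sj by (simp add: A.l_minus A.a_assoc A.r_neg)
      finally have "z \<in> T" using \<open>z \<in> N\<close> m by (simp add: T_def)
      have "p z = p x \<oplus>\<^bsub>X\<^esub> p ((\<ominus>\<^bsub>A\<^esub> a) \<odot>\<^bsub>F\<^esub> s)"
        unfolding z_def by (rule module_homD(2)[OF p N_closed[OF x(1)] N_closed[OF as]])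
      also have "p ((\<ominus>\<^bsub>A\<^esub> a) \<odot>\<^bsub>F\<^esub> s) = \<zero>\<^bsub>X\<^esub>"
        using hp(3)[of "\<ominus>\<^bsub>A\<^esub> a" s] m s by simp
      finally have "p z = y" using x hp(1) by simp
      then show "y \<in> p ` T" using \<open>z \<in> T\<close> by blast
    qed
    moreover have "p ` T \<subseteq> carrier X" using hp(1) by (auto simp: T_def)
    ultimately have "T = N" using minimal[OF T] by (auto simp: T_def)
    then show False using s(1) nM by (auto simp: T_def)
  qed
  then show ?thesis using sj by (auto simp: jacobson_radical_def)
qed

text \<open>The submodule \<open>J\<^sup>t N\<close> for the radical \<open>J\<close>. As \<open>N\<close> is a direct summand of a free module, it
  consists of the elements of \<open>N\<close> with all coordinates in \<open>J\<^sup>t\<close>.\<close>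

definition rad_layer :: "nat \<Rightarrow> (nat \<Rightarrow> 'a) set" where
  "rad_layer t = {x \<in> N. \<forall>j<n. x j \<in> radical_power A t}"

lemma rad_layer_submodule: "submodule (rad_layer t) A FN"
proof -
  interpret reg: left_module A "regular_module A" by (rule A.regular_left_module)
  note r = reg.submoduleD[OF A.ideal_imp_submodule_regular[OF A.radical_power_ideal], simplified]
  note sN = F.submoduleD[OF N]
  show ?thesis
    using sN r by (intro FN.submoduleI) (auto simp: rad_layer_def)
qed

lemma rad_layer_loewy_length: "rad_layer (loewy_length A) = {\<zero>\<^bsub>F\<^esub>}"
proof
  show "rad_layer (loewy_length A) \<subseteq> {\<zero>\<^bsub>F\<^esub>}"
  proof
    fix x assume "x \<in> rad_layer (loewy_length A)"
    then have "x \<in> carrier F" "\<And>j. j < n \<Longrightarrow> x j = \<zero>\<^bsub>A\<^esub>"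
      using N_closed by (auto simp: rad_layer_def radical_power_loewy_length)
    then have "x = \<zero>\<^bsub>F\<^esub>"
      using F.M.zero_closed by (intro PiE_ext[of x "{..<n}" "\<lambda>_. carrier A"]) auto
    then show "x \<in> {\<zero>\<^bsub>F\<^esub>}" by simp
  qed
  show "{\<zero>\<^bsub>F\<^esub>} \<subseteq> rad_layer (loewy_length A)"
    using FN.submoduleD(3)[OF rad_layer_submodule] by simp
qed

lemma rad_layer_smult_kernel:
  assumes x: "x \<in> N" "p x = \<zero>\<^bsub>X\<^esub>" and w: "w \<in> radical_power A t"
  shows "w \<odot>\<^bsub>F\<^esub> x \<in> rad_layer (Suc t)"
proof -
  have "w \<odot>\<^bsub>F\<^esub> x \<in> N" using F.submoduleD(5)[OF N] x w by auto
  moreover have "(w \<odot>\<^bsub>F\<^esub> x) j \<in> radical_power A (Suc t)" if "j < n" for j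
    using A.radical_power_mult_radical[OF w kernel_coord_radical[OF x that]] that by simp
  ultimately show ?thesis by (simp add: rad_layer_def)
qed

text \<open>If \<open>J\<^sup>t X = 0\<close>, then the cover factors through \<open>N / J\<^sup>t N\<close>.\<close>

lemma rad_layer_killed:
  assumes kill: "\<And>w x. w \<in> radical_power A t \<Longrightarrow> x \<in> carrier X \<Longrightarrow> w \<odot>\<^bsub>X\<^esub> x = \<zero>\<^bsub>X\<^esub>"
    and x: "x \<in> rad_layer t"
  shows "p x = \<zero>\<^bsub>X\<^esub>"
proof -
  define g where "g j = p (unit_vector A n j)" for j
  have g: "g \<in> {..<n} \<rightarrow> carrier X"
    using module_homD(1)[OF p A.unit_vector_closed] by (simp add: g_def)
  have xF: "x \<in> carrier F" using x N_closed by (simp add: rad_layer_def)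
  have "p x = lincomb X n g x"
    using X.lincomb_unit_vector[OF g]
    by (intro A.free_module_hom_eqI[OF X.left_module_axioms p X.lincomb_hom[OF g] _ xF])
      (simp add: g_def)
  also have "\<dots> = (\<Oplus>\<^bsub>X\<^esub>i\<in>{..<n}. \<zero>\<^bsub>X\<^esub>)"
    unfolding lincomb_def using x g kill
    by (intro X.M.finsum_cong') (auto simp: rad_layer_def Pi_iff)
  finally show ?thesis by simp
qed

text \<open>The quotient \<open>N / J\<^sup>t N\<close>, on the cosets in the free module. For \<open>t\<close> the Loewy length of \<open>A\<close>
  it is a copy of \<open>N\<close>.\<close>

definition Q :: "nat \<Rightarrow> 'a fgmod" where
  "Q t = quotient_module FN (rad_layer t)"

lemma quotient: "module_quotient A FN (rad_layer t)"
  by (intro module_quotient.intro module_quotient_axioms.intro FN.left_module_axioms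
      rad_layer_submodule)

lemma Q_fg: "fg_left_module A (Q t)"
  unfolding Q_def using module_quotient.quotient_fg[OF quotient] FN_fg
  by (simp add: fg_left_module_def)

lemma Q_left_module: "left_module A (Q t)"
  using Q_fg by (simp add: fg_left_module_def)

text \<open>The class of an element of \<open>N\<close> in the quotient \<open>Q t\<close>.\<close>

definition coset :: "nat \<Rightarrow> (nat \<Rightarrow> 'a) \<Rightarrow> (nat \<Rightarrow> 'a) set" where
  "coset t x = rad_layer t +>\<^bsub>FN\<^esub> x"

lemma coset_hom: "coset t \<in> module_hom A FN (Q t)"
  using module_quotient.coset_hom[OF quotient] by (simp add: Q_def coset_def[abs_def])

lemma carrier_Q: "carrier (Q t) = coset t ` N"
  by (simp add: Q_def coset_def quotient_module_carrier)

lemma coset_eq_zero: "x \<in> N \<Longrightarrow> coset t x = \<zero>\<^bsub>Q t\<^esub> \<longleftrightarrow> x \<in> rad_layer t"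
  using module_quotient.coset_eq_zero_iff[OF quotient]
  by (simp add: Q_def coset_def quotient_module_zero)

lemma Q_lift:
  assumes "left_module A Y" "f \<in> module_hom A FN Y" "\<And>x. x \<in> rad_layer t \<Longrightarrow> f x = \<zero>\<^bsub>Y\<^esub>"
  obtains g where "g \<in> module_hom A (Q t) Y" "\<And>x. x \<in> N \<Longrightarrow> g (coset t x) = f x"
  using module_quotient.quotient_lift[OF quotient assms] by (auto simp: Q_def coset_def)

lemma Q_cover:
  assumes "\<And>w x. w \<in> radical_power A t \<Longrightarrow> x \<in> carrier X \<Longrightarrow> w \<odot>\<^bsub>X\<^esub> x = \<zero>\<^bsub>X\<^esub>"
  obtains q where "q \<in> module_hom A (Q t) X" "\<And>x. x \<in> N \<Longrightarrow> q (coset t x) = p x"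
proof -
  have "p x = \<zero>\<^bsub>X\<^esub>" if "x \<in> rad_layer t" for x
    using assms that by (rule rad_layer_killed)
  then show thesis using Q_lift[OF X.left_module_axioms p_FN] that by blast
qed

lemma Q_cover_surj:
  assumes "\<And>x. x \<in> N \<Longrightarrow> q (coset t x) = p x"
  shows "q ` carrier (Q t) = carrier X"
  unfolding carrier_Q using assms surj by (simp add: image_image cong: image_cong)

text \<open>The kernel of \<open>N \<rightarrow> X\<close> lies in \<open>J N\<close>, so that \<open>J\<^sup>t\<close> moves it into \<open>J\<^sup>t\<^sup>+\<^sup>1 N\<close>.\<close>

lemma Q_kernel_killed:
  assumes q: "\<And>x. x \<in> N \<Longrightarrow> q (coset (Suc t) x) = p x"
    and w: "w \<in> radical_power A t" and y: "y \<in> a_kernel (Q (Suc t)) X q"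
  shows "w \<odot>\<^bsub>Q (Suc t)\<^esub> y = \<zero>\<^bsub>Q (Suc t)\<^esub>"
proof -
  obtain x where x: "x \<in> N" "y = coset (Suc t) x" "p x = \<zero>\<^bsub>X\<^esub>"
    using y q by (auto simp: a_kernel_iff carrier_Q)
  have wx: "w \<odot>\<^bsub>F\<^esub> x \<in> rad_layer (Suc t)" by (rule rad_layer_smult_kernel[OF x(1,3) w])
  have "w \<odot>\<^bsub>Q (Suc t)\<^esub> y = coset (Suc t) (w \<odot>\<^bsub>FN\<^esub> x)"
    using module_homD(3)[OF coset_hom[of "Suc t"], of w x] x w by simp
  then show ?thesis
    using wx coset_eq_zero[of "w \<odot>\<^bsub>F\<^esub> x" "Suc t"] by (simp add: rad_layer_def)
qed

lemma Q_projective: "projective_module A (Q (loewy_length A))"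
  unfolding projective_module_def
proof (intro conjI allI impI)
  let ?l = "loewy_length A"
  show "fg_left_module A (Q ?l)" by (rule Q_fg)
  fix M M' :: "'a fgmod" and f g
  assume M: "fg_left_module A M" and M': "fg_left_module A M'" and f: "f \<in> module_hom A M M'"
    and fsurj: "f ` carrier M = carrier M'" and g: "g \<in> module_hom A (Q ?l) M'"
  interpret M: left_module A M using M by (simp add: fg_left_module_def)
  interpret M': left_module A M' using M' by (simp add: fg_left_module_def)
  \<comment> \<open>extend \<open>g\<close> along \<open>h\<close> to the free module, lift it there on the unit vectors, and restrict
    the lift to \<open>N\<close>\<close>
  define g' where "g' x = g (coset ?l (h x))" for x
  have g': "g' \<in> module_hom A F M'"
    unfolding g'_def by (rule module_hom_compose[OF module_hom_compose[OF h_FN coset_hom] g])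
  have "\<exists>y. y \<in> carrier M \<and> f y = g' (unit_vector A n j)" for j
    using module_homD(1)[OF g' A.unit_vector_closed] fsurj by (metis imageE)
  then obtain m where m: "\<And>j. m j \<in> carrier M" "\<And>j. f (m j) = g' (unit_vector A n j)" by metis
  have m': "m \<in> {..<n} \<rightarrow> carrier M" using m by simp
  note lc = M.lincomb_hom[OF m']
  have eq: "f (lincomb M n m x) = g' x" if "x \<in> carrier F" for x
    using M.lincomb_unit_vector[OF m'] m(2)
    by (intro A.free_module_hom_eqI[OF M'.left_module_axioms module_hom_compose[OF lc f] g' _ that]) simp
  have "lincomb M n m \<in> module_hom A FN M"
    using module_homD[OF lc] N_closed by (intro module_homI) auto
  moreover have "lincomb M n m x = \<zero>\<^bsub>M\<^esub>" if "x \<in> rad_layer ?l" for x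
    using that module_hom_zero[OF F.left_module_axioms M.left_module_axioms lc]
    by (simp add: rad_layer_loewy_length)
  ultimately obtain r where r: "r \<in> module_hom A (Q ?l) M" "\<And>x. x \<in> N \<Longrightarrow> r (coset ?l x) = lincomb M n m x"
    using Q_lift[OF M.left_module_axioms] by blast
  have "f (r y) = g y" if "y \<in> carrier (Q ?l)" for y
  proof -
    obtain x where x: "x \<in> N" "y = coset ?l x" using \<open>y \<in> carrier (Q ?l)\<close> by (auto simp: carrier_Q)
    then show ?thesis using r(2) eq[OF N_closed[OF x(1)]] h_id[OF x(1)] by (simp add: g'_def)
  qed
  then show "\<exists>r\<in>module_hom A (Q ?l) M. \<forall>x\<in>carrier (Q ?l). f (r x) = g x" using r(1) by blast
qed

lemma Q_projective_cover:
  assumes q: "q \<in> module_hom A (Q (loewy_length A)) X"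
    and qp: "\<And>x. x \<in> N \<Longrightarrow> q (coset (loewy_length A) x) = p x"
  shows "projective_cover A (Q (loewy_length A)) X q"
  unfolding projective_cover_def
proof (intro conjI allI impI Q_projective q Q_cover_surj qp)
  let ?Q = "Q (loewy_length A)"
  interpret Q: left_module A ?Q by (rule Q_left_module)
  fix T assume "submodule T A ?Q \<and> T <+>\<^bsub>?Q\<^esub> a_kernel ?Q X q = carrier ?Q"
  then have T: "submodule T A ?Q" and sum: "T <+>\<^bsub>?Q\<^esub> a_kernel ?Q X q = carrier ?Q" by auto
  note sT = Q.submoduleD[OF T] and hq = module_homD[OF q]
  define T' where "T' = {x \<in> N. coset (loewy_length A) x \<in> T}"
  have "submodule T' A FN"
    using submodule_preimage[OF FN.left_module_axioms Q_left_module coset_hom T]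
    by (simp add: T'_def)
  then have T': "submodule T' A F" "T' \<subseteq> N" by (auto simp: submodule_FN_iff)
  have "p ` T' = carrier X"
  proof
    show "p ` T' \<subseteq> carrier X" using surj by (auto simp: T'_def)
    show "carrier X \<subseteq> p ` T'"
    proof
      fix y assume "y \<in> carrier X"
      then obtain z where z: "z \<in> carrier ?Q" "y = q z" using Q_cover_surj[OF qp] by blast
      then obtain u v where u: "u \<in> T" "v \<in> a_kernel ?Q X q" "z = u \<oplus>\<^bsub>?Q\<^esub> v"
        using Q.set_addE[of z T "a_kernel ?Q X q"] unfolding sum by blast
      have "y = q u" using u z hq sT(2) by (auto simp: a_kernel_iff)
      moreover obtain x where "x \<in> N" "u = coset (loewy_length A) x"
        using sT(2)[OF u(1)] by (auto simp: carrier_Q)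
      ultimately show "y \<in> p ` T'" using u(1) qp by (auto simp: T'_def)
    qed
  qed
  then have "T' = N" using minimal[OF T'] by blast
  then have "carrier ?Q \<subseteq> T" by (auto simp: carrier_Q T'_def)
  then show "T = carrier ?Q" using sT(1) by blast
qed

end


section \<open>Resolutions by layers of the radical\<close>

context artin_algebra
begin

text \<open>The submodule \<open>J \<oplus> J\<^sup>2 \<oplus> \<dots> \<oplus> J\<^sup>m\<^sup>+\<^sup>1\<close> of \<open>A\<^sup>m\<^sup>+\<^sup>1\<close> for the radical \<open>J\<close>.\<close>

definition radical_powers_sum :: "nat \<Rightarrow> (nat \<Rightarrow> 'a) set" where
  "radical_powers_sum m = {x \<in> carrier (free_module A (Suc m)). \<forall>i\<le>m. x i \<in> radical_power A (Suc i)}"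

text \<open>The module \<open>A/J \<oplus> A/J\<^sup>2 \<oplus> \<dots> \<oplus> A/J\<^sup>m\<^sup>+\<^sup>1\<close>.\<close>

definition layer_module :: "nat \<Rightarrow> 'a fgmod" where
  "layer_module m = quotient_module (free_module A (Suc m)) (radical_powers_sum m)"

lemma radical_power_submodule_facts:
  shows "\<zero>\<^bsub>A\<^esub> \<in> radical_power A t"
    and "\<And>x y. x \<in> radical_power A t \<Longrightarrow> y \<in> radical_power A t \<Longrightarrow> x \<oplus>\<^bsub>A\<^esub> y \<in> radical_power A t"
    and "\<And>a x. a \<in> carrier A \<Longrightarrow> x \<in> radical_power A t \<Longrightarrow> a \<otimes>\<^bsub>A\<^esub> x \<in> radical_power A t"
proof -
  interpret reg: left_module A "regular_module A" by (rule A.regular_left_module)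
  note r = reg.submoduleD[OF A.ideal_imp_submodule_regular[OF A.radical_power_ideal], simplified]
  show "\<zero>\<^bsub>A\<^esub> \<in> radical_power A t"
    and "\<And>x y. x \<in> radical_power A t \<Longrightarrow> y \<in> radical_power A t \<Longrightarrow> x \<oplus>\<^bsub>A\<^esub> y \<in> radical_power A t"
    and "\<And>a x. a \<in> carrier A \<Longrightarrow> x \<in> radical_power A t \<Longrightarrow> a \<otimes>\<^bsub>A\<^esub> x \<in> radical_power A t"
    using r(3,4,5) by blast+
qed

lemma layer_quotient: "module_quotient A (free_module A (Suc m)) (radical_powers_sum m)"
proof -
  interpret G: left_module A "free_module A (Suc m)" by (rule A.free_left_module)
  have "submodule (radical_powers_sum m) A (free_module A (Suc m))"
  proof (rule G.submoduleI)
    show "radical_powers_sum m \<subseteq> carrier (free_module A (Suc m))"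
      by (auto simp: radical_powers_sum_def)
    show "\<zero>\<^bsub>free_module A (Suc m)\<^esub> \<in> radical_powers_sum m"
      using G.M.zero_closed radical_power_submodule_facts(1)
      by (simp add: radical_powers_sum_def less_Suc_eq_le del: radical_power.simps)
    fix x y assume x: "x \<in> radical_powers_sum m" and y: "y \<in> radical_powers_sum m"
    then have "x \<oplus>\<^bsub>free_module A (Suc m)\<^esub> y \<in> carrier (free_module A (Suc m))"
      unfolding radical_powers_sum_def by (intro G.M.add.m_closed) auto
    then show "x \<oplus>\<^bsub>free_module A (Suc m)\<^esub> y \<in> radical_powers_sum m"
      using x y radical_power_submodule_facts(2)
      by (simp add: radical_powers_sum_def less_Suc_eq_le del: radical_power.simps)
  next
    fix a x assume a: "a \<in> carrier A" and x: "x \<in> radical_powers_sum m"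
    then have "a \<odot>\<^bsub>free_module A (Suc m)\<^esub> x \<in> carrier (free_module A (Suc m))"
      unfolding radical_powers_sum_def by (intro G.smult_closed) auto
    then show "a \<odot>\<^bsub>free_module A (Suc m)\<^esub> x \<in> radical_powers_sum m"
      using a x radical_power_submodule_facts(3)
      by (simp add: radical_powers_sum_def less_Suc_eq_le del: radical_power.simps)
  qed
  then show ?thesis
    by (intro module_quotient.intro module_quotient_axioms.intro G.left_module_axioms)
qed

lemma layer_module_fg: "fg_left_module A (layer_module m)"
  unfolding layer_module_def using module_quotient.quotient_fg[OF layer_quotient] A.free_module_fg
  by (simp add: fg_left_module_def)

end

text \<open>\<open>N / J\<^sup>s\<^sup>+\<^sup>1 N\<close> is a direct summand of a power of \<open>A / J\<^sup>s\<^sup>+\<^sup>1\<close>: the inclusion of \<open>N\<close> into the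
  free module and the projection \<open>h\<close> are compatible with the quotients.\<close>

lemma (in minimal_cover) Q_in_add:
  assumes s: "s \<le> m"
  shows "in_add A (layer_module m) (Q (Suc s))"
proof -
  let ?G = "free_module A (Suc m)" and ?U = "layer_module m"
  interpret G: left_module A ?G by (rule A.free_left_module)
  interpret U: left_module A ?U using layer_module_fg by (simp add: fg_left_module_def)
  interpret Q: left_module A "Q (Suc s)" by (rule Q_left_module)
  define c where "c x = radical_powers_sum m +>\<^bsub>?G\<^esub> x" for x
  have c: "c \<in> module_hom A ?G ?U"
    using module_quotient.coset_hom[OF layer_quotient] by (simp add: layer_module_def c_def[abs_def])
  have c0: "c x = \<zero>\<^bsub>?U\<^esub>" if "x \<in> radical_powers_sum m" for x
    using module_quotient.coset_eq_zero_iff[OF layer_quotient, of x m] that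
    by (simp add: layer_module_def c_def quotient_module_zero radical_powers_sum_def)
  let ?e = "unit_vector A (Suc m) s"
  have e: "?e \<in> carrier ?G" by (rule A.unit_vector_closed)
  have "\<exists>\<alpha>. \<alpha> \<in> module_hom A (Q (Suc s)) ?U \<and> (\<forall>x\<in>N. \<alpha> (coset (Suc s) x) = c (x j \<odot>\<^bsub>?G\<^esub> ?e))"
    if j: "j < n" for j
  proof -
    have "(\<lambda>x. x j \<odot>\<^bsub>?G\<^esub> ?e) \<in> module_hom A FN ?G"
    proof (rule module_homI)
      fix x assume x: "x \<in> carrier FN"
      then have xj: "x j \<in> carrier A" using N_coord j by simp
      show "x j \<odot>\<^bsub>?G\<^esub> ?e \<in> carrier ?G" using xj e by (rule G.smult_closed)
      show "(x \<oplus>\<^bsub>FN\<^esub> y) j \<odot>\<^bsub>?G\<^esub> ?e = x j \<odot>\<^bsub>?G\<^esub> ?e \<oplus>\<^bsub>?G\<^esub> y j \<odot>\<^bsub>?G\<^esub> ?e" if y: "y \<in> carrier FN" for y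
      proof -
        have "y j \<in> carrier A" using N_coord y j by simp
        from G.smult_l_distr[OF xj this e] show ?thesis using j by simp
      qed
      show "(a \<odot>\<^bsub>FN\<^esub> x) j \<odot>\<^bsub>?G\<^esub> ?e = a \<odot>\<^bsub>?G\<^esub> (x j \<odot>\<^bsub>?G\<^esub> ?e)" if a: "a \<in> carrier A" for a
      proof -
        have "(a \<odot>\<^bsub>FN\<^esub> x) j = a \<otimes>\<^bsub>A\<^esub> x j" using j by simp
        then show ?thesis by (simp only: G.smult_assoc[OF a xj e])
      qed
    qed
    then have hom: "(\<lambda>x. c (x j \<odot>\<^bsub>?G\<^esub> ?e)) \<in> module_hom A FN ?U"
      by (rule module_hom_compose[OF _ c])
    have "c (x j \<odot>\<^bsub>?G\<^esub> ?e) = \<zero>\<^bsub>?U\<^esub>" if x: "x \<in> rad_layer (Suc s)" for x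
    proof (rule c0)
      have xj: "x j \<in> radical_power A (Suc s)" using x j by (simp add: rad_layer_def del: radical_power.simps)
      have "x j \<odot>\<^bsub>?G\<^esub> ?e \<in> carrier ?G"
        by (rule G.smult_closed[OF A.radical_power_closed[OF xj] e])
      then show "x j \<odot>\<^bsub>?G\<^esub> ?e \<in> radical_powers_sum m"
        using xj radical_power_submodule_facts(1)
        by (auto simp: radical_powers_sum_def unit_vector_def simp del: radical_power.simps)
    qed
    then obtain \<alpha> where "\<alpha> \<in> module_hom A (Q (Suc s)) ?U"
      "\<And>x. x \<in> N \<Longrightarrow> \<alpha> (coset (Suc s) x) = c (x j \<odot>\<^bsub>?G\<^esub> ?e)"
      using Q_lift[OF U.left_module_axioms hom] by blast
    then show ?thesis by blast
  qed
  then have "\<forall>j\<in>{..<n}. \<exists>\<alpha>. \<alpha> \<in> module_hom A (Q (Suc s)) ?U \<and>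
      (\<forall>x\<in>N. \<alpha> (coset (Suc s) x) = c (x j \<odot>\<^bsub>?G\<^esub> ?e))"
    by blast
  from bchoice[OF this] obtain \<alpha> where \<alpha>: "\<And>j. j < n \<Longrightarrow> \<alpha> j \<in> module_hom A (Q (Suc s)) ?U"
    "\<And>j x. j < n \<Longrightarrow> x \<in> N \<Longrightarrow> \<alpha> j (coset (Suc s) x) = c (x j \<odot>\<^bsub>?G\<^esub> ?e)"
    by blast
  define g where "g j = h (unit_vector A n j)" for j
  have gN: "g j \<in> N" for j
    using module_homD(1)[OF h_FN A.unit_vector_closed] by (simp add: g_def)
  have "\<exists>\<beta>. \<beta> \<in> module_hom A ?U (Q (Suc s)) \<and>
      (\<forall>u\<in>carrier ?G. \<beta> (c u) = coset (Suc s) (u s \<odot>\<^bsub>F\<^esub> g j))" for j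
  proof -
    define f where "f u = coset (Suc s) (u s \<odot>\<^bsub>FN\<^esub> g j)" for u
    have us: "u s \<in> carrier A" if "u \<in> carrier ?G" for u
      using s by (intro PiE_mem[OF that[unfolded free_module_simps]]) simp
    have "(\<lambda>u. u s \<odot>\<^bsub>FN\<^esub> g j) \<in> module_hom A ?G FN"
    proof (rule module_homI)
      fix u assume u: "u \<in> carrier ?G"
      show "u s \<odot>\<^bsub>FN\<^esub> g j \<in> carrier FN"
        using us[OF u] gN by (intro FN.smult_closed) auto
      show "(u \<oplus>\<^bsub>?G\<^esub> v) s \<odot>\<^bsub>FN\<^esub> g j = u s \<odot>\<^bsub>FN\<^esub> g j \<oplus>\<^bsub>FN\<^esub> v s \<odot>\<^bsub>FN\<^esub> g j" if v: "v \<in> carrier ?G" for v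
        using FN.smult_l_distr[OF us[OF u] us[OF v], of "g j"] gN s by simp
      show "(a \<odot>\<^bsub>?G\<^esub> u) s \<odot>\<^bsub>FN\<^esub> g j = a \<odot>\<^bsub>FN\<^esub> (u s \<odot>\<^bsub>FN\<^esub> g j)" if a: "a \<in> carrier A" for a
        using FN.smult_assoc[OF a us[OF u], of "g j"] gN s by simp
    qed
    from module_hom_compose[OF this coset_hom[of "Suc s"]]
    have hom: "f \<in> module_hom A ?G (Q (Suc s))" by (simp only: f_def[abs_def])
    have kill: "f u = \<zero>\<^bsub>Q (Suc s)\<^esub>" if u: "u \<in> radical_powers_sum m" for u
    proof -
      have uJ: "u s \<in> radical_power A (Suc s)" using u s by (simp add: radical_powers_sum_def del: radical_power.simps)
      have uN: "u s \<odot>\<^bsub>FN\<^esub> g j \<in> N"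
        using FN.smult_closed[OF A.radical_power_closed[OF uJ], of "g j"] gN by simp
      have "u s \<otimes>\<^bsub>A\<^esub> g j i \<in> radical_power A (Suc s)" if "i < n" for i
        using ideal.I_r_closed[OF A.radical_power_ideal uJ N_coord[OF gN that]] .
      then have "u s \<odot>\<^bsub>FN\<^esub> g j \<in> rad_layer (Suc s)"
        using uN by (simp add: rad_layer_def del: radical_power.simps)
      then show ?thesis unfolding f_def using coset_eq_zero[OF uN] by blast
    qed
    have "\<exists>\<beta>. \<beta> \<in> module_hom A ?U (Q (Suc s)) \<and> (\<forall>u\<in>carrier ?G. \<beta> (c u) = f u)"
    proof (rule module_quotient.quotient_lift[OF layer_quotient[of m] Q_left_module hom, OF kill])
      fix \<beta>
      assume "\<beta> \<in> module_hom A (quotient_module ?G (radical_powers_sum m)) (Q (Suc s))"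
        "\<And>u. u \<in> carrier ?G \<Longrightarrow> \<beta> (radical_powers_sum m +>\<^bsub>?G\<^esub> u) = f u"
      then show ?thesis unfolding c_def layer_module_def by blast
    qed
    then show ?thesis by (simp only: f_def FN_simps)
  qed
  then have "\<forall>j. \<exists>\<beta>. \<beta> \<in> module_hom A ?U (Q (Suc s)) \<and>
      (\<forall>u\<in>carrier ?G. \<beta> (c u) = coset (Suc s) (u s \<odot>\<^bsub>F\<^esub> g j))"
    by blast
  from choice[OF this] obtain \<beta> where \<beta>: "\<And>j. \<beta> j \<in> module_hom A ?U (Q (Suc s))"
    "\<And>j u. u \<in> carrier ?G \<Longrightarrow> \<beta> j (c u) = coset (Suc s) (u s \<odot>\<^bsub>F\<^esub> g j)"
    by blast
  show ?thesis
  proof (rule in_addI[OF Q_fg U.left_module_axioms \<alpha>(1) \<beta>(1)])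
    fix y assume "y \<in> carrier (Q (Suc s))"
    then obtain x where x: "x \<in> N" "y = coset (Suc s) x" by (auto simp: carrier_Q)
    have gFN: "g \<in> {..<n} \<rightarrow> carrier FN" using gN by simp
    have xg: "(\<lambda>j. x j \<odot>\<^bsub>FN\<^esub> g j) \<in> {..<n} \<rightarrow> carrier FN"
      using N_coord[OF x(1)] gN by (intro funcsetI FN.smult_closed) auto
    have "\<beta> j (\<alpha> j y) = coset (Suc s) (x j \<odot>\<^bsub>FN\<^esub> g j)" if j: "j < n" for j
    proof -
      have xj: "x j \<in> carrier A" using N_coord[OF x(1) j] .
      have "x j \<odot>\<^bsub>?G\<^esub> ?e \<in> carrier ?G" using xj e by (rule G.smult_closed)
      then have "\<beta> j (\<alpha> j y) = coset (Suc s) ((x j \<odot>\<^bsub>?G\<^esub> ?e) s \<odot>\<^bsub>F\<^esub> g j)"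
        using \<alpha>(2)[OF j x(1)] \<beta>(2) x(2) by simp
      moreover have "(x j \<odot>\<^bsub>?G\<^esub> ?e) s = x j" using xj s by (simp add: unit_vector_def)
      ultimately show ?thesis by simp
    qed
    then have "(\<Oplus>\<^bsub>Q (Suc s)\<^esub>j\<in>{..<n}. \<beta> j (\<alpha> j y)) =
        (\<Oplus>\<^bsub>Q (Suc s)\<^esub>j\<in>{..<n}. coset (Suc s) (x j \<odot>\<^bsub>FN\<^esub> g j))"
      using xg module_homD(1)[OF coset_hom] by (intro Q.M.finsum_cong') (auto simp: Pi_iff)
    also have "\<dots> = coset (Suc s) (lincomb FN n g x)"
      unfolding lincomb_def
      by (rule module_hom_finsum[OF FN.left_module_axioms Q_left_module coset_hom _ xg, symmetric]) simp
    also have "lincomb FN n g x = h x"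
    proof (rule A.free_module_hom_eqI[OF FN.left_module_axioms FN.lincomb_hom[OF gFN] h_FN])
      show "lincomb FN n g (unit_vector A n j) = h (unit_vector A n j)" if "j < n" for j
        using FN.lincomb_unit_vector[OF gFN that] by (simp only: g_def)
      show "x \<in> carrier F" by (rule N_closed[OF x(1)])
    qed
    finally show "(\<Oplus>\<^bsub>Q (Suc s)\<^esub>j\<in>{..<n}. \<beta> j (\<alpha> j y)) = y"
      using x h_id by simp
  qed
qed

context artin_algebra
begin

lemma layer_resolution:
  fixes Y :: "'a fgmod"
  assumes "s \<le> m" "fg_left_module A Y"
    and "\<And>w y. w \<in> radical_power A (Suc s) \<Longrightarrow> y \<in> carrier Y \<Longrightarrow> w \<odot>\<^bsub>Y\<^esub> y = \<zero>\<^bsub>Y\<^esub>"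
  shows "\<exists>V d. (\<forall>i\<le>s. in_add A (layer_module m) (V i)) \<and> exact_resolution A s V d Y"
  using assms
proof (induction s arbitrary: Y)
  case 0
  obtain n p N h where "minimal_cover k A \<phi> Y n p N h"
    using exists_minimal_cover[OF "0.prems"(2)] by blast
  then interpret C: minimal_cover k A \<phi> Y n p N h .
  obtain q where q: "q \<in> module_hom A (C.Q (Suc 0)) Y" "\<And>x. x \<in> N \<Longrightarrow> q (C.coset (Suc 0) x) = p x"
    using C.Q_cover[OF "0.prems"(3)] by blast
  interpret Q: left_module A "C.Q (Suc 0)" by (rule C.Q_left_module)
  have "inj_on q (carrier (C.Q (Suc 0)))"
  proof (rule inj_onI)
    fix x y assume x: "x \<in> carrier (C.Q (Suc 0))" and y: "y \<in> carrier (C.Q (Suc 0))" and eq: "q x = q y"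
    have xy: "x \<ominus>\<^bsub>C.Q (Suc 0)\<^esub> y \<in> carrier (C.Q (Suc 0))" using x y by simp
    have "q (x \<ominus>\<^bsub>C.Q (Suc 0)\<^esub> y) = q x \<ominus>\<^bsub>Y\<^esub> q y"
      by (rule module_hom_diff[OF Q.left_module_axioms C.X.left_module_axioms q(1) x y])
    also have "\<dots> = \<zero>\<^bsub>Y\<^esub>"
      using eq module_homD(1)[OF q(1) y] by (simp add: C.X.M.diff_eq_zero_iff)
    finally have "x \<ominus>\<^bsub>C.Q (Suc 0)\<^esub> y \<in> a_kernel (C.Q (Suc 0)) Y q" using xy by (simp add: a_kernel_iff)
    \<comment> \<open>the kernel is killed by the zeroth power of the radical, which contains the unit\<close>
    then have "\<one>\<^bsub>A\<^esub> \<odot>\<^bsub>C.Q (Suc 0)\<^esub> (x \<ominus>\<^bsub>C.Q (Suc 0)\<^esub> y) = \<zero>\<^bsub>C.Q (Suc 0)\<^esub>"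
      by (intro C.Q_kernel_killed[OF q(2)]) auto
    then show "x = y" using xy x y by (simp add: Q.M.diff_eq_zero_iff)
  qed
  then have "exact_resolution A 0 (\<lambda>_. C.Q (Suc 0)) (\<lambda>_. q) Y"
    using q(1) C.Q_cover_surj[OF q(2)] by (simp add: exact_resolution_def)
  then show ?case using C.Q_in_add[OF "0.prems"(1)]
    by (intro exI[of _ "\<lambda>_. C.Q (Suc 0)"] exI[of _ "\<lambda>_. q"]) simp
next
  case (Suc s)
  obtain n p N h where "minimal_cover k A \<phi> Y n p N h"
    using exists_minimal_cover[OF Suc.prems(2)] by blast
  then interpret C: minimal_cover k A \<phi> Y n p N h .
  define V0 where "V0 = C.Q (Suc (Suc s))"
  obtain q where q: "q \<in> module_hom A V0 Y" "\<And>x. x \<in> N \<Longrightarrow> q (C.coset (Suc (Suc s)) x) = p x"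
    using C.Q_cover[OF Suc.prems(3)] unfolding V0_def by blast
  define K where "K = V0\<lparr>carrier := a_kernel V0 Y q\<rparr>"
  have V0: "left_module A V0" unfolding V0_def by (rule C.Q_left_module)
  have K: "fg_left_module A K"
    unfolding K_def using C.Q_fg submodule_a_kernel[OF V0 C.X.left_module_axioms q(1)]
    by (intro fg_left_module_submodule) (simp_all add: V0_def)
  have "w \<odot>\<^bsub>K\<^esub> y = \<zero>\<^bsub>K\<^esub>" if "w \<in> radical_power A (Suc s)" "y \<in> carrier K" for w y
    using C.Q_kernel_killed[OF q(2) that(1), of y] that(2) by (simp add: K_def V0_def)
  then obtain V d where V: "\<And>i. i \<le> s \<Longrightarrow> in_add A (layer_module m) (V i)"
    and d: "exact_resolution A s V d K"
    using Suc.IH[OF Suc_leD[OF Suc.prems(1)] K] by blast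
  define V' where "V' i = (case i of 0 \<Rightarrow> V0 | Suc j \<Rightarrow> V j)" for i
  define d' where "d' i = (case i of 0 \<Rightarrow> q | Suc j \<Rightarrow> d j)" for i
  have [simp]: "V' 0 = V0" "\<And>i. V' (Suc i) = V i" "d' 0 = q" "\<And>i. d' (Suc i) = d i"
    by (simp_all add: V'_def d'_def)
  have "in_add A (layer_module m) (V' i)" if "i \<le> Suc s" for i
    using that V C.Q_in_add[OF Suc.prems(1)] by (cases i) (simp_all add: V0_def)
  moreover have "exact_resolution A (Suc s) V' d' Y"
    unfolding exact_resolution_def
  proof (intro conjI allI impI)
    note ex = d[unfolded exact_resolution_def]
    have carK: "carrier K = a_kernel V0 Y q" by (simp add: K_def)
    show "d' 0 \<in> module_hom A (V' 0) Y" using q(1) by simp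
    show "d' 0 ` carrier (V' 0) = carrier Y" using C.Q_cover_surj[OF q(2)] by (simp add: V0_def)
    show "inj_on (d' (Suc s)) (carrier (V' (Suc s)))" using ex by simp
    fix i assume i: "i < Suc s"
    show "d' (Suc i) \<in> module_hom A (V' (Suc i)) (V' i)"
    proof (cases i)
      case 0
      have "d 0 \<in> module_hom A (V 0) K" using ex by blast
      note d0 = module_homD[OF this]
      have "d 0 \<in> module_hom A (V 0) V0"
        using d0 carK by (intro module_homI) (auto simp: K_def a_kernel_iff)
      then show ?thesis using 0 by simp
    next
      case (Suc j)
      then show ?thesis using ex i by simp
    qed
    show "d' (Suc i) ` carrier (V' (Suc i)) =
        a_kernel (V' i) (case i of 0 \<Rightarrow> Y | Suc j \<Rightarrow> V' j) (d' i)"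
    proof (cases i)
      case 0
      then show ?thesis using ex carK by simp
    next
      case (Suc j)
      have "a_kernel (V j) K (d j) = a_kernel (V j) V0 (d j)"
        by (simp add: set_eq_iff a_kernel_iff K_def)
      then show ?thesis using ex i Suc by (cases j) (simp_all)
    qed
  qed
  ultimately show ?case by blast
qed

text \<open>A syzygy lies in the radical of a projective module, so that it is killed by one power of
  the radical less than the algebra.\<close>

lemma exists_killed_syzygy:
  fixes X :: "'a fgmod"
  assumes X: "fg_left_module A X" and l: "loewy_length A = Suc t"
  obtains Y where "syzygy A X Y" "fg_left_module A Y"
    "\<And>w y. w \<in> radical_power A t \<Longrightarrow> y \<in> carrier Y \<Longrightarrow> w \<odot>\<^bsub>Y\<^esub> y = \<zero>\<^bsub>Y\<^esub>"
proof -
  obtain n p N h where "minimal_cover k A \<phi> X n p N h"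
    using exists_minimal_cover[OF X] by blast
  then interpret C: minimal_cover k A \<phi> X n p N h .
  have "w \<odot>\<^bsub>X\<^esub> x = \<zero>\<^bsub>X\<^esub>" if "w \<in> radical_power A (Suc t)" "x \<in> carrier X" for w x
    using that radical_power_loewy_length unfolding l by (simp del: radical_power.simps)
  then obtain q where q: "q \<in> module_hom A (C.Q (Suc t)) X"
    "\<And>x. x \<in> N \<Longrightarrow> q (C.coset (Suc t) x) = p x"
    using C.Q_cover by blast
  define Y where "Y = (C.Q (Suc t))\<lparr>carrier := a_kernel (C.Q (Suc t)) X q\<rparr>"
  show thesis
  proof (rule that)
    show "syzygy A X Y"
      unfolding syzygy_def Y_def using C.Q_projective_cover[unfolded l, OF q] by blast
    show "fg_left_module A Y"
      unfolding Y_def using submodule_a_kernel[OF C.Q_left_module C.X.left_module_axioms q(1)]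
      by (rule fg_left_module_submodule[OF C.Q_fg])
    show "w \<odot>\<^bsub>Y\<^esub> y = \<zero>\<^bsub>Y\<^esub>" if "w \<in> radical_power A t" "y \<in> carrier Y" for w y
      using C.Q_kernel_killed[OF q(2) that(1), of y] that(2) by (simp add: Y_def)
  qed
qed

lemma igusa_todorov_algebraI:
  assumes "\<And>X :: 'a fgmod. fg_left_module A X \<Longrightarrow>
    \<exists>Y. nth_syzygy A n X Y \<and> fg_left_module A Y \<and>
      (\<forall>w\<in>radical_power A (Suc m). \<forall>y\<in>carrier Y. w \<odot>\<^bsub>Y\<^esub> y = \<zero>\<^bsub>Y\<^esub>)"
  shows "igusa_todorov_algebra m n A"
  unfolding igusa_todorov_algebra_def
proof (rule exI[of _ "layer_module m"], intro conjI allI impI)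
  show "fg_left_module A (layer_module m)" by (rule layer_module_fg)
  fix X :: "'a fgmod" assume "fg_left_module A X"
  then obtain Y where Y: "nth_syzygy A n X Y" "fg_left_module A Y"
    "\<And>w y. w \<in> radical_power A (Suc m) \<Longrightarrow> y \<in> carrier Y \<Longrightarrow> w \<odot>\<^bsub>Y\<^esub> y = \<zero>\<^bsub>Y\<^esub>"
    using assms by blast
  then show "\<exists>Y V d. nth_syzygy A n X Y \<and> (\<forall>i\<le>m. in_add A (layer_module m) (V i)) \<and>
      exact_resolution A m V d Y"
    using layer_resolution[OF order_refl Y(2,3)] by blast
qed

end

theorem theorem1p1:
  fixes k :: "('k, 'e) ring_scheme" and A :: "('a, 'c) ring_scheme" and \<phi> :: "'k \<Rightarrow> 'a"
  assumes "artin_algebra k A \<phi>"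
  shows "IT_dist A \<le> enat (nat (max (int (loewy_length A) - 2) 0))"
proof -
  interpret artin_algebra k A \<phi> by fact
  define m where "m = loewy_length A - 2"
  have m: "nat (max (int (loewy_length A) - 2) 0) = m" by (simp add: m_def)
  have "\<exists>n. igusa_todorov_algebra m n A"
  proof (cases "loewy_length A \<le> 1")
    case True
    have "radical_power A (Suc m) \<subseteq> {\<zero>\<^bsub>A\<^esub>}"
      using A.radical_power_antimono[of "loewy_length A" "Suc m"] True radical_power_loewy_length by simp
    then have kill: "w \<odot>\<^bsub>X\<^esub> x = \<zero>\<^bsub>X\<^esub>"
      if "fg_left_module A X" "w \<in> radical_power A (Suc m)" "x \<in> carrier X" for X :: "'a fgmod" and w x
      using that left_module.smult_zero_left[of A X x] by (auto simp: fg_left_module_def)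
    \<comment> \<open>every module is killed by the radical, so that no syzygy is needed\<close>
    have "igusa_todorov_algebra m 0 A"
      using kill by (intro igusa_todorov_algebraI) auto
    then show ?thesis ..
  next
    case False
    then have l: "loewy_length A = Suc (Suc m)" by (simp add: m_def)
    \<comment> \<open>the first syzygy is killed by the power \<open>m + 1\<close> of the radical\<close>
    have "igusa_todorov_algebra m 1 A"
    proof (rule igusa_todorov_algebraI)
      fix X :: "'a fgmod" assume X: "fg_left_module A X"
      obtain Y where "syzygy A X Y" "fg_left_module A Y"
        "\<And>w y. w \<in> radical_power A (Suc m) \<Longrightarrow> y \<in> carrier Y \<Longrightarrow> w \<odot>\<^bsub>Y\<^esub> y = \<zero>\<^bsub>Y\<^esub>"
        using exists_killed_syzygy[OF X l] by blast
      then show "\<exists>Y. nth_syzygy A 1 X Y \<and> fg_left_module A Y \<and>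
          (\<forall>w\<in>radical_power A (Suc m). \<forall>y\<in>carrier Y. w \<odot>\<^bsub>Y\<^esub> y = \<zero>\<^bsub>Y\<^esub>)"
        by auto
    qed
    then show ?thesis ..
  qed
  then have "enat m \<in> {enat m | m. \<exists>n. igusa_todorov_algebra m n A}" by blast
  then have "IT_dist A \<le> enat m" unfolding IT_dist_def by (rule Inf_lower)
  then show ?thesis by (simp only: m)
qed

end
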